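(* Let $q\ge 2$ be an integer and consider the $(q+1)$-stage IMEX Runge-Kutta method determined, as described in the context, by real coefficients $\alpha_1,\dots,\alpha_q$, $\beta_1,\dots,\beta_{q-1}$, $\hat\alpha_1,\dots,\hat\alpha_q$, $\hat\beta_1,\dots,\hat\beta_{q-1}$, $\hat d_1,\dots,\hat d_{q-1}$. Use the convention that $\alpha_k,\hat\alpha_k,\beta_k,\hat\beta_k,\hat d_k$ equal $0$ when $k\le 0$. Then: 1. The method is second order accurate if and only if $$\alpha_q(\beta_{q-2}+\alpha_{q-1})=\alpha_q(\hat\beta_{q-2}+\hat\alpha_{q-1}+\hat d_{q-1})=\tfrac12,$$ $$\hat\alpha_q(\hat\beta_{q-2}+\hat\alpha_{q-1}+\hat d_{q-1})=\hat\alpha_q(\beta_{q-2}+\alpha_{q-1})=\tfrac12,$$ $$\alpha_q+\beta_{q-1}=1=\hat\alpha_q+\hat\beta_{q-1}.$$ If $\beta_{q-1}=\hat\beta_{q-1}=\beta_{q-2}=\hat\beta_{q-2}=0$, then this system of conditions is equivalent to $\alpha_q=1=\hat\alpha_q$, $\alpha_{q-1}=\tfrac12$, and $\hat\alpha_{q-1}+\hat d_{q-1}=\tfrac12$. 2. The method is third order accurate if and only if $\alpha_q=\tfrac34=\hat\alpha_q$, $\beta_{q-1}=\tfrac14=\hat\beta_{q-1}$, and $$\hat\alpha_{q-1}(\hat\alpha_{q-2}+\hat d_{q-2}+\hat\beta_{q-3})+\tfrac23\hat d_{q-1}=\tfrac29,$$ $$\hat\alpha_{q-1}(\alpha_{q-2}+\beta_{q-3})+\tfrac23\hat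 d_{q-1}=\tfrac29,$$ $$\alpha_{q-1}(\hat\alpha_{q-2}+\hat d_{q-2}+\hat\beta_{q-3})=\tfrac29=\alpha_{q-1}(\alpha_{q-2}+\beta_{q-3}),$$ $$\hat\alpha_{q-1}+\hat d_{q-1}+\hat\beta_{q-2}=\tfrac23=\alpha_{q-1}+\beta_{q-2}.$$
   Context: IMEX Runge-Kutta methods. Consider additively partitioned ODEs $\dot x=n(x,t)+s(x,t)$ with $n,s:\mathbb R^d\times\mathbb R\to\mathbb R^d$, $d\in\mathbb N$. Given $r\in\mathbb N$, $b,\hat b,c,\hat c\in\mathbb R^r$, a strictly lower triangular $A\in\mathbb R^{r\times r}$ and a lower triangular $\hat A\in\mathbb R^{r\times r}$, the $r$-stage IMEX Runge-Kutta method with step-size $\Delta t>0$ is $$x_{m+1}=x_m+\Delta t\sum_{k=1}^r\big(b_k n_{m,k}+\hat b_k s_{m,k}\big),$$ $$g_{m,j}=x_m+\Delta t\sum_{k=1}^{j-1}\big(A_{j,k}n_{m,k}+\hat A_{j,k}s_{m,k}\big)+\Delta t\,\hat A_{j,j}s_{m,j},\quad j=1,\dots,r,$$ where $n_{m,k}=n(g_{m,k},t_m+c_k\Delta t)$, $s_{m,k}=s(g_{m,k},t_m+\hat c_k\Delta t)$, $t_m=t_0+m\Delta t$. The family considered. For an integer $q\ge2$ and real coefficients $\alpha_1,\dots,\alpha_q$, $\beta_1,\dots,\beta_{q-1}$, $\hat\alpha_1,\dots,\hat\alpha_q$, $\hat\beta_1,\dots,\hat\beta_{q-1}$, $\hat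 d_1,\dots,\hat d_{q-1}$, take $r=q+1$ and (rows and columns indexed $1,\dots,q+1$): - $A_{j+1,j}=\alpha_j$ for $1\le j\le q$, $A_{j+1,1}=\beta_{j-1}$ for $2\le j\le q$, all other entries of $A$ zero; - $\hat A_{j+1,j}=\hat\alpha_j$ for $1\le j\le q$, $\hat A_{j+1,1}=\hat\beta_{j-1}$ for $2\le j\le q$, $\hat A_{j+1,j+1}=\hat d_j$ for $1\le j\le q-1$, all other entries of $\hat A$ zero (in particular $\hat A_{1,1}=\hat A_{q+1,q+1}=0$); - $b_j=A_{q+1,j}$ and $\hat b_j=\hat A_{q+1,j}$ for $1\le j\le q+1$; - $c=A\mathbf 1$ and $\hat c=\hat A\mathbf 1$, where $\mathbf 1=(1,\dots,1)^T\in\mathbb R^{q+1}$. Order of accuracy. The method is called $p$-th order accurate (meaning of order at least $p$) if for every $d$, all sufficiently smooth $n,s$, and every initial condition $x(t_0)=x_0$, the result $x_1$ of one step satisfies $x_1-x(t_0+\Delta t)=O(\Delta t^{p+1})$ as $\Delta t\to0^+$, where $x(\cdot)$ is the exact solution (for small $\Delta t$ the implicit stages are the unique solutions near $x_0$). *)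

theory Defs
  imports
    "HOL-Analysis.Analysis"
    "HOL-Analysis.Abstract_Euclidean_Space"
    "HOL-Library.Landau_Symbols"
begin

text \<open>
  The order of accuracy quantifies over all dimensions \<open>d\<close> inside a formula, so
  \<open>d\<close> cannot be a type. A vector of \<open>R^d\<close> is a sequence \<open>x\<close>
  with \<open>x i = 0\<close> for \<open>i \<ge> d\<close>; these sequences form the carrier of the
  library topology \<^term>\<open>Euclidean_space d\<close>, and the components are numbered from 0.
  The Euclidean norm of \<open>x\<close> is \<open>L2_set x {..<d}\<close>.
  A function with values in \<open>R^d\<close> is only ever evaluated at components \<open>i < d\<close>,
  so nothing is required of its other components.
\<close>

type_synonym rvec = "nat \<Rightarrow> real"

type_synonym vfield = "rvec \<Rightarrow> real \<Rightarrow> rvec"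

abbreviation Rn :: "nat \<Rightarrow> rvec set" where
  "Rn d \<equiv> topspace (Euclidean_space d)"

text \<open>
  \<open>Ck d k f\<close>: all partial derivatives of \<open>f\<close> up to order \<open>k\<close>, with
  respect to the \<open>d\<close> space variables and to time, exist and are continuous on
  \<open>R^d \<times> R\<close>.
\<close>

primrec Ck :: "nat \<Rightarrow> nat \<Rightarrow> (rvec \<Rightarrow> real \<Rightarrow> real) \<Rightarrow> bool" where
  "Ck d 0 f \<longleftrightarrow>
     continuous_map (prod_topology (Euclidean_space d) euclideanreal) euclideanreal (\<lambda>(x, t). f x t)"
| "Ck d (Suc k) f \<longleftrightarrow>
     continuous_map (prod_topology (Euclidean_space d) euclideanreal) euclideanreal (\<lambda>(x, t). f x t) \<and>
     (\<forall>i<d. \<exists>f'. Ck d k f' \<and>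
        (\<forall>x\<in>Rn d. \<forall>t. ((\<lambda>u. f (x(i := u)) t) has_real_derivative f' x t) (at (x i)))) \<and>
     (\<exists>f'. Ck d k f' \<and>
        (\<forall>x\<in>Rn d. \<forall>t. ((\<lambda>u. f x u) has_real_derivative f' x t) (at t)))"

definition Ck_field :: "nat \<Rightarrow> nat \<Rightarrow> vfield \<Rightarrow> bool" where
  "Ck_field d k n \<longleftrightarrow> (\<forall>i<d. Ck d k (\<lambda>x t. n x t i))"

definition solves_ivp ::
  "nat \<Rightarrow> vfield \<Rightarrow> vfield \<Rightarrow> real \<Rightarrow> rvec \<Rightarrow> real \<Rightarrow> (real \<Rightarrow> rvec) \<Rightarrow> bool" where
  "solves_ivp d n s t0 x0 T x \<longleftrightarrow>
     x t0 = x0 \<and>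
     (\<forall>t\<in>{t0..t0 + T}. x t \<in> Rn d \<and>
        (\<forall>i<d. ((\<lambda>u. x u i) has_real_derivative (n (x t) t i + s (x t) t i))
                 (at t within {t0..t0 + T})))"

text \<open>
  The coefficients of an IMEX Runge-Kutta method; stages are numbered from 1 to
  \<open>stages M\<close>. \<open>Aex\<close>, \<open>bex\<close>, \<open>cex\<close> belong to the
  explicitly treated \<open>n\<close>, and \<open>Aim\<close>, \<open>bim\<close>, \<open>cim\<close>
  (written with a hat in the literature) to the implicitly treated \<open>s\<close>. \<open>Aex\<close> is
  meant to be strictly lower triangular and \<open>Aim\<close> lower triangular; other entries are not
  used in the stage equations below.
\<close>

record imex =
  stages :: nat
  Aex :: "nat \<Rightarrow> nat \<Rightarrow> real"
  Aim :: "nat \<Rightarrow> nat \<Rightarrow> real"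
  bex :: "nat \<Rightarrow> real"
  bim :: "nat \<Rightarrow> real"
  cex :: "nat \<Rightarrow> real"
  cim :: "nat \<Rightarrow> real"

text \<open>The tuple \<open>g 1, \<dots>, g (stages M)\<close> solves the stage equations of the step of
  size \<open>h\<close> from \<open>x\<close> at time \<open>t\<close>.\<close>

definition stage_eqs ::
  "imex \<Rightarrow> nat \<Rightarrow> vfield \<Rightarrow> vfield \<Rightarrow> real \<Rightarrow> rvec \<Rightarrow> real \<Rightarrow> (nat \<Rightarrow> rvec) \<Rightarrow> bool" where
  "stage_eqs M d n s t x h g \<longleftrightarrow>
     (\<forall>j\<in>{1..stages M}. g j \<in> Rn d \<and>
        (\<forall>i<d. g j i =
           x i + h * (\<Sum>k\<in>{1..<j}. Aex M j k * n (g k) (t + cex M k * h) i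
                                 + Aim M j k * s (g k) (t + cim M k * h) i)
               + h * Aim M j j * s (g j) (t + cim M j * h) i))"

definition stages_near :: "imex \<Rightarrow> nat \<Rightarrow> rvec \<Rightarrow> real \<Rightarrow> (nat \<Rightarrow> rvec) \<Rightarrow> bool" where
  "stages_near M d x \<rho> g \<longleftrightarrow> (\<forall>j\<in>{1..stages M}. L2_set (\<lambda>i. g j i - x i) {..<d} < \<rho>)"

definition step_result ::
  "imex \<Rightarrow> vfield \<Rightarrow> vfield \<Rightarrow> real \<Rightarrow> rvec \<Rightarrow> real \<Rightarrow> (nat \<Rightarrow> rvec) \<Rightarrow> rvec" where
  "step_result M n s t x h g i =
     x i + h * (\<Sum>k\<in>{1..stages M}. bex M k * n (g k) (t + cex M k * h) i
                                 + bim M k * s (g k) (t + cim M k * h) i)"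

text \<open>
  Order at least \<open>p\<close>. "Sufficiently smooth" means of class \<open>C^K\<close> for some \<open>K\<close>
  depending on the method and \<open>p\<close> only. The stages \<open>G h\<close> of the step of size \<open>h\<close> are the
  unique solution of the stage equations in a fixed ball around \<open>x0\<close>, for all small
  \<open>h > 0\<close>.
\<close>

definition order_accurate :: "imex \<Rightarrow> nat \<Rightarrow> bool" where
  "order_accurate M p \<longleftrightarrow>
     (\<exists>K. \<forall>d\<ge>1. \<forall>n s. Ck_field d K n \<longrightarrow> Ck_field d K s \<longrightarrow>
        (\<forall>t0 x0 T x. T > 0 \<longrightarrow> solves_ivp d n s t0 x0 T x \<longrightarrow>
           (\<exists>\<rho>>0. \<exists>G.
              (\<forall>\<^sub>F h in at_right 0.
                 stage_eqs M d n s t0 x0 h (G h) \<and> stages_near M d x0 \<rho> (G h) \<and>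
                 (\<forall>g. stage_eqs M d n s t0 x0 h g \<and> stages_near M d x0 \<rho> g \<longrightarrow>
                      (\<forall>j\<in>{1..stages M}. g j = G h j))) \<and>
              (\<lambda>h. L2_set (\<lambda>i. step_result M n s t0 x0 h (G h) i - x (t0 + h) i) {..<d})
                \<in> O[at_right 0](\<lambda>h. h ^ (p + 1)))))"

text \<open>The matrices of the family. The coefficients are indexed by integers so that indices
  such as \<open>q - 3\<close> may be negative.\<close>

definition family_A :: "nat \<Rightarrow> (int \<Rightarrow> real) \<Rightarrow> (int \<Rightarrow> real) \<Rightarrow> nat \<Rightarrow> nat \<Rightarrow> real" where
  "family_A q \<alpha> \<beta> i k =
     (if 1 \<le> k \<and> k \<le> q \<and> i = k + 1 then \<alpha> (int k)
      else if k = 1 \<and> 3 \<le> i \<and> i \<le> q + 1 then \<beta> (int i - 2)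
      else 0)"

definition family_Ahat ::
  "nat \<Rightarrow> (int \<Rightarrow> real) \<Rightarrow> (int \<Rightarrow> real) \<Rightarrow> (int \<Rightarrow> real) \<Rightarrow> nat \<Rightarrow> nat \<Rightarrow> real" where
  "family_Ahat q \<alpha>' \<beta>' d' i k =
     (if 2 \<le> i \<and> i \<le> q \<and> k = i then d' (int i - 1)
      else family_A q \<alpha>' \<beta>' i k)"

definition imex_family ::
  "nat \<Rightarrow> (int \<Rightarrow> real) \<Rightarrow> (int \<Rightarrow> real) \<Rightarrow> (int \<Rightarrow> real) \<Rightarrow> (int \<Rightarrow> real) \<Rightarrow> (int \<Rightarrow> real) \<Rightarrow> imex" where
  "imex_family q \<alpha> \<beta> \<alpha>' \<beta>' d' =
     \<lparr> stages = q + 1,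
       Aex = family_A q \<alpha> \<beta>,
       Aim = family_Ahat q \<alpha>' \<beta>' d',
       bex = (\<lambda>j. family_A q \<alpha> \<beta> (q + 1) j),
       bim = (\<lambda>j. family_Ahat q \<alpha>' \<beta>' d' (q + 1) j),
       cex = (\<lambda>j. \<Sum>k\<in>{1..q + 1}. family_A q \<alpha> \<beta> j k),
       cim = (\<lambda>j. \<Sum>k\<in>{1..q + 1}. family_Ahat q \<alpha>' \<beta>' d' j k) \<rparr>"

end

theory Submission
  imports Defs
begin

text \<open>
A step of a Runge-Kutta method and the exact flow are both determined by the vector field near the
starting point, and both have expansions in powers of the step size \<open>h\<close> whose coefficients are
the elementary differentials of the field. The method has order \<open>p\<close> exactly when the two
expansions agree up to \<open>h ^ p\<close> for every field; comparing the coefficients of the elementary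
differentials gives the order conditions, polynomial equations in the method coefficients. For an
IMEX method there is one elementary differential for every rooted tree whose nodes carry one of two
colours, explicit or implicit. The colours are the booleans, \<open>True\<close> for the explicit part.

Three observations keep this elementary.

First, if the nodes are the row sums of the coefficient matrices, a non-autonomous problem becomes
an autonomous one with two additional coordinates, one clock for each colour
(\<open>autonomous\<close>, \<open>lifted_stages\<close>, \<open>projected_stages\<close>): the explicit clock advances by slopes
of the explicit part only, so that its value in stage \<open>j\<close> is the starting time plus \<open>h\<close> times an
explicit row sum, which is the time at which the method evaluates the explicit part.

Second, neither the stages nor the solution need to be differentiated repeatedly. If a point has the
form \<open>z0 + h * w\<close> and \<open>w\<close> is known up to \<open>O(h ^ k)\<close>, then Taylor expansion along the line in
direction \<open>w\<close> gives the field at that point up to \<open>O(h ^ (k + 1))\<close>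
(\<open>slope_expansion1\<close>, \<open>slope_expansion2\<close>, \<open>slope_expansion3\<close>). The stage equations, or one
integration in the case of the exact solution, turn this into \<open>w\<close> up to \<open>O(h ^ (k + 1))\<close>.
Starting from boundedness, a few such rounds give both expansions.
The stages themselves come from a contraction argument (\<open>stages_exist_unique\<close>). This shows that
the order conditions suffice.

Third, one family of five-dimensional problems with polynomial solutions isolates every condition
(\<open>test_slope\<close>): each component of its error is exactly a constant times a power of \<open>h\<close>, and the
constant is the defect of one order condition. This shows that the conditions are necessary.

In the family at hand the last row has nonzero entries only in the columns \<open>1\<close> and \<open>q\<close>, and the
first node is zero. Every sum in the order conditions therefore collapses to one or two terms. For
order 2 the collapsed conditions are the assertion. For order 3 the values of
\<open>a * c = 1/2\<close> and \<open>a * c\<^sup>2 = 1/3\<close> force \<open>c = 2/3\<close> and \<open>a = 3/4\<close>, where \<open>a\<close> is a last subdiagonal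
entry and \<open>c\<close> the node of stage \<open>q\<close>; the rest is linear (\<open>third_order_system\<close>).
\<close>

section \<open>Smooth functions of finitely many coordinates\<close>

lemma compact_all_coords:
  fixes S :: "'a \<Rightarrow> 'b::topological_space set"
  assumes "\<And>i. compact (S i)"
  shows "compact {f. \<forall>i. f i \<in> S i}"
proof -
  have "compactin (product_topology (\<lambda>i::'a. euclidean :: 'b topology) UNIV) (PiE UNIV S)"
    using assms by (simp add: compactin_PiE)
  moreover have "PiE UNIV S = {f. \<forall>i. f i \<in> S i}"
    by (auto simp: PiE_UNIV_domain)
  ultimately show ?thesis
    by (simp add: euclidean_product_topology)
qed

text \<open>
Closed boxes in the first \<open>D\<close> coordinates; the other coordinates are frozen. A box is compact in the
product topology of the space of all sequences, which serves as the topology of vectors throughout.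
\<close>

definition cube :: "nat \<Rightarrow> rvec \<Rightarrow> real \<Rightarrow> rvec set" where
  "cube D z B = {u. \<forall>l. u l \<in> (if l < D then {z l - B..z l + B} else {z l})}"

lemma compact_cube: "compact (cube D z B)"
  unfolding cube_def by (intro compact_all_coords) auto

lemma cube_iff: "u \<in> cube D z B \<longleftrightarrow> (\<forall>l<D. \<bar>u l - z l\<bar> \<le> B) \<and> (\<forall>l\<ge>D. u l = z l)"
proof -
  have "\<bar>u l - z l\<bar> \<le> B \<longleftrightarrow> u l \<in> {z l - B..z l + B}" for l by (auto simp: abs_le_iff)
  then show ?thesis unfolding cube_def by (auto simp: not_less)
qed

lemma cube_mono: "B \<le> B' \<Longrightarrow> cube D z B \<subseteq> cube D z B'"
  unfolding cube_iff subset_iff by (meson order_trans)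

lemma bounded_on_cube:
  fixes F :: "rvec \<Rightarrow> real"
  assumes "continuous_on UNIV F"
  shows "\<exists>C\<ge>0. \<forall>u\<in>cube D z B. \<bar>F u\<bar> \<le> C"
proof -
  have "compact (F ` cube D z B)"
    by (intro compact_continuous_image continuous_on_subset[OF assms] compact_cube) auto
  then obtain C where "\<forall>y\<in>F ` cube D z B. norm y \<le> C"
    using compact_imp_bounded bounded_iff by metis
  then have "\<forall>u\<in>cube D z B. \<bar>F u\<bar> \<le> max C 0" by (auto intro: order_trans)
  then show ?thesis by (intro exI[of _ "max C 0"]) auto
qed

definition partials :: "nat \<Rightarrow> (rvec \<Rightarrow> real) \<Rightarrow> (nat \<Rightarrow> rvec \<Rightarrow> real) \<Rightarrow> bool" where
  "partials D F P \<longleftrightarrow>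
     (\<forall>l<D. \<forall>z. ((\<lambda>u. F (z(l := u))) has_real_derivative P l z) (at (z l)))"

text \<open>
Functions of class \<open>C^k\<close> in the first \<open>D\<close> coordinates. The partial derivatives are prescribed at every
point of the space of sequences, so they are unique as functions and every choice of them is smooth
(\<open>smooth_partial\<close>).
\<close>

primrec smooth :: "nat \<Rightarrow> nat \<Rightarrow> (rvec \<Rightarrow> real) \<Rightarrow> bool" where
  "smooth D 0 F \<longleftrightarrow> continuous_on UNIV F"
| "smooth D (Suc k) F \<longleftrightarrow> continuous_on UNIV F \<and> (\<exists>P. partials D F P \<and> (\<forall>l<D. smooth D k (P l)))"

lemma smooth_imp_continuous: "smooth D k F \<Longrightarrow> continuous_on UNIV F"
  by (cases k) auto

lemma partials_unique:
  assumes "partials D F P" "partials D F P'" "l < D"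
  shows "P l = P' l"
proof
  fix z
  show "P l z = P' l z"
    using assms by (auto simp: partials_def intro!: DERIV_unique[of "\<lambda>u. F (z(l := u))" _ "z l"])
qed

lemma smooth_partial:
  assumes "smooth D (Suc k) F" "partials D F P" "l < D"
  shows "smooth D k (P l)"
  using assms partials_unique by (metis smooth.simps(2))

lemma smooth_mono: "smooth D m F \<Longrightarrow> k \<le> m \<Longrightarrow> smooth D k F"
proof (induction m arbitrary: k F)
  case (Suc m)
  then show ?case by (cases k) (force intro: smooth_imp_continuous)+
qed auto

text \<open>
Passing from \<open>u\<close> to \<open>v\<close> one coordinate at a time reduces the increment of \<open>F\<close> to the mean value theorem
in one variable. The intermediate points stay in the box spanned by \<open>u\<close> and \<open>v\<close>; this is what makes
continuity, or boundedness, of the partial derivatives sufficient in the two applications, the chain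
rule and the Lipschitz bound.
\<close>

lemma hybrid_mvt:
  fixes F :: "rvec \<Rightarrow> real"
  assumes P: "partials D F P" and uv: "\<And>l. l \<ge> D \<Longrightarrow> u l = v l"
  shows "\<exists>\<xi>. (\<forall>l<D. \<forall>i. \<xi> l i \<in> {min (u i) (v i)..max (u i) (v i)}) \<and>
    F v - F u = (\<Sum>l<D. P l (\<xi> l) * (v l - u l))"
proof -
  \<comment> \<open>the first \<open>m\<close> coordinates already moved to \<open>v\<close>\<close>
  define w where "w = (\<lambda>m i. if i < m then v i else u i)"
  have "\<exists>x. x \<in> {min (u l) (v l)..max (u l) (v l)} \<and>
      F (w (Suc l)) - F (w l) = P l ((w l)(l := x)) * (v l - u l)" if "l < D" for l
  proof -
    have der: "((\<lambda>y. F ((w l)(l := y))) has_real_derivative P l ((w l)(l := y))) (at y)" for y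
      using P[unfolded partials_def, rule_format, OF \<open>l < D\<close>, of "(w l)(l := y)"] by simp
    have eq: "F (w l) = F ((w l)(l := u l))" "F (w (Suc l)) = F ((w l)(l := v l))"
      by (auto simp: w_def intro!: arg_cong[of _ _ F])
    consider "u l = v l" | "u l < v l" | "v l < u l" by linarith
    then show ?thesis
    proof cases
      case 1 then show ?thesis unfolding eq by auto
    next
      case 2
      from MVT2[OF this der] obtain x where "u l < x" "x < v l"
        "F ((w l)(l := v l)) - F ((w l)(l := u l)) = (v l - u l) * P l ((w l)(l := x))" by auto
      then show ?thesis unfolding eq by (intro exI[of _ x]) (auto simp: algebra_simps)
    next
      case 3
      from MVT2[OF this der] obtain x where "v l < x" "x < u l"
        "F ((w l)(l := u l)) - F ((w l)(l := v l)) = (u l - v l) * P l ((w l)(l := x))" by auto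
      then show ?thesis unfolding eq by (intro exI[of _ x]) (auto simp: algebra_simps)
    qed
  qed
  then obtain x where x: "\<And>l. l < D \<Longrightarrow> x l \<in> {min (u l) (v l)..max (u l) (v l)}"
    "\<And>l. l < D \<Longrightarrow> F (w (Suc l)) - F (w l) = P l ((w l)(l := x l)) * (v l - u l)"
    by metis
  have "F v - F u = F (w D) - F (w 0)"
    using uv by (auto simp: w_def fun_eq_iff intro!: arg_cong2[of _ _ _ _ minus] arg_cong[of _ _ F])
  also have "\<dots> = (\<Sum>l<D. F (w (Suc l)) - F (w l))"
    by (rule sum_lessThan_telescope[symmetric])
  also have "\<dots> = (\<Sum>l<D. P l ((w l)(l := x l)) * (v l - u l))"
    using x by auto
  finally show ?thesis
    using x(1) by (intro exI[of _ "\<lambda>l. (w l)(l := x l)"]) (auto simp: w_def)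
qed

lemma tendsto_vecI:
  fixes f :: "'a \<Rightarrow> rvec"
  assumes "\<And>i. ((\<lambda>x. f x i) \<longlongrightarrow> l i) G"
  shows "(f \<longlongrightarrow> l) G"
proof -
  have "limitin (product_topology (\<lambda>i. euclidean) UNIV) f l G"
    using assms by (simp add: limitin_componentwise)
  then show ?thesis by (simp add: euclidean_product_topology)
qed

text \<open>
The intermediate points of the mean value theorem are squeezed between the two ends of a shrinking
segment, so continuity of the partial derivatives identifies the limit of the difference quotient.
\<close>

lemma chain_rule_line:
  assumes F: "smooth D (Suc k) F" and P: "partials D F P" and w: "\<And>l. l \<ge> D \<Longrightarrow> w l = 0"
  shows "((\<lambda>\<tau>. F (\<lambda>i. z i + \<tau> * w i)) has_real_derivative
            (\<Sum>l<D. P l (\<lambda>i. z i + \<tau> * w i) * w l)) (at \<tau>)"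
proof -
  define y where "y = (\<lambda>\<tau> i. z i + \<tau> * w i)"
  have "\<forall>e. \<exists>\<xi>. (\<forall>l<D. \<forall>i. \<xi> l i \<in> {min (y \<tau> i) (y (\<tau>+e) i)..max (y \<tau> i) (y (\<tau>+e) i)}) \<and>
    F (y (\<tau>+e)) - F (y \<tau>) = (\<Sum>l<D. P l (\<xi> l) * (y (\<tau>+e) l - y \<tau> l))"
    by (intro allI hybrid_mvt[OF P]) (auto simp: y_def w)
  then obtain \<xi> where \<xi>: "\<And>e l i. l < D \<Longrightarrow> \<xi> e l i \<in> {min (y \<tau> i) (y (\<tau>+e) i)..max (y \<tau> i) (y (\<tau>+e) i)}"
    and eq: "\<And>e. F (y (\<tau>+e)) - F (y \<tau>) = (\<Sum>l<D. P l (\<xi> e l) * (y (\<tau>+e) l - y \<tau> l))"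
    by metis
  have y_lim: "((\<lambda>e. y (\<tau>+e) i) \<longlongrightarrow> y \<tau> i) (at 0)" for i
    unfolding y_def by (auto intro!: tendsto_eq_intros)
  have "((\<lambda>e. \<xi> e l) \<longlongrightarrow> y \<tau>) (at 0)" if "l < D" for l
  proof (rule tendsto_vecI)
    fix i
    show "((\<lambda>e. \<xi> e l i) \<longlongrightarrow> y \<tau> i) (at 0)"
    proof (rule tendsto_sandwich)
      show "((\<lambda>e. min (y \<tau> i) (y (\<tau>+e) i)) \<longlongrightarrow> y \<tau> i) (at 0)"
        using tendsto_min[OF tendsto_const y_lim, of "y \<tau> i" i] by simp
      show "((\<lambda>e. max (y \<tau> i) (y (\<tau>+e) i)) \<longlongrightarrow> y \<tau> i) (at 0)"
        using tendsto_max[OF tendsto_const y_lim, of "y \<tau> i" i] by simp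
    qed (use \<xi>[OF that] in auto)
  qed
  moreover have "isCont (P l) (y \<tau>)" if "l < D" for l
    using smooth_imp_continuous[OF smooth_partial[OF F P that]] by (simp add: continuous_on_eq_continuous_at)
  ultimately have "((\<lambda>e. P l (\<xi> e l)) \<longlongrightarrow> P l (y \<tau>)) (at 0)" if "l < D" for l
    using isCont_tendsto_compose that by blast
  then have "((\<lambda>e. \<Sum>l<D. P l (\<xi> e l) * w l) \<longlongrightarrow> (\<Sum>l<D. P l (y \<tau>) * w l)) (at 0)"
    by (intro tendsto_sum tendsto_mult tendsto_const) auto
  moreover have "\<forall>\<^sub>F e in at 0. (\<Sum>l<D. P l (\<xi> e l) * w l) = (F (y (\<tau>+e)) - F (y \<tau>)) / e"
    unfolding eventually_at_filter eq
    by (auto simp: y_def algebra_simps sum_divide_distrib intro!: always_eventually)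
  ultimately have "((\<lambda>e. (F (y (\<tau>+e)) - F (y \<tau>)) / e) \<longlongrightarrow> (\<Sum>l<D. P l (y \<tau>) * w l)) (at 0)"
    by (rule Lim_transform_eventually)
  then show ?thesis
    unfolding DERIV_def y_def .
qed

text \<open>
The one analytic estimate behind both expansions: integration raises the order of smallness by one. It
is applied to Taylor remainders along lines and to the exact solution.
\<close>

lemma growth_of_antiderivative:
  fixes y y' :: "real \<Rightarrow> real"
  assumes "0 \<le> h" "y 0 = 0"
    and der: "\<And>\<tau>. 0 \<le> \<tau> \<Longrightarrow> \<tau> \<le> h \<Longrightarrow> (y has_real_derivative y' \<tau>) (at \<tau> within {0..h})"
    and bound: "\<And>\<tau>. 0 < \<tau> \<Longrightarrow> \<tau> \<le> h \<Longrightarrow> \<bar>y' \<tau>\<bar> \<le> C * \<tau> ^ k"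
  shows "\<bar>y h\<bar> \<le> C * h ^ Suc k"
proof (cases "h = 0")
  case False
  with \<open>0 \<le> h\<close> have h: "0 < h" by simp
  obtain \<xi> where \<xi>: "0 < \<xi>" "\<xi> < h" "y h - y 0 = y' \<xi> * (h - 0)"
    using mvt_simple[OF h, of y "\<lambda>x. (*) (y' x)"] der[unfolded has_field_derivative_def] by auto
  have "0 \<le> \<bar>y' h\<bar>" by simp
  also have "\<dots> \<le> C * h ^ k" using bound h by simp
  finally have "0 \<le> C" using zero_less_power[OF h, of k] by (simp add: zero_le_mult_iff)
  have "\<bar>y h\<bar> = \<bar>y' \<xi>\<bar> * h" using \<xi>(3) assms(1,2) by (simp add: abs_mult)
  also have "\<dots> \<le> (C * \<xi> ^ k) * h" using \<xi> h bound by (intro mult_right_mono) auto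
  also have "\<dots> \<le> (C * h ^ k) * h"
    using \<xi> h \<open>0 \<le> C\<close> by (intro mult_right_mono mult_left_mono power_mono) auto
  finally show ?thesis by (simp add: algebra_simps)
qed (use assms(2) in auto)

section \<open>Taylor expansion along lines\<close>

text \<open>
One more order of Taylor expansion: if the partial derivatives of \<open>F\<close> are approximated along lines by
\<open>p\<close>, then \<open>F\<close> is approximated by the antiderivative \<open>q\<close> of the directional derivative built from
\<open>p\<close>. The bounds are uniform over bounded directions \<open>w\<close>, because the direction will later depend on
the length \<open>\<tau>\<close>.
\<close>

lemma taylor_step:
  assumes F: "smooth D (Suc m) F" and P: "partials D F P"
    and approx: "\<And>l. l < D \<Longrightarrow> \<exists>C\<ge>0. \<forall>w\<in>cube D (\<lambda>_. 0) B. \<forall>\<tau>\<in>{0..1}.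
                   \<bar>P l (\<lambda>i. z i + \<tau> * w i) - p l w \<tau>\<bar> \<le> C * \<tau> ^ k"
    and q0: "\<And>w. q w 0 = F z"
    and q': "\<And>w \<tau>. (q w has_real_derivative (\<Sum>l<D. p l w \<tau> * w l)) (at \<tau>)"
  shows "\<exists>C\<ge>0. \<forall>w\<in>cube D (\<lambda>_. 0) B. \<forall>\<tau>\<in>{0..1}.
           \<bar>F (\<lambda>i. z i + \<tau> * w i) - q w \<tau>\<bar> \<le> C * \<tau> ^ Suc k"
proof -
  obtain C where C: "\<And>l. l < D \<Longrightarrow> 0 \<le> C l"
    "\<And>l w \<tau>. l < D \<Longrightarrow> w \<in> cube D (\<lambda>_. 0) B \<Longrightarrow> \<tau> \<in> {0..1} \<Longrightarrow>
       \<bar>P l (\<lambda>i. z i + \<tau> * w i) - p l w \<tau>\<bar> \<le> C l * \<tau> ^ k"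
    using approx by metis
  define K where "K = (\<Sum>l<D. C l * \<bar>B\<bar>)"
  have "\<bar>F (\<lambda>i. z i + h * w i) - q w h\<bar> \<le> K * h ^ Suc k"
    if w: "w \<in> cube D (\<lambda>_. 0) B" and h: "h \<in> {0..1}" for w h
  proof (rule growth_of_antiderivative[where y = "\<lambda>h. F (\<lambda>i. z i + h * w i) - q w h"])
    show "((\<lambda>h. F (\<lambda>i. z i + h * w i) - q w h) has_real_derivative
        (\<Sum>l<D. (P l (\<lambda>i. z i + \<tau> * w i) - p l w \<tau>) * w l)) (at \<tau> within {0..h})" for \<tau>
      unfolding left_diff_distrib sum_subtractf using w
      by (intro has_field_derivative_at_within[OF DERIV_diff[OF chain_rule_line[OF F P] q']])
         (auto simp: cube_iff)
    show "\<bar>\<Sum>l<D. (P l (\<lambda>i. z i + \<tau> * w i) - p l w \<tau>) * w l\<bar> \<le> K * \<tau> ^ k"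
      if \<tau>: "0 < \<tau>" "\<tau> \<le> h" for \<tau>
    proof -
      have "\<bar>\<Sum>l<D. (P l (\<lambda>i. z i + \<tau> * w i) - p l w \<tau>) * w l\<bar>
          \<le> (\<Sum>l<D. \<bar>P l (\<lambda>i. z i + \<tau> * w i) - p l w \<tau>\<bar> * \<bar>w l\<bar>)"
        by (rule order_trans[OF sum_abs]) (simp add: abs_mult)
      also have "\<dots> \<le> (\<Sum>l<D. (C l * \<tau> ^ k) * \<bar>B\<bar>)"
        using w h \<tau> C by (intro sum_mono mult_mono) (auto simp: cube_iff)
      also have "\<dots> = K * \<tau> ^ k"
        by (simp add: K_def sum_distrib_left sum_distrib_right mult_ac)
      finally show ?thesis .
    qed
  qed (use h q0 in auto)
  moreover have "0 \<le> K"
    unfolding K_def using C(1) by (auto intro: sum_nonneg)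
  ultimately show ?thesis by blast
qed

lemma taylor_bounded:
  fixes F :: "rvec \<Rightarrow> real"
  assumes "continuous_on UNIV F"
  shows "\<exists>C\<ge>0. \<forall>w\<in>cube D (\<lambda>_. 0) B. \<forall>\<tau>\<in>{0..1}. \<bar>F (\<lambda>i. z i + \<tau> * w i)\<bar> \<le> C"
proof -
  obtain C where C: "C \<ge> 0" "\<And>u. u \<in> cube D z \<bar>B\<bar> \<Longrightarrow> \<bar>F u\<bar> \<le> C"
    using bounded_on_cube[OF assms] by metis
  have "(\<lambda>i. z i + \<tau> * w i) \<in> cube D z \<bar>B\<bar>"
    if "w \<in> cube D (\<lambda>_. 0) B" "\<tau> \<in> {0..1}" for w and \<tau> :: real
    using that by (auto simp: cube_iff abs_mult intro!: mult_left_le_one_le[THEN order_trans])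
  with C show ?thesis by blast
qed

lemma taylor1:
  assumes "smooth D 1 F"
  shows "\<exists>C\<ge>0. \<forall>w\<in>cube D (\<lambda>_. 0) B. \<forall>\<tau>\<in>{0..1}.
           \<bar>F (\<lambda>i. z i + \<tau> * w i) - F z\<bar> \<le> C * \<tau> ^ 1"
proof -
  obtain P where P: "partials D F P" and cont: "\<And>l. l < D \<Longrightarrow> continuous_on UNIV (P l)"
    using assms by auto
  from assms P show ?thesis
    unfolding One_nat_def
    by (rule taylor_step[where p = "\<lambda>_ _ _. 0"]) (use taylor_bounded[OF cont] in auto)
qed

lemma taylor2:
  assumes F: "smooth D 2 F" and P: "partials D F P"
  shows "\<exists>C\<ge>0. \<forall>w\<in>cube D (\<lambda>_. 0) B. \<forall>\<tau>\<in>{0..1}.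
           \<bar>F (\<lambda>i. z i + \<tau> * w i) - (F z + \<tau> * (\<Sum>l<D. P l z * w l))\<bar> \<le> C * \<tau> ^ 2"
proof -
  have F': "smooth D (Suc 1) F" using F by (simp add: numeral_2_eq_2)
  from F' P show ?thesis
    unfolding Suc_1[symmetric]
  proof (rule taylor_step[where p = "\<lambda>l w \<tau>. P l z"], goal_cases)
    case (1 l)
    show ?case using taylor1[OF smooth_partial[OF F' P 1]] .
  qed (auto intro!: derivative_eq_intros)
qed

lemma taylor3:
  assumes F: "smooth D 3 F" and P: "partials D F P"
    and H: "\<And>l. l < D \<Longrightarrow> partials D (P l) (H l)"
  shows "\<exists>C\<ge>0. \<forall>w\<in>cube D (\<lambda>_. 0) B. \<forall>\<tau>\<in>{0..1}.
           \<bar>F (\<lambda>i. z i + \<tau> * w i) - (F z + \<tau> * (\<Sum>l<D. P l z * w l)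
              + \<tau>\<^sup>2 / 2 * (\<Sum>l<D. (\<Sum>m<D. H l m z * w m) * w l))\<bar> \<le> C * \<tau> ^ 3"
proof -
  have F': "smooth D (Suc 2) F" using F by (simp add: numeral_eq_Suc)
  have s3: "3 = Suc 2" by simp
  from F' P show ?thesis
    unfolding s3
  proof (rule taylor_step[where p = "\<lambda>l w \<tau>. P l z + \<tau> * (\<Sum>m<D. H l m z * w m)"], goal_cases)
    case (1 l)
    show ?case using taylor2[OF smooth_partial[OF F' P 1] H[OF 1]] .
  next
    case (3 w \<tau>)
    show ?case
      by (auto intro!: derivative_eq_intros
          simp: sum.distrib sum_distrib_left sum_distrib_right algebra_simps)
  qed auto
qed

section \<open>Orders of smallness in the step size\<close>

abbreviation Oh :: "nat \<Rightarrow> (real \<Rightarrow> real) set" where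
  "Oh k \<equiv> O[at_right 0](\<lambda>h. h ^ k)"

lemma Oh_I:
  assumes "\<forall>\<^sub>F h in at_right 0. \<bar>f h\<bar> \<le> C * h ^ k"
  shows "f \<in> Oh k"
proof (rule bigoI[of _ C])
  have "\<forall>\<^sub>F h::real in at_right 0. 0 < h" by (rule eventually_at_right_less)
  then show "\<forall>\<^sub>F h in at_right 0. norm (f h) \<le> C * norm (h ^ k)"
    using assms by eventually_elim auto
qed

lemma Oh_add: "f \<in> Oh k \<Longrightarrow> g \<in> Oh k \<Longrightarrow> (\<lambda>h. f h + g h) \<in> Oh k"
  by (rule sum_in_bigo)

lemma Oh_diff: "f \<in> Oh k \<Longrightarrow> g \<in> Oh k \<Longrightarrow> (\<lambda>h. f h - g h) \<in> Oh k"
  by (rule sum_in_bigo)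

lemma Oh_sum: "(\<And>x. x \<in> A \<Longrightarrow> f x \<in> Oh k) \<Longrightarrow> (\<lambda>h. \<Sum>x\<in>A. f x h) \<in> Oh k"
  by (rule big_sum_in_bigo)

lemma Oh_mult: "f \<in> Oh j \<Longrightarrow> g \<in> Oh k \<Longrightarrow> (\<lambda>h. f h * g h) \<in> Oh (j + k)"
  unfolding power_add by (rule landau_o.big.mult)

lemma Oh_const: "(\<lambda>_. c) \<in> Oh 0"
  by (simp add: bigo_const)

lemma Oh_cmult: "f \<in> Oh k \<Longrightarrow> (\<lambda>h. c * f h) \<in> Oh k"
  using Oh_mult[OF Oh_const, of f k c] by simp

lemma Oh_shift: "f \<in> Oh k \<Longrightarrow> (\<lambda>h. h ^ m * f h) \<in> Oh (m + k)"
  by (intro Oh_mult) auto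

lemma Oh_mono:
  assumes "f \<in> Oh k" "j \<le> k"
  shows "f \<in> Oh j"
proof -
  have "(\<lambda>h::real. h ^ k) \<in> Oh j"
  proof (rule Oh_I[of _ 1])
    have "\<forall>\<^sub>F h::real in at_right 0. h \<in> {0<..<1}"
      by (rule eventually_at_right_real) simp
    then show "\<forall>\<^sub>F h::real in at_right 0. \<bar>h ^ k\<bar> \<le> 1 * h ^ j"
      by eventually_elim (use assms(2) in \<open>auto intro!: power_decreasing\<close>)
  qed
  with assms(1) show ?thesis by (rule landau_o.big_trans)
qed

text \<open>
Uniformity in the direction is used here: the direction may vary with \<open>h\<close> as long as it stays bounded.
\<close>

lemma Oh_along_line:
  assumes R: "\<And>B. \<exists>C\<ge>0. \<forall>w\<in>cube D (\<lambda>_. 0) B. \<forall>\<tau>\<in>{0..1}. \<bar>R w \<tau>\<bar> \<le> C * \<tau> ^ k"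
    and w: "\<And>l. l < D \<Longrightarrow> (\<lambda>h. w h l) \<in> Oh 0" and w0: "\<And>h l. l \<ge> D \<Longrightarrow> w h l = 0"
  shows "(\<lambda>h. R (w h) h) \<in> Oh k"
proof -
  have "\<exists>B. \<forall>\<^sub>F h in at_right 0. \<bar>w h l\<bar> \<le> B" if "l < D" for l
    using w[OF that] by (auto elim!: landau_o.bigE)
  then obtain b where b: "\<And>l. l < D \<Longrightarrow> \<forall>\<^sub>F h in at_right 0. \<bar>w h l\<bar> \<le> b l"
    by metis
  define B where "B = (\<Sum>l<D. \<bar>b l\<bar>)"
  have bB: "b l \<le> B" if "l < D" for l
  proof -
    have "b l \<le> \<bar>b l\<bar>" by simp
    also have "\<dots> \<le> B" unfolding B_def using that by (intro member_le_sum) auto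
    finally show ?thesis .
  qed
  obtain C where C: "\<And>w \<tau>. w \<in> cube D (\<lambda>_. 0) B \<Longrightarrow> \<tau> \<in> {0..1} \<Longrightarrow> \<bar>R w \<tau>\<bar> \<le> C * \<tau> ^ k"
    using R by metis
  have "\<forall>\<^sub>F h in at_right 0. \<forall>l\<in>{..<D}. \<bar>w h l\<bar> \<le> b l"
    using b by (intro eventually_ball_finite) auto
  moreover have "\<forall>\<^sub>F h::real in at_right 0. h \<in> {0<..<1}"
    by (rule eventually_at_right_real) simp
  ultimately have "\<forall>\<^sub>F h in at_right 0. \<bar>R (w h) h\<bar> \<le> C * h ^ k"
  proof eventually_elim
    case (elim h)
    have "w h \<in> cube D (\<lambda>_. 0) B"
      unfolding cube_iff using elim(1) w0 by (auto intro: order_trans[OF _ bB])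
    then show ?case using elim by (intro C) auto
  qed
  then show ?thesis by (rule Oh_I)
qed

lemma Oh_bounded_of_approx:
  assumes "(\<lambda>h. f h - a) \<in> Oh k"
  shows "f \<in> Oh 0"
  using Oh_add[OF Oh_mono[OF assms, of 0] Oh_const[of a]] by simp

lemma curve_expansion1:
  assumes "smooth D 1 F"
    and "\<And>l. l < D \<Longrightarrow> (\<lambda>h. w h l) \<in> Oh 0" "\<And>h l. l \<ge> D \<Longrightarrow> w h l = 0"
  shows "(\<lambda>h. F (\<lambda>i. z i + h * w h i) - F z) \<in> Oh 1"
  by (rule Oh_along_line[where R = "\<lambda>w \<tau>. F (\<lambda>i. z i + \<tau> * w i) - F z", OF taylor1]) (use assms in auto)

lemma curve_expansion2:
  assumes F: "smooth D 2 F" and P: "partials D F P"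
    and w: "\<And>l. l < D \<Longrightarrow> (\<lambda>h. w h l - a l) \<in> Oh 1" and w0: "\<And>h l. l \<ge> D \<Longrightarrow> w h l = 0"
  shows "(\<lambda>h. F (\<lambda>i. z i + h * w h i) - (F z + h * (\<Sum>l<D. P l z * a l))) \<in> Oh 2"
proof -
  have *: "(\<lambda>h. F (\<lambda>i. z i + h * w h i) - (F z + h * (\<Sum>l<D. P l z * w h l))) \<in> Oh 2"
    by (rule Oh_along_line[where R = "\<lambda>w \<tau>. F (\<lambda>i. z i + \<tau> * w i) - (F z + \<tau> * (\<Sum>l<D. P l z * w l))",
          OF taylor2[OF F P]]) (use w0 Oh_bounded_of_approx[OF w] in auto)
  have "(\<lambda>h. h ^ 1 * (\<Sum>l<D. P l z * (w h l - a l))) \<in> Oh (1 + 1)"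
    using w by (intro Oh_shift Oh_sum Oh_cmult) auto
  then have "(\<lambda>h. F (\<lambda>i. z i + h * w h i) - (F z + h * (\<Sum>l<D. P l z * w h l))
      + h * (\<Sum>l<D. P l z * (w h l - a l))) \<in> Oh 2"
    by (intro Oh_add[OF *]) (simp add: numeral_2_eq_2)
  then show ?thesis
    by (simp add: algebra_simps sum_subtractf)
qed

text \<open>
A direction known up to \<open>O(h ^ 2)\<close> determines \<open>F\<close> up to \<open>O(h ^ 3)\<close>, since the direction enters the
expansion with a factor \<open>h\<close>. The second-order term of the direction contributes through the first
derivative, and its leading term through the second derivative.
\<close>

lemma curve_expansion3:
  assumes F: "smooth D 3 F" and P: "partials D F P"
    and H: "\<And>l. l < D \<Longrightarrow> partials D (P l) (H l)"
    and w: "\<And>l. l < D \<Longrightarrow> (\<lambda>h. w h l - (a l + h * b l)) \<in> Oh 2" and w0: "\<And>h l. l \<ge> D \<Longrightarrow> w h l = 0"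
  shows "(\<lambda>h. F (\<lambda>i. z i + h * w h i) - (F z + h * (\<Sum>l<D. P l z * a l)
     + h\<^sup>2 * ((\<Sum>l<D. P l z * b l) + (\<Sum>l<D. \<Sum>m<D. H l m z * a m * a l) / 2))) \<in> Oh 3"
proof -
  have w1: "(\<lambda>h. w h l - a l) \<in> Oh 1" if "l < D" for l
  proof -
    have "(\<lambda>h. h ^ 1 * b l) \<in> Oh (1 + 0)" by (intro Oh_shift Oh_const)
    then have "(\<lambda>h. (w h l - (a l + h * b l)) + h * b l) \<in> Oh 1"
      by (intro Oh_add Oh_mono[OF w[OF that]]) simp_all
    then show ?thesis by (simp add: algebra_simps)
  qed
  have wb: "(\<lambda>h. w h l) \<in> Oh 0" if "l < D" for l
    by (rule Oh_bounded_of_approx[OF w1[OF that]])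
  have *: "(\<lambda>h. F (\<lambda>i. z i + h * w h i) - (F z + h * (\<Sum>l<D. P l z * w h l)
      + h\<^sup>2 / 2 * (\<Sum>l<D. (\<Sum>m<D. H l m z * w h m) * w h l))) \<in> Oh 3"
    by (rule Oh_along_line[where R = "\<lambda>w \<tau>. F (\<lambda>i. z i + \<tau> * w i) - (F z + \<tau> * (\<Sum>l<D. P l z * w l)
      + \<tau>\<^sup>2 / 2 * (\<Sum>l<D. (\<Sum>m<D. H l m z * w m) * w l))", OF taylor3[OF F P H]])
       (use w0 wb in auto)
  have lin: "(\<lambda>h. h ^ 1 * (\<Sum>l<D. P l z * (w h l - (a l + h * b l)))) \<in> Oh (1 + 2)"
    using w by (intro Oh_shift Oh_sum Oh_cmult) auto
  have "(\<lambda>h. w h m * w h l - a m * a l) \<in> Oh 1" if "l < D" "m < D" for l m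
  proof -
    have "(\<lambda>h. (w h m - a m) * w h l + a m * (w h l - a l)) \<in> Oh 1"
      using Oh_add[OF Oh_mult[OF w1[OF that(2)] wb[OF that(1)], unfolded add_0_right] Oh_cmult[OF w1[OF that(1)]]] by simp
    then show ?thesis by (simp add: algebra_simps)
  qed
  then have "(\<lambda>h. h ^ 2 * (1/2 * (\<Sum>l<D. \<Sum>m<D. H l m z * (w h m * w h l - a m * a l)))) \<in> Oh (2 + 1)"
    by (intro Oh_shift Oh_sum Oh_cmult) auto
  note quad = this
  have three: "1 + 2 = (3::nat)" "2 + 1 = (3::nat)" by simp_all
  have lin_eq: "(\<Sum>l<D. P l z * (w h l - (a l + h * b l)))
      = (\<Sum>l<D. P l z * w h l) - ((\<Sum>l<D. P l z * a l) + h * (\<Sum>l<D. P l z * b l))" for h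
    by (simp add: algebra_simps sum_subtractf sum.distrib sum_distrib_left)
  have quad_eq: "(\<Sum>l<D. \<Sum>m<D. H l m z * (w h m * w h l - a m * a l))
      = (\<Sum>l<D. (\<Sum>m<D. H l m z * w h m) * w h l) - (\<Sum>l<D. \<Sum>m<D. H l m z * a m * a l)" for h
    by (simp add: algebra_simps sum_subtractf sum_distrib_left)
  have "(\<lambda>h. F (\<lambda>i. z i + h * w h i) - (F z + h * (\<Sum>l<D. P l z * w h l)
        + h\<^sup>2 / 2 * (\<Sum>l<D. (\<Sum>m<D. H l m z * w h m) * w h l))
      + (h ^ 1 * (\<Sum>l<D. P l z * (w h l - (a l + h * b l)))
        + h\<^sup>2 * (1/2 * (\<Sum>l<D. \<Sum>m<D. H l m z * (w h m * w h l - a m * a l))))) \<in> Oh 3"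
    by (intro Oh_add[OF *] Oh_add lin[unfolded three] quad[unfolded three])
  then show ?thesis
    unfolding lin_eq quad_eq
    by (rule back_subst[of "\<lambda>f. f \<in> Oh 3"])
       (simp add: fun_eq_iff field_simps power2_eq_square)
qed

lemma Oh_cong:
  assumes "f \<in> Oh k" "\<forall>\<^sub>F h in at_right 0. f h = g h"
  shows "g \<in> Oh k"
  using assms landau_o.big.in_cong by blast

lemma Oh_divide:
  assumes "f \<in> Oh (Suc k)"
  shows "(\<lambda>h. f h / h) \<in> Oh k"
proof -
  from assms obtain C where C: "\<forall>\<^sub>F h in at_right 0. norm (f h) \<le> C * norm (h ^ Suc k)"
    by (auto elim: landau_o.bigE)
  have "\<forall>\<^sub>F h::real in at_right 0. 0 < h" by (rule eventually_at_right_less)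
  with C have "\<forall>\<^sub>F h in at_right 0. \<bar>f h / h\<bar> \<le> C * h ^ k"
    by eventually_elim (simp add: field_simps)
  then show ?thesis by (rule Oh_I)
qed

lemma Oh_antiderivative:
  fixes \<phi> :: "real \<Rightarrow> real"
  assumes "0 < T" "\<phi> 0 = 0"
    and der: "\<And>\<tau>. \<tau> \<in> {0..T} \<Longrightarrow> (\<phi> has_real_derivative \<phi>' \<tau>) (at \<tau> within {0..T})"
    and small: "\<phi>' \<in> Oh k"
  shows "\<phi> \<in> Oh (Suc k)"
proof -
  from small obtain C where "\<forall>\<^sub>F h in at_right 0. norm (\<phi>' h) \<le> C * norm (h ^ k)"
    by (auto elim: landau_o.bigE)
  then obtain \<delta> where \<delta>: "\<delta> > 0" "\<And>h. 0 < h \<Longrightarrow> h < \<delta> \<Longrightarrow> norm (\<phi>' h) \<le> C * norm (h ^ k)"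
    unfolding eventually_at_right_field by auto
  have "\<forall>\<^sub>F h in at_right 0. h \<in> {0<..<min T \<delta>}"
    using assms(1) \<delta>(1) by (intro eventually_at_right_real) simp
  then have "\<forall>\<^sub>F h in at_right 0. \<bar>\<phi> h\<bar> \<le> C * h ^ Suc k"
  proof eventually_elim
    case (elim h)
    show ?case
    proof (rule growth_of_antiderivative[where y' = \<phi>'])
      show "(\<phi> has_real_derivative \<phi>' \<tau>) (at \<tau> within {0..h})" if "0 \<le> \<tau>" "\<tau> \<le> h" for \<tau>
        using that elim by (intro has_field_derivative_subset[OF der]) auto
      show "\<bar>\<phi>' \<tau>\<bar> \<le> C * \<tau> ^ k" if "0 < \<tau>" "\<tau> \<le> h" for \<tau>
        using \<delta>(2)[of \<tau>] that elim by simp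
    qed (use elim assms in auto)
  qed
  then show ?thesis by (rule Oh_I)
qed

section \<open>Expansion of the stages\<close>

text \<open>
The stage equations of an additive Runge-Kutta method for the autonomous field \<open>\<Sum>\<sigma>. F \<sigma>\<close> whose parts are
indexed by colours; the tableau \<open>A \<sigma>\<close> belongs to the part \<open>F \<sigma>\<close>. The stages are confined to a box, as
implicit equations have a unique solution only near the starting point.
\<close>

definition stage_solution ::
  "('c::finite \<Rightarrow> nat \<Rightarrow> nat \<Rightarrow> real) \<Rightarrow> ('c \<Rightarrow> rvec \<Rightarrow> rvec) \<Rightarrow> nat set \<Rightarrow> nat \<Rightarrow> rvec \<Rightarrow> real \<Rightarrow> real
     \<Rightarrow> (nat \<Rightarrow> rvec) \<Rightarrow> bool" where
  "stage_solution A F J D z \<rho> h g \<longleftrightarrow> (\<forall>j\<in>J. g j \<in> cube D z \<rho> \<and>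
      (\<forall>l<D. g j l = z l + h * (\<Sum>k\<in>J. \<Sum>\<mu>\<in>UNIV. A \<mu> j k * F \<mu> (g k) l)))"

text \<open>
A coloured field with fixed first and second partial derivatives \<open>P\<close> and \<open>H\<close>, together with the point at
which everything is expanded.
\<close>

locale coloured_jet =
  fixes D :: nat and F :: "'c::finite \<Rightarrow> rvec \<Rightarrow> rvec" and z0 :: rvec
    and P :: "'c \<Rightarrow> nat \<Rightarrow> nat \<Rightarrow> rvec \<Rightarrow> real"
    and H :: "'c \<Rightarrow> nat \<Rightarrow> nat \<Rightarrow> nat \<Rightarrow> rvec \<Rightarrow> real"
  assumes smooth_F: "\<And>\<sigma> i. i < D \<Longrightarrow> smooth D 3 (\<lambda>z. F \<sigma> z i)"
    and partials_P: "\<And>\<sigma> i. i < D \<Longrightarrow> partials D (\<lambda>z. F \<sigma> z i) (P \<sigma> i)"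
    and partials_H: "\<And>\<sigma> i l. i < D \<Longrightarrow> l < D \<Longrightarrow> partials D (P \<sigma> i l) (H \<sigma> i l)"
begin

text \<open>
The elementary differentials at \<open>z0\<close> of the trees with two and three nodes. The first colour is that
of the root. In \<open>diff3_tall\<close> the three nodes form a chain; in \<open>diff3_bushy\<close> the root has two children.
\<close>

definition diff2 :: "'c \<Rightarrow> 'c \<Rightarrow> nat \<Rightarrow> real" where
  "diff2 \<sigma> \<mu> i = (\<Sum>l<D. P \<sigma> i l z0 * F \<mu> z0 l)"

definition diff3_tall :: "'c \<Rightarrow> 'c \<Rightarrow> 'c \<Rightarrow> nat \<Rightarrow> real" where
  "diff3_tall \<sigma> \<mu> \<nu> i = (\<Sum>l<D. P \<sigma> i l z0 * diff2 \<mu> \<nu> l)"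

definition diff3_bushy :: "'c \<Rightarrow> 'c \<Rightarrow> 'c \<Rightarrow> nat \<Rightarrow> real" where
  "diff3_bushy \<sigma> \<mu> \<nu> i = (\<Sum>l<D. \<Sum>m<D. H \<sigma> i l m z0 * F \<nu> z0 m * F \<mu> z0 l)"

text \<open>
The three lemmas below express one round of the bootstrap in terms of elementary differentials: they
convert what is known about the direction \<open>w\<close> into a value of the field that is known to one order
more. For the numerical stages \<open>u\<close> consists of nodes and \<open>v\<close> of products of a tableau row with the nodes;
for the exact solution they are \<open>1\<close> and \<open>1/2\<close>.
\<close>

lemma slope_expansion1:
  assumes "i < D" "\<And>l. l < D \<Longrightarrow> (\<lambda>h. w h l) \<in> Oh 0" "\<And>h l. l \<ge> D \<Longrightarrow> w h l = 0"
  shows "(\<lambda>h. F \<sigma> (\<lambda>l. z0 l + h * w h l) i - F \<sigma> z0 i) \<in> Oh 1"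
  using assms smooth_mono[OF smooth_F[OF assms(1)], of 1 \<sigma>] by (intro curve_expansion1) auto

lemma slope_expansion2:
  assumes i: "i < D" and w: "\<And>l. l < D \<Longrightarrow> (\<lambda>h. w h l - (\<Sum>\<mu>\<in>UNIV. u \<mu> * F \<mu> z0 l)) \<in> Oh 1"
    and w0: "\<And>h l. l \<ge> D \<Longrightarrow> w h l = 0"
  shows "(\<lambda>h. F \<sigma> (\<lambda>l. z0 l + h * w h l) i - (F \<sigma> z0 i + h * (\<Sum>\<mu>\<in>UNIV. u \<mu> * diff2 \<sigma> \<mu> i))) \<in> Oh 2"
proof -
  have "(\<Sum>l<D. P \<sigma> i l z0 * (\<Sum>\<mu>\<in>UNIV. u \<mu> * F \<mu> z0 l)) = (\<Sum>\<mu>\<in>UNIV. u \<mu> * diff2 \<sigma> \<mu> i)"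
    unfolding diff2_def sum_distrib_left by (subst sum.swap) (simp add: mult_ac)
  moreover have "(\<lambda>h. F \<sigma> (\<lambda>l. z0 l + h * w h l) i
      - (F \<sigma> z0 i + h * (\<Sum>l<D. P \<sigma> i l z0 * (\<Sum>\<mu>\<in>UNIV. u \<mu> * F \<mu> z0 l)))) \<in> Oh 2"
    by (rule curve_expansion2[OF smooth_mono[OF smooth_F[OF i]] partials_P[OF i]]) (rule order.refl w w0 | simp)+
  ultimately show ?thesis by simp
qed

lemma slope_expansion3:
  assumes i: "i < D"
    and w: "\<And>l. l < D \<Longrightarrow> (\<lambda>h. w h l - ((\<Sum>\<mu>\<in>UNIV. u \<mu> * F \<mu> z0 l)
                + h * (\<Sum>\<mu>\<in>UNIV. \<Sum>\<nu>\<in>UNIV. v \<mu> \<nu> * diff2 \<mu> \<nu> l))) \<in> Oh 2"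
    and w0: "\<And>h l. l \<ge> D \<Longrightarrow> w h l = 0"
  shows "(\<lambda>h. F \<sigma> (\<lambda>l. z0 l + h * w h l) i - (F \<sigma> z0 i + h * (\<Sum>\<mu>\<in>UNIV. u \<mu> * diff2 \<sigma> \<mu> i)
     + h\<^sup>2 * (\<Sum>\<mu>\<in>UNIV. \<Sum>\<nu>\<in>UNIV. v \<mu> \<nu> * diff3_tall \<sigma> \<mu> \<nu> i + u \<mu> * u \<nu> * diff3_bushy \<sigma> \<mu> \<nu> i / 2))) \<in> Oh 3"
proof -
  have lin: "(\<Sum>l<D. P \<sigma> i l z0 * (\<Sum>\<mu>\<in>UNIV. u \<mu> * F \<mu> z0 l)) = (\<Sum>\<mu>\<in>UNIV. u \<mu> * diff2 \<sigma> \<mu> i)"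
    unfolding diff2_def sum_distrib_left by (subst sum.swap) (simp add: mult_ac)
  have "(\<Sum>l<D. P \<sigma> i l z0 * (\<Sum>\<mu>\<in>UNIV. \<Sum>\<nu>\<in>UNIV. v \<mu> \<nu> * diff2 \<mu> \<nu> l))
      = (\<Sum>l<D. \<Sum>\<mu>\<in>UNIV. \<Sum>\<nu>\<in>UNIV. v \<mu> \<nu> * (P \<sigma> i l z0 * diff2 \<mu> \<nu> l))"
    by (simp add: sum_distrib_left mult_ac)
  also have "\<dots> = (\<Sum>\<mu>\<in>UNIV. \<Sum>\<nu>\<in>UNIV. \<Sum>l<D. v \<mu> \<nu> * (P \<sigma> i l z0 * diff2 \<mu> \<nu> l))"
    by (subst sum.swap, rule sum.cong[OF refl], rule sum.swap)
  also have "\<dots> = (\<Sum>\<mu>\<in>UNIV. \<Sum>\<nu>\<in>UNIV. v \<mu> \<nu> * diff3_tall \<sigma> \<mu> \<nu> i)"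
    by (simp add: diff3_tall_def sum_distrib_left)
  finally have tall: "(\<Sum>l<D. P \<sigma> i l z0 * (\<Sum>\<mu>\<in>UNIV. \<Sum>\<nu>\<in>UNIV. v \<mu> \<nu> * diff2 \<mu> \<nu> l))
      = (\<Sum>\<mu>\<in>UNIV. \<Sum>\<nu>\<in>UNIV. v \<mu> \<nu> * diff3_tall \<sigma> \<mu> \<nu> i)" .
  let ?a = "\<lambda>l. \<Sum>\<mu>\<in>UNIV. u \<mu> * F \<mu> z0 l"
  have square: "?a m * ?a l = (\<Sum>\<mu>\<in>UNIV. \<Sum>\<nu>\<in>UNIV. (u \<mu> * F \<mu> z0 l) * (u \<nu> * F \<nu> z0 m))" for l m
    by (subst mult.commute, rule sum_product)
  have "(\<Sum>l<D. \<Sum>m<D. H \<sigma> i l m z0 * ?a m * ?a l)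
      = (\<Sum>l<D. \<Sum>m<D. \<Sum>\<mu>\<in>UNIV. \<Sum>\<nu>\<in>UNIV. u \<mu> * u \<nu> * (H \<sigma> i l m z0 * F \<nu> z0 m * F \<mu> z0 l))"
    by (simp only: mult.assoc[of "H _ _ _ _ _"] square) (simp add: sum_distrib_left mult_ac)
  also have "\<dots> = (\<Sum>l<D. \<Sum>\<mu>\<in>UNIV. \<Sum>m<D. \<Sum>\<nu>\<in>UNIV. u \<mu> * u \<nu> * (H \<sigma> i l m z0 * F \<nu> z0 m * F \<mu> z0 l))"
    by (rule sum.cong[OF refl], rule sum.swap)
  also have "\<dots> = (\<Sum>\<mu>\<in>UNIV. \<Sum>l<D. \<Sum>m<D. \<Sum>\<nu>\<in>UNIV. u \<mu> * u \<nu> * (H \<sigma> i l m z0 * F \<nu> z0 m * F \<mu> z0 l))"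
    by (rule sum.swap)
  also have "\<dots> = (\<Sum>\<mu>\<in>UNIV. \<Sum>l<D. \<Sum>\<nu>\<in>UNIV. \<Sum>m<D. u \<mu> * u \<nu> * (H \<sigma> i l m z0 * F \<nu> z0 m * F \<mu> z0 l))"
    by (rule sum.cong[OF refl], rule sum.cong[OF refl], rule sum.swap)
  also have "\<dots> = (\<Sum>\<mu>\<in>UNIV. \<Sum>\<nu>\<in>UNIV. \<Sum>l<D. \<Sum>m<D. u \<mu> * u \<nu> * (H \<sigma> i l m z0 * F \<nu> z0 m * F \<mu> z0 l))"
    by (rule sum.cong[OF refl], rule sum.swap)
  also have "\<dots> = (\<Sum>\<mu>\<in>UNIV. \<Sum>\<nu>\<in>UNIV. u \<mu> * u \<nu> * diff3_bushy \<sigma> \<mu> \<nu> i)"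
    by (simp add: diff3_bushy_def sum_distrib_left)
  finally have bushy: "(\<Sum>l<D. \<Sum>m<D. H \<sigma> i l m z0 * ?a m * ?a l)
      = (\<Sum>\<mu>\<in>UNIV. \<Sum>\<nu>\<in>UNIV. u \<mu> * u \<nu> * diff3_bushy \<sigma> \<mu> \<nu> i)" .
  have "(\<lambda>h. F \<sigma> (\<lambda>l. z0 l + h * w h l) i - (F \<sigma> z0 i + h * (\<Sum>l<D. P \<sigma> i l z0 * ?a l)
      + h\<^sup>2 * ((\<Sum>l<D. P \<sigma> i l z0 * (\<Sum>\<mu>\<in>UNIV. \<Sum>\<nu>\<in>UNIV. v \<mu> \<nu> * diff2 \<mu> \<nu> l))
        + (\<Sum>l<D. \<Sum>m<D. H \<sigma> i l m z0 * ?a m * ?a l) / 2))) \<in> Oh 3"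
    by (rule curve_expansion3[OF smooth_F[OF i] partials_P[OF i] partials_H[OF i]]) (use w w0 in auto)
  then show ?thesis
    unfolding lin tall bushy by (simp add: sum.distrib sum_divide_distrib)
qed

text \<open>
The directions from \<open>z0\<close> to the stages are linear combinations of the stage slopes, so each expansion of
the slopes yields an expansion of the directions of the same order, and then one of the slopes that is
one order better.
\<close>

lemma stage_slope_expansions:
  fixes A :: "'c \<Rightarrow> nat \<Rightarrow> nat \<Rightarrow> real" and g :: "real \<Rightarrow> nat \<Rightarrow> rvec" and J :: "nat set"
  defines "c \<equiv> \<lambda>\<mu> j. \<Sum>k\<in>J. A \<mu> j k"
  assumes sol: "\<forall>\<^sub>F h in at_right 0. stage_solution A F J D z0 \<rho> h (g h)"
    and j: "j \<in> J" and i: "i < D"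
  shows "(\<lambda>h. F \<sigma> (g h j) i - (F \<sigma> z0 i + h * (\<Sum>\<mu>\<in>UNIV. c \<mu> j * diff2 \<sigma> \<mu> i))) \<in> Oh 2" (is ?second)
    and "(\<lambda>h. F \<sigma> (g h j) i - (F \<sigma> z0 i + h * (\<Sum>\<mu>\<in>UNIV. c \<mu> j * diff2 \<sigma> \<mu> i)
     + h\<^sup>2 * (\<Sum>\<mu>\<in>UNIV. \<Sum>\<nu>\<in>UNIV. (\<Sum>k\<in>J. A \<mu> j k * c \<nu> k) * diff3_tall \<sigma> \<mu> \<nu> i
                        + c \<mu> j * c \<nu> j * diff3_bushy \<sigma> \<mu> \<nu> i / 2))) \<in> Oh 3" (is ?third)
proof -
  have stage: "\<forall>\<^sub>F h in at_right 0. g h j \<in> cube D z0 \<rho> \<and>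
      (\<forall>l<D. g h j l = z0 l + h * (\<Sum>k\<in>J. \<Sum>\<mu>\<in>UNIV. A \<mu> j k * F \<mu> (g h k) l))" if "j \<in> J" for j
    using sol by eventually_elim (use that in \<open>simp add: stage_solution_def\<close>)
  define w where "w = (\<lambda>h j l. if l < D then \<Sum>k\<in>J. \<Sum>\<mu>\<in>UNIV. A \<mu> j k * F \<mu> (g h k) l else 0)"
  have w0: "w h j l = 0" if "l \<ge> D" for h j l using that by (simp add: w_def)
  have on_line: "\<forall>\<^sub>F h in at_right 0. F \<sigma> (\<lambda>l. z0 l + h * w h j l) i = F \<sigma> (g h j) i" if "j \<in> J" for \<sigma> j i
  proof -
    have "\<forall>\<^sub>F h in at_right 0. (\<lambda>l. z0 l + h * w h j l) = g h j"
      using stage[OF that] by eventually_elim (auto simp: w_def cube_iff fun_eq_iff)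
    then show ?thesis by eventually_elim simp
  qed
  have slope0: "(\<lambda>h. F \<sigma> (g h j) i) \<in> Oh 0" if j: "j \<in> J" and i: "i < D" for \<sigma> j i
  proof -
    obtain C where C: "\<And>u. u \<in> cube D z0 \<rho> \<Longrightarrow> \<bar>F \<sigma> u i\<bar> \<le> C"
      using bounded_on_cube[OF smooth_imp_continuous[OF smooth_F[OF i]]] by metis
    have "\<forall>\<^sub>F h in at_right 0. \<bar>F \<sigma> (g h j) i\<bar> \<le> C * h ^ 0"
      using stage[OF j] by eventually_elim (simp add: C)
    then show ?thesis by (rule Oh_I)
  qed
  have w_bounded: "(\<lambda>h. w h j l) \<in> Oh 0" if "l < D" for j l
    using that slope0 by (auto simp: w_def simp del: power_0 intro!: Oh_sum Oh_cmult)
  have slope1: "(\<lambda>h. F \<sigma> (g h j) i - F \<sigma> z0 i) \<in> Oh 1" if "j \<in> J" "i < D" for \<sigma> j i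
    by (rule Oh_cong[OF slope_expansion1[OF that(2), of "\<lambda>h. w h j" \<sigma>]])
       (use w_bounded w0 on_line[OF that(1)] in \<open>auto elim!: eventually_mono\<close>)
  have w1: "(\<lambda>h. w h j l - (\<Sum>\<mu>\<in>UNIV. c \<mu> j * F \<mu> z0 l)) \<in> Oh 1" if "l < D" for j l
  proof -
    have "(\<lambda>h. \<Sum>k\<in>J. \<Sum>\<mu>\<in>UNIV. A \<mu> j k * (F \<mu> (g h k) l - F \<mu> z0 l)) \<in> Oh 1"
      using slope1 that by (intro Oh_sum Oh_cmult) auto
    moreover have "(\<Sum>k\<in>J. \<Sum>\<mu>\<in>UNIV. A \<mu> j k * F \<mu> z0 l) = (\<Sum>\<mu>\<in>UNIV. c \<mu> j * F \<mu> z0 l)"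
      unfolding c_def sum_distrib_right by (rule sum.swap)
    ultimately show ?thesis
      using that by (simp add: w_def right_diff_distrib sum_subtractf)
  qed
  have slope2: "(\<lambda>h. F \<sigma> (g h j) i - (F \<sigma> z0 i + h * (\<Sum>\<mu>\<in>UNIV. c \<mu> j * diff2 \<sigma> \<mu> i))) \<in> Oh 2"
    if "j \<in> J" "i < D" for \<sigma> j i
    by (rule Oh_cong[OF slope_expansion2[OF that(2), of "\<lambda>h. w h j" "\<lambda>\<mu>. c \<mu> j" \<sigma>]])
       (use w1 w0 on_line[OF that(1)] in \<open>auto elim!: eventually_mono\<close>)
  have w2: "(\<lambda>h. w h j l - ((\<Sum>\<mu>\<in>UNIV. c \<mu> j * F \<mu> z0 l)
      + h * (\<Sum>\<mu>\<in>UNIV. \<Sum>\<nu>\<in>UNIV. (\<Sum>k\<in>J. A \<mu> j k * c \<nu> k) * diff2 \<mu> \<nu> l))) \<in> Oh 2" if "l < D" for j l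
  proof -
    have "(\<lambda>h. \<Sum>k\<in>J. \<Sum>\<mu>\<in>UNIV. A \<mu> j k *
        (F \<mu> (g h k) l - (F \<mu> z0 l + h * (\<Sum>\<nu>\<in>UNIV. c \<nu> k * diff2 \<mu> \<nu> l)))) \<in> Oh 2"
      using slope2 that by (intro Oh_sum Oh_cmult) auto
    moreover have "(\<Sum>k\<in>J. \<Sum>\<mu>\<in>UNIV. A \<mu> j k * F \<mu> z0 l) = (\<Sum>\<mu>\<in>UNIV. c \<mu> j * F \<mu> z0 l)"
      unfolding c_def sum_distrib_right by (rule sum.swap)
    moreover have "(\<Sum>k\<in>J. \<Sum>\<mu>\<in>UNIV. A \<mu> j k * (h * (\<Sum>\<nu>\<in>UNIV. c \<nu> k * diff2 \<mu> \<nu> l)))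
       = h * (\<Sum>\<mu>\<in>UNIV. \<Sum>\<nu>\<in>UNIV. (\<Sum>k\<in>J. A \<mu> j k * c \<nu> k) * diff2 \<mu> \<nu> l)" for h
    proof -
      have "(\<Sum>k\<in>J. \<Sum>\<mu>\<in>UNIV. A \<mu> j k * (h * (\<Sum>\<nu>\<in>UNIV. c \<nu> k * diff2 \<mu> \<nu> l)))
          = h * (\<Sum>k\<in>J. \<Sum>\<mu>\<in>UNIV. \<Sum>\<nu>\<in>UNIV. A \<mu> j k * c \<nu> k * diff2 \<mu> \<nu> l)"
        by (simp add: sum_distrib_left mult_ac)
      also have "(\<Sum>k\<in>J. \<Sum>\<mu>\<in>UNIV. \<Sum>\<nu>\<in>UNIV. A \<mu> j k * c \<nu> k * diff2 \<mu> \<nu> l)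
          = (\<Sum>\<mu>\<in>UNIV. \<Sum>\<nu>\<in>UNIV. \<Sum>k\<in>J. A \<mu> j k * c \<nu> k * diff2 \<mu> \<nu> l)"
        by (subst sum.swap, rule sum.cong[OF refl], rule sum.swap)
      finally show ?thesis by (simp add: sum_distrib_right)
    qed
    ultimately show ?thesis
      using that by (simp add: w_def right_diff_distrib distrib_left sum_subtractf sum.distrib)
  qed
  show ?second by (rule slope2[OF j i])
  show ?third
    by (rule Oh_cong[OF slope_expansion3[OF i, of "\<lambda>h. w h j" "\<lambda>\<mu>. c \<mu> j"
            "\<lambda>\<mu> \<nu>. \<Sum>k\<in>J. A \<mu> j k * c \<nu> k" \<sigma>]])
       (use w2 w0 on_line[OF j] in \<open>auto elim!: eventually_mono\<close>)
qed

end

section \<open>Expansion of the exact solution and of the numerical result\<close>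

context coloured_jet
begin

text \<open>
The same bootstrap as for the stages, with integration in place of multiplication by the tableau:
the direction is now the difference quotient of the solution.
\<close>

lemma exact_solution_expansions:
  assumes T: "0 < T" and y0: "y 0 = z0"
    and der: "\<And>\<tau> l. \<tau> \<in> {0..T} \<Longrightarrow> l < D \<Longrightarrow>
       ((\<lambda>u. y u l) has_real_derivative (\<Sum>\<sigma>\<in>UNIV. F \<sigma> (y \<tau>) l)) (at \<tau> within {0..T})"
    and off: "\<And>\<tau> l. \<tau> \<in> {0..T} \<Longrightarrow> D \<le> l \<Longrightarrow> y \<tau> l = z0 l"
    and i: "i < D"
  shows "(\<lambda>h. y h i - z0 i - (h * (\<Sum>\<sigma>\<in>UNIV. F \<sigma> z0 i)
            + h\<^sup>2 / 2 * (\<Sum>\<sigma>\<in>UNIV. \<Sum>\<mu>\<in>UNIV. diff2 \<sigma> \<mu> i))) \<in> Oh 3" (is ?second)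
    and "(\<lambda>h. y h i - z0 i - (h * (\<Sum>\<sigma>\<in>UNIV. F \<sigma> z0 i)
            + h\<^sup>2 / 2 * (\<Sum>\<sigma>\<in>UNIV. \<Sum>\<mu>\<in>UNIV. diff2 \<sigma> \<mu> i)
            + h ^ 3 / 6 * (\<Sum>\<sigma>\<in>UNIV. \<Sum>\<mu>\<in>UNIV. \<Sum>\<nu>\<in>UNIV. diff3_tall \<sigma> \<mu> \<nu> i + diff3_bushy \<sigma> \<mu> \<nu> i))) \<in> Oh 4" (is ?third)
proof -
  have [simp]: "at 0 within {0..T} = at_right 0"
    using T by (rule at_within_Icc_at_right)
  have early: "\<forall>\<^sub>F h in at_right 0. h \<in> {0<..<T}"
    using T by (rule eventually_at_right_real)
  define w where "w = (\<lambda>h l. if l < D then (y h l - z0 l) / h else 0)"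
  have w0: "w h l = 0" if "l \<ge> D" for h l using that by (simp add: w_def)
  have on_line: "\<forall>\<^sub>F h in at_right 0. F \<sigma> (\<lambda>l. z0 l + h * w h l) i = F \<sigma> (y h) i" for \<sigma> i
    using early
  proof eventually_elim
    case (elim h)
    then have "(\<lambda>l. z0 l + h * w h l) = y h" by (auto simp: w_def fun_eq_iff off)
    then show ?case by simp
  qed
  have integrate: "(\<lambda>h. y h l - z0 l - q h) \<in> Oh (Suc k)"
    if "(\<lambda>h. (\<Sum>\<sigma>\<in>UNIV. F \<sigma> (y h) l) - q' h) \<in> Oh k" "l < D" "q 0 = 0"
      "\<And>\<tau>. (q has_real_derivative q' \<tau>) (at \<tau>)" for l q q' k
    by (rule Oh_antiderivative[OF T _ _ that(1)])
       (use y0 that(2-4) der in \<open>auto intro!: derivative_eq_intros has_field_derivative_at_within[OF that(4)]\<close>)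
  have divide: "(\<lambda>h. w h l - q h) \<in> Oh k" if "(\<lambda>h. y h l - z0 l - h * q h) \<in> Oh (Suc k)" "l < D" for l q k
  proof (rule Oh_cong[OF Oh_divide[OF that(1)]])
    show "\<forall>\<^sub>F h in at_right 0. (y h l - z0 l - h * q h) / h = w h l - q h"
      using early by eventually_elim (use that(2) in \<open>auto simp: w_def field_simps\<close>)
  qed

  have slope0: "(\<lambda>h. F \<sigma> (y h) l) \<in> Oh 0" if l: "l < D" for \<sigma> l
  proof -
    have "\<forall>\<^sub>F h in at_right 0. \<bar>y h m - z0 m\<bar> < 1" if "m < D" for m
    proof -
      have "((\<lambda>u. y u m) \<longlongrightarrow> y 0 m) (at_right 0)"
        using DERIV_continuous[OF der[of 0 m]] that T by (simp add: continuous_within)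
      from tendstoD[OF this, of 1] show ?thesis by (simp add: y0 dist_real_def)
    qed
    then have "\<forall>\<^sub>F h in at_right 0. \<forall>m\<in>{..<D}. \<bar>y h m - z0 m\<bar> < 1"
      by (intro eventually_ball_finite) auto
    then have in_cube: "\<forall>\<^sub>F h in at_right 0. y h \<in> cube D z0 1"
      using early by eventually_elim (auto simp: cube_iff off less_imp_le)
    obtain C where C: "\<And>u. u \<in> cube D z0 1 \<Longrightarrow> \<bar>F \<sigma> u l\<bar> \<le> C"
      using bounded_on_cube[OF smooth_imp_continuous[OF smooth_F[OF l]]] by metis
    have "\<forall>\<^sub>F h in at_right 0. \<bar>F \<sigma> (y h) l\<bar> \<le> C * h ^ 0"
      using in_cube by eventually_elim (simp add: C)
    then show ?thesis by (rule Oh_I)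
  qed
  have "(\<lambda>h. y h l - z0 l - 0) \<in> Oh (Suc 0)" if "l < D" for l
    by (rule integrate[where q' = "\<lambda>_. 0"])
       (use that slope0 in \<open>auto simp del: power_0 intro!: Oh_sum\<close>)
  then have w_bounded: "(\<lambda>h. w h l) \<in> Oh 0" if "l < D" for l
    using divide[of l "\<lambda>_. 0" 0] that by simp

  have slope1: "(\<lambda>h. F \<sigma> (y h) l - F \<sigma> z0 l) \<in> Oh 1" if "l < D" for \<sigma> l
    by (rule Oh_cong[OF slope_expansion1[OF that, of w \<sigma>]])
       (use w_bounded w0 on_line in \<open>auto elim!: eventually_mono\<close>)
  have "(\<lambda>h. (\<Sum>\<sigma>\<in>UNIV. F \<sigma> (y h) l) - (\<Sum>\<sigma>\<in>UNIV. F \<sigma> z0 l)) \<in> Oh 1" if "l < D" for l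
    unfolding sum_subtractf[symmetric] using slope1[OF that] by (rule Oh_sum)
  then have "(\<lambda>h. y h l - z0 l - h * (\<Sum>\<sigma>\<in>UNIV. F \<sigma> z0 l)) \<in> Oh (Suc 1)" if "l < D" for l
    by (rule integrate) (use that in \<open>auto intro!: derivative_eq_intros\<close>)
  then have w1: "(\<lambda>h. w h l - (\<Sum>\<sigma>\<in>UNIV. 1 * F \<sigma> z0 l)) \<in> Oh 1" if "l < D" for l
    using divide[of l "\<lambda>_. \<Sum>\<sigma>\<in>UNIV. F \<sigma> z0 l" 1] that by simp

  have slope2: "(\<lambda>h. F \<sigma> (y h) l - (F \<sigma> z0 l + h * (\<Sum>\<mu>\<in>UNIV. 1 * diff2 \<sigma> \<mu> l))) \<in> Oh 2" if "l < D" for \<sigma> l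
    by (rule Oh_cong[OF slope_expansion2[OF that, of w "\<lambda>_. 1" \<sigma>]])
       (use w1 w0 on_line in \<open>auto elim!: eventually_mono\<close>)
  have "(\<lambda>h. (\<Sum>\<sigma>\<in>UNIV. F \<sigma> (y h) l) - ((\<Sum>\<sigma>\<in>UNIV. F \<sigma> z0 l)
      + h * (\<Sum>\<sigma>\<in>UNIV. \<Sum>\<mu>\<in>UNIV. diff2 \<sigma> \<mu> l))) \<in> Oh 2" if "l < D" for l
    unfolding sum_distrib_left[of _ _ UNIV] sum.distrib[symmetric] sum_subtractf[symmetric]
    using slope2[OF that] by (intro Oh_sum) (simp add: sum_distrib_left)
  then have y2: "(\<lambda>h. y h l - z0 l - (h * (\<Sum>\<sigma>\<in>UNIV. F \<sigma> z0 l)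
      + h\<^sup>2 / 2 * (\<Sum>\<sigma>\<in>UNIV. \<Sum>\<mu>\<in>UNIV. diff2 \<sigma> \<mu> l))) \<in> Oh (Suc 2)" if "l < D" for l
    by (rule integrate) (use that in \<open>auto intro!: derivative_eq_intros\<close>)
  from y2[OF i] show ?second by (simp add: numeral_3_eq_3 numeral_2_eq_2)
  have w2: "(\<lambda>h. w h l - ((\<Sum>\<sigma>\<in>UNIV. 1 * F \<sigma> z0 l)
      + h * (\<Sum>\<mu>\<in>UNIV. \<Sum>\<nu>\<in>UNIV. 1 / 2 * diff2 \<mu> \<nu> l))) \<in> Oh 2" if "l < D" for l
  proof (rule divide[OF _ that])
    show "(\<lambda>h. y h l - z0 l - h * ((\<Sum>\<sigma>\<in>UNIV. 1 * F \<sigma> z0 l)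
      + h * (\<Sum>\<mu>\<in>UNIV. \<Sum>\<nu>\<in>UNIV. 1 / 2 * diff2 \<mu> \<nu> l))) \<in> Oh (Suc 2)"
      using y2[OF that] by (simp add: algebra_simps power2_eq_square flip: sum_divide_distrib)
  qed
  have slope3: "(\<lambda>h. F \<sigma> (y h) l - (F \<sigma> z0 l + h * (\<Sum>\<mu>\<in>UNIV. 1 * diff2 \<sigma> \<mu> l)
       + h\<^sup>2 * (\<Sum>\<mu>\<in>UNIV. \<Sum>\<nu>\<in>UNIV. 1 / 2 * diff3_tall \<sigma> \<mu> \<nu> l + 1 * 1 * diff3_bushy \<sigma> \<mu> \<nu> l / 2))) \<in> Oh 3" if "l < D" for \<sigma> l
    by (rule Oh_cong[OF slope_expansion3[OF that, of w "\<lambda>_. 1" "\<lambda>_ _. 1/2" \<sigma>]])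
       (use w2 w0 on_line in \<open>auto elim!: eventually_mono\<close>)
  have "(\<lambda>h. \<Sum>\<sigma>\<in>UNIV. F \<sigma> (y h) i - (F \<sigma> z0 i + h * (\<Sum>\<mu>\<in>UNIV. 1 * diff2 \<sigma> \<mu> i)
       + h\<^sup>2 * (\<Sum>\<mu>\<in>UNIV. \<Sum>\<nu>\<in>UNIV. 1 / 2 * diff3_tall \<sigma> \<mu> \<nu> i + 1 * 1 * diff3_bushy \<sigma> \<mu> \<nu> i / 2))) \<in> Oh 3"
    using slope3[OF i] by (rule Oh_sum)
  also have "(\<lambda>h. \<Sum>\<sigma>\<in>UNIV. F \<sigma> (y h) i - (F \<sigma> z0 i + h * (\<Sum>\<mu>\<in>UNIV. 1 * diff2 \<sigma> \<mu> i)
       + h\<^sup>2 * (\<Sum>\<mu>\<in>UNIV. \<Sum>\<nu>\<in>UNIV. 1 / 2 * diff3_tall \<sigma> \<mu> \<nu> i + 1 * 1 * diff3_bushy \<sigma> \<mu> \<nu> i / 2)))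
     = (\<lambda>h. (\<Sum>\<sigma>\<in>UNIV. F \<sigma> (y h) i) - ((\<Sum>\<sigma>\<in>UNIV. F \<sigma> z0 i)
      + h * (\<Sum>\<sigma>\<in>UNIV. \<Sum>\<mu>\<in>UNIV. diff2 \<sigma> \<mu> i)
      + h\<^sup>2 / 2 * (\<Sum>\<sigma>\<in>UNIV. \<Sum>\<mu>\<in>UNIV. \<Sum>\<nu>\<in>UNIV. diff3_tall \<sigma> \<mu> \<nu> i + diff3_bushy \<sigma> \<mu> \<nu> i)))"
    by (simp add: fun_eq_iff sum_subtractf sum.distrib add_divide_distrib distrib_left
          flip: sum_distrib_left sum_divide_distrib)
  finally have "(\<lambda>h. y h i - z0 i - (h * (\<Sum>\<sigma>\<in>UNIV. F \<sigma> z0 i)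
      + h\<^sup>2 / 2 * (\<Sum>\<sigma>\<in>UNIV. \<Sum>\<mu>\<in>UNIV. diff2 \<sigma> \<mu> i)
      + h ^ 3 / 6 * (\<Sum>\<sigma>\<in>UNIV. \<Sum>\<mu>\<in>UNIV. \<Sum>\<nu>\<in>UNIV. diff3_tall \<sigma> \<mu> \<nu> i + diff3_bushy \<sigma> \<mu> \<nu> i))) \<in> Oh (Suc 3)"
    by (rule integrate[OF _ i]) (auto intro!: derivative_eq_intros)
  then show ?third by (simp add: eval_nat_numeral)
qed

text \<open>
The order conditions say that the weighted sums over the stages replace the coefficients of every
elementary differential in the slopes by those in the exact solution.
\<close>

lemma method_expansions:
  fixes A :: "'c \<Rightarrow> nat \<Rightarrow> nat \<Rightarrow> real" and b :: "'c \<Rightarrow> nat \<Rightarrow> real"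
    and g :: "real \<Rightarrow> nat \<Rightarrow> rvec" and J :: "nat set"
  defines "c \<equiv> \<lambda>\<mu> j. \<Sum>k\<in>J. A \<mu> j k"
  assumes sol: "\<forall>\<^sub>F h in at_right 0. stage_solution A F J D z0 \<rho> h (g h)"
    and i: "i < D"
    and order1: "\<And>\<sigma>. (\<Sum>j\<in>J. b \<sigma> j) = 1"
    and order2: "\<And>\<sigma> \<mu>. (\<Sum>j\<in>J. b \<sigma> j * c \<mu> j) = 1/2"
  shows "(\<lambda>h. h * (\<Sum>j\<in>J. \<Sum>\<sigma>\<in>UNIV. b \<sigma> j * F \<sigma> (g h j) i) - (h * (\<Sum>\<sigma>\<in>UNIV. F \<sigma> z0 i)
            + h\<^sup>2 / 2 * (\<Sum>\<sigma>\<in>UNIV. \<Sum>\<mu>\<in>UNIV. diff2 \<sigma> \<mu> i))) \<in> Oh 3" (is ?second)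
    and "(\<And>\<sigma> \<mu> \<nu>. (\<Sum>j\<in>J. b \<sigma> j * (\<Sum>k\<in>J. A \<mu> j k * c \<nu> k)) = 1/6) \<Longrightarrow>
         (\<And>\<sigma> \<mu> \<nu>. (\<Sum>j\<in>J. b \<sigma> j * (c \<mu> j * c \<nu> j)) = 1/3) \<Longrightarrow>
         (\<lambda>h. h * (\<Sum>j\<in>J. \<Sum>\<sigma>\<in>UNIV. b \<sigma> j * F \<sigma> (g h j) i) - (h * (\<Sum>\<sigma>\<in>UNIV. F \<sigma> z0 i)
            + h\<^sup>2 / 2 * (\<Sum>\<sigma>\<in>UNIV. \<Sum>\<mu>\<in>UNIV. diff2 \<sigma> \<mu> i)
            + h ^ 3 / 6 * (\<Sum>\<sigma>\<in>UNIV. \<Sum>\<mu>\<in>UNIV. \<Sum>\<nu>\<in>UNIV. diff3_tall \<sigma> \<mu> \<nu> i + diff3_bushy \<sigma> \<mu> \<nu> i))) \<in> Oh 4"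
proof -
  note slopes = stage_slope_expansions[OF sol]
  have swap1: "(\<Sum>j\<in>J. \<Sum>\<sigma>\<in>UNIV. b \<sigma> j * F \<sigma> z0 i) = (\<Sum>\<sigma>\<in>UNIV. F \<sigma> z0 i)"
    by (subst sum.swap) (simp add: order1 flip: sum_distrib_right)
  have swap2: "(\<Sum>j\<in>J. \<Sum>\<sigma>\<in>UNIV. b \<sigma> j * (\<Sum>\<mu>\<in>UNIV. c \<mu> j * diff2 \<sigma> \<mu> i))
      = 1/2 * (\<Sum>\<sigma>\<in>UNIV. \<Sum>\<mu>\<in>UNIV. diff2 \<sigma> \<mu> i)"
  proof -
    have "(\<Sum>j\<in>J. \<Sum>\<sigma>\<in>UNIV. b \<sigma> j * (\<Sum>\<mu>\<in>UNIV. c \<mu> j * diff2 \<sigma> \<mu> i))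
        = (\<Sum>j\<in>J. \<Sum>\<sigma>\<in>UNIV. \<Sum>\<mu>\<in>UNIV. b \<sigma> j * c \<mu> j * diff2 \<sigma> \<mu> i)"
      by (simp add: sum_distrib_left mult_ac)
    also have "\<dots> = (\<Sum>\<sigma>\<in>UNIV. \<Sum>\<mu>\<in>UNIV. \<Sum>j\<in>J. b \<sigma> j * c \<mu> j * diff2 \<sigma> \<mu> i)"
      by (subst sum.swap, rule sum.cong[OF refl], rule sum.swap)
    also have "\<dots> = (\<Sum>\<sigma>\<in>UNIV. \<Sum>\<mu>\<in>UNIV. 1/2 * diff2 \<sigma> \<mu> i)"
      unfolding sum_distrib_right[symmetric] order2 ..
    finally show ?thesis by (simp add: sum_distrib_left)
  qed
  have "(\<lambda>h. h ^ 1 * (\<Sum>j\<in>J. \<Sum>\<sigma>\<in>UNIV. b \<sigma> j *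
      (F \<sigma> (g h j) i - (F \<sigma> z0 i + h * (\<Sum>\<mu>\<in>UNIV. c \<mu> j * diff2 \<sigma> \<mu> i))))) \<in> Oh (1 + 2)"
    using slopes(1)[OF _ i] unfolding c_def by (intro Oh_shift Oh_sum Oh_cmult) auto
  also have "(\<lambda>h. h ^ 1 * (\<Sum>j\<in>J. \<Sum>\<sigma>\<in>UNIV. b \<sigma> j *
      (F \<sigma> (g h j) i - (F \<sigma> z0 i + h * (\<Sum>\<mu>\<in>UNIV. c \<mu> j * diff2 \<sigma> \<mu> i)))))
    = (\<lambda>h. h * ((\<Sum>j\<in>J. \<Sum>\<sigma>\<in>UNIV. b \<sigma> j * F \<sigma> (g h j) i) - ((\<Sum>j\<in>J. \<Sum>\<sigma>\<in>UNIV. b \<sigma> j * F \<sigma> z0 i)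
       + h * (\<Sum>j\<in>J. \<Sum>\<sigma>\<in>UNIV. b \<sigma> j * (\<Sum>\<mu>\<in>UNIV. c \<mu> j * diff2 \<sigma> \<mu> i)))))"
    by (simp add: right_diff_distrib distrib_left sum_subtractf sum.distrib mult.left_commute[of "b _ _"]
          flip: sum_distrib_left)
  finally show ?second
    unfolding swap1 swap2 by (simp add: algebra_simps power2_eq_square power3_eq_cube)

  assume tall: "\<And>\<sigma> \<mu> \<nu>. (\<Sum>j\<in>J. b \<sigma> j * (\<Sum>k\<in>J. A \<mu> j k * c \<nu> k)) = 1/6"
    and bushy: "\<And>\<sigma> \<mu> \<nu>. (\<Sum>j\<in>J. b \<sigma> j * (c \<mu> j * c \<nu> j)) = 1/3"
  let ?e = "\<lambda>j \<sigma>. \<Sum>\<mu>\<in>UNIV. \<Sum>\<nu>\<in>UNIV. (\<Sum>k\<in>J. A \<mu> j k * c \<nu> k) * diff3_tall \<sigma> \<mu> \<nu> i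
                        + c \<mu> j * c \<nu> j * diff3_bushy \<sigma> \<mu> \<nu> i / 2"
  have swap3: "(\<Sum>j\<in>J. \<Sum>\<sigma>\<in>UNIV. b \<sigma> j * ?e j \<sigma>)
      = 1/6 * (\<Sum>\<sigma>\<in>UNIV. \<Sum>\<mu>\<in>UNIV. \<Sum>\<nu>\<in>UNIV. diff3_tall \<sigma> \<mu> \<nu> i + diff3_bushy \<sigma> \<mu> \<nu> i)"
  proof -
    have "(\<Sum>j\<in>J. \<Sum>\<sigma>\<in>UNIV. b \<sigma> j * ?e j \<sigma>)
        = (\<Sum>j\<in>J. \<Sum>\<sigma>\<in>UNIV. \<Sum>\<mu>\<in>UNIV. \<Sum>\<nu>\<in>UNIV. (b \<sigma> j * (\<Sum>k\<in>J. A \<mu> j k * c \<nu> k)) * diff3_tall \<sigma> \<mu> \<nu> i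
                        + (b \<sigma> j * (c \<mu> j * c \<nu> j)) * (diff3_bushy \<sigma> \<mu> \<nu> i / 2))"
      by (simp add: sum_distrib_left[where A = "UNIV :: 'c set"] distrib_left mult.assoc)
    also have "\<dots> = (\<Sum>\<sigma>\<in>UNIV. \<Sum>j\<in>J. \<Sum>\<mu>\<in>UNIV. \<Sum>\<nu>\<in>UNIV. (b \<sigma> j * (\<Sum>k\<in>J. A \<mu> j k * c \<nu> k)) * diff3_tall \<sigma> \<mu> \<nu> i
                        + (b \<sigma> j * (c \<mu> j * c \<nu> j)) * (diff3_bushy \<sigma> \<mu> \<nu> i / 2))"
      by (rule sum.swap)
    also have "\<dots> = (\<Sum>\<sigma>\<in>UNIV. \<Sum>\<mu>\<in>UNIV. \<Sum>j\<in>J. \<Sum>\<nu>\<in>UNIV. (b \<sigma> j * (\<Sum>k\<in>J. A \<mu> j k * c \<nu> k)) * diff3_tall \<sigma> \<mu> \<nu> i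
                        + (b \<sigma> j * (c \<mu> j * c \<nu> j)) * (diff3_bushy \<sigma> \<mu> \<nu> i / 2))"
      by (rule sum.cong[OF refl], rule sum.swap)
    also have "\<dots> = (\<Sum>\<sigma>\<in>UNIV. \<Sum>\<mu>\<in>UNIV. \<Sum>\<nu>\<in>UNIV. \<Sum>j\<in>J. (b \<sigma> j * (\<Sum>k\<in>J. A \<mu> j k * c \<nu> k)) * diff3_tall \<sigma> \<mu> \<nu> i
                        + (b \<sigma> j * (c \<mu> j * c \<nu> j)) * (diff3_bushy \<sigma> \<mu> \<nu> i / 2))"
      by (rule sum.cong[OF refl], rule sum.cong[OF refl], rule sum.swap)
    also have "\<dots> = (\<Sum>\<sigma>\<in>UNIV. \<Sum>\<mu>\<in>UNIV. \<Sum>\<nu>\<in>UNIV. 1/6 * (diff3_tall \<sigma> \<mu> \<nu> i + diff3_bushy \<sigma> \<mu> \<nu> i))"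
      unfolding sum.distrib[of _ _ J] sum_distrib_right[symmetric] tall bushy by (simp add: add_divide_distrib)
    finally show ?thesis by (simp only: sum_distrib_left)
  qed
  have "(\<lambda>h. h ^ 1 * (\<Sum>j\<in>J. \<Sum>\<sigma>\<in>UNIV. b \<sigma> j *
      (F \<sigma> (g h j) i - (F \<sigma> z0 i + h * (\<Sum>\<mu>\<in>UNIV. c \<mu> j * diff2 \<sigma> \<mu> i) + h\<^sup>2 * ?e j \<sigma>)))) \<in> Oh (1 + 3)"
    using slopes(2)[OF _ i] unfolding c_def by (intro Oh_shift Oh_sum Oh_cmult) auto
  moreover have factor: "h ^ 1 * (\<Sum>j\<in>J. \<Sum>\<sigma>\<in>UNIV. b \<sigma> j *
      (F \<sigma> (g h j) i - (F \<sigma> z0 i + h * (\<Sum>\<mu>\<in>UNIV. c \<mu> j * diff2 \<sigma> \<mu> i) + h\<^sup>2 * e j \<sigma>)))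
    = h * ((\<Sum>j\<in>J. \<Sum>\<sigma>\<in>UNIV. b \<sigma> j * F \<sigma> (g h j) i) - ((\<Sum>j\<in>J. \<Sum>\<sigma>\<in>UNIV. b \<sigma> j * F \<sigma> z0 i)
       + h * (\<Sum>j\<in>J. \<Sum>\<sigma>\<in>UNIV. b \<sigma> j * (\<Sum>\<mu>\<in>UNIV. c \<mu> j * diff2 \<sigma> \<mu> i))
       + h\<^sup>2 * (\<Sum>j\<in>J. \<Sum>\<sigma>\<in>UNIV. b \<sigma> j * e j \<sigma>)))" for h e
    by (simp add: right_diff_distrib distrib_left[of "b _ _"] sum_subtractf sum.distrib[of _ _ UNIV]
          sum.distrib[of _ _ J] mult.left_commute[of "b _ _"] flip: sum_distrib_left)
  ultimately have "(\<lambda>h. h * ((\<Sum>j\<in>J. \<Sum>\<sigma>\<in>UNIV. b \<sigma> j * F \<sigma> (g h j) i) - ((\<Sum>j\<in>J. \<Sum>\<sigma>\<in>UNIV. b \<sigma> j * F \<sigma> z0 i)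
       + h * (\<Sum>j\<in>J. \<Sum>\<sigma>\<in>UNIV. b \<sigma> j * (\<Sum>\<mu>\<in>UNIV. c \<mu> j * diff2 \<sigma> \<mu> i))
       + h\<^sup>2 * (\<Sum>j\<in>J. \<Sum>\<sigma>\<in>UNIV. b \<sigma> j * ?e j \<sigma>)))) \<in> Oh (1 + 3)"
    by (simp only: factor)
  then show "(\<lambda>h. h * (\<Sum>j\<in>J. \<Sum>\<sigma>\<in>UNIV. b \<sigma> j * F \<sigma> (g h j) i) - (h * (\<Sum>\<sigma>\<in>UNIV. F \<sigma> z0 i)
            + h\<^sup>2 / 2 * (\<Sum>\<sigma>\<in>UNIV. \<Sum>\<mu>\<in>UNIV. diff2 \<sigma> \<mu> i)
            + h ^ 3 / 6 * (\<Sum>\<sigma>\<in>UNIV. \<Sum>\<mu>\<in>UNIV. \<Sum>\<nu>\<in>UNIV. diff3_tall \<sigma> \<mu> \<nu> i + diff3_bushy \<sigma> \<mu> \<nu> i))) \<in> Oh 4"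
    unfolding swap1 swap2 swap3 by (simp add: algebra_simps power2_eq_square power3_eq_cube)
qed

end

section \<open>Existence and uniqueness of the stages\<close>

lemma common_bound:
  fixes f :: "'i \<Rightarrow> 'x \<Rightarrow> real"
  assumes "finite I" and r: "\<And>x. x \<in> X \<Longrightarrow> 0 \<le> r x"
    and "\<And>i. i \<in> I \<Longrightarrow> \<exists>C\<ge>0. \<forall>x\<in>X. f i x \<le> C * r x"
  shows "\<exists>C\<ge>0. \<forall>i\<in>I. \<forall>x\<in>X. f i x \<le> C * r x"
  using assms(1,3)
proof (induction I rule: finite_induct)
  case (insert i I)
  then obtain C C' where C: "0 \<le> C" "\<And>j x. j \<in> I \<Longrightarrow> x \<in> X \<Longrightarrow> f j x \<le> C * r x"
    and C': "0 \<le> C'" "\<And>x. x \<in> X \<Longrightarrow> f i x \<le> C' * r x"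
    by (metis insertCI)
  have "f j x \<le> (C + C') * r x" if "j \<in> insert i I" "x \<in> X" for j x
    using that C C' r[OF that(2)] by (auto simp: distrib_right intro: add_increasing add_increasing2)
  with C(1) C'(1) show ?case by (intro exI[of _ "C + C'"]) auto
qed auto

lemma lipschitz_on_cube:
  assumes "smooth D 1 F"
  shows "\<exists>L\<ge>0. \<forall>u\<in>cube D z B. \<forall>v\<in>cube D z B. \<bar>F u - F v\<bar> \<le> L * (\<Sum>l<D. \<bar>u l - v l\<bar>)"
proof -
  obtain P where P: "partials D F P" and cont: "\<And>l. l < D \<Longrightarrow> continuous_on UNIV (P l)"
    using assms by auto
  have "\<exists>C\<ge>0. \<forall>l\<in>{..<D}. \<forall>u\<in>cube D z B. \<bar>P l u\<bar> \<le> C * 1"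
    using bounded_on_cube[OF cont] by (intro common_bound) auto
  then obtain C where C: "0 \<le> C" "\<And>l u. l < D \<Longrightarrow> u \<in> cube D z B \<Longrightarrow> \<bar>P l u\<bar> \<le> C"
    by auto
  have "\<bar>F u - F v\<bar> \<le> C * (\<Sum>l<D. \<bar>u l - v l\<bar>)"
    if uv: "u \<in> cube D z B" "v \<in> cube D z B" for u v
  proof -
    obtain \<xi> where \<xi>: "\<And>l i. l < D \<Longrightarrow> \<xi> l i \<in> {min (v i) (u i)..max (v i) (u i)}"
      and eq: "F u - F v = (\<Sum>l<D. P l (\<xi> l) * (u l - v l))"
      using hybrid_mvt[OF P, of v u] uv unfolding cube_iff by metis
    have "\<xi> l \<in> cube D z B" if "l < D" for l
    proof -
      have bounds: "u i \<in> (if i < D then {z i - B..z i + B} else {z i})"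
        "v i \<in> (if i < D then {z i - B..z i + B} else {z i})" for i
        using uv unfolding cube_def by blast+
      have "\<xi> l i \<in> (if i < D then {z i - B..z i + B} else {z i})" for i
        using \<xi>[OF that, of i] bounds[of i] by (cases "i < D") (auto simp: min_def max_def split: if_splits)
      then show ?thesis unfolding cube_def by blast
    qed
    then have "\<bar>F u - F v\<bar> \<le> (\<Sum>l<D. C * \<bar>u l - v l\<bar>)"
      unfolding eq using C(2)
      by (intro order_trans[OF sum_abs] sum_mono) (auto simp: abs_mult intro!: mult_right_mono)
    then show ?thesis by (simp add: sum_distrib_left)
  qed
  with C(1) show ?thesis by blast
qed

text \<open>
For small \<open>h\<close> the right-hand side of the stage equations maps a box into itself and contracts the sum of
all coordinate distances. Instead of iterating the map, existence is obtained by minimising the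
residual over the compact box: applying the map to a minimiser would halve a positive residual.
\<close>

lemma stages_exist_unique:
  fixes F :: "'c::finite \<Rightarrow> rvec \<Rightarrow> rvec" and A :: "'c \<Rightarrow> nat \<Rightarrow> nat \<Rightarrow> real"
  assumes J: "finite J" and \<rho>: "0 < \<rho>"
    and F: "\<And>\<sigma> l. l < D \<Longrightarrow> smooth D 1 (\<lambda>z. F \<sigma> z l)"
  shows "\<forall>\<^sub>F h in at_right 0. (\<exists>g. stage_solution A F J D z \<rho> h g) \<and>
    (\<forall>g g'. stage_solution A F J D z \<rho> h g \<longrightarrow> stage_solution A F J D z \<rho> h g' \<longrightarrow> (\<forall>j\<in>J. g j = g' j))"
proof -
  define a where "a = (\<Sum>j\<in>J. \<Sum>k\<in>J. \<Sum>\<mu>\<in>UNIV. \<bar>A \<mu> j k\<bar>)"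
  have a0: "0 \<le> a" unfolding a_def by (intro sum_nonneg) auto
  have "\<exists>C\<ge>0. \<forall>i\<in>UNIV \<times> {..<D}. \<forall>u\<in>cube D z \<rho>. \<bar>F (fst i) u (snd i)\<bar> \<le> C * 1"
    using bounded_on_cube[OF smooth_imp_continuous[OF F]] by (intro common_bound) auto
  then obtain C where C0: "0 \<le> C" and C: "\<And>\<sigma> l u. l < D \<Longrightarrow> u \<in> cube D z \<rho> \<Longrightarrow> \<bar>F \<sigma> u l\<bar> \<le> C"
    by auto
  have "\<exists>L\<ge>0. \<forall>i\<in>UNIV \<times> {..<D}. \<forall>x\<in>cube D z \<rho> \<times> cube D z \<rho>.
      \<bar>F (fst i) (fst x) (snd i) - F (fst i) (snd x) (snd i)\<bar> \<le> L * (\<Sum>l<D. \<bar>fst x l - snd x l\<bar>)"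
  proof (intro common_bound)
    fix i :: "'c \<times> nat" assume "i \<in> UNIV \<times> {..<D}"
    then show "\<exists>L\<ge>0. \<forall>x\<in>cube D z \<rho> \<times> cube D z \<rho>.
      \<bar>F (fst i) (fst x) (snd i) - F (fst i) (snd x) (snd i)\<bar> \<le> L * (\<Sum>l<D. \<bar>fst x l - snd x l\<bar>)"
      using lipschitz_on_cube[OF F[of "snd i" "fst i"], of z \<rho>] by auto
  qed (auto intro: sum_nonneg)
  then obtain L where L0: "0 \<le> L" and L: "\<And>\<sigma> l u v. l < D \<Longrightarrow> u \<in> cube D z \<rho> \<Longrightarrow> v \<in> cube D z \<rho> \<Longrightarrow>
      \<bar>F \<sigma> u l - F \<sigma> v l\<bar> \<le> L * (\<Sum>l<D. \<bar>u l - v l\<bar>)"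
    by auto
  \<comment> \<open>The first bound keeps the box invariant, the second gives contraction by \<open>1/2\<close>; adding 1 avoids division by zero.\<close>
  define \<delta> where "\<delta> = min (\<rho> / (a * C + 1)) (1 / (2 * (real D * (a * L) + 1)))"
  have "0 < \<delta>" using \<rho> a0 C0 L0
    unfolding \<delta>_def by (auto intro!: divide_pos_pos add_nonneg_pos mult_nonneg_nonneg)
  then have "\<forall>\<^sub>F h in at_right 0. h \<in> {0<..<\<delta>}"
    by (rule eventually_at_right_real)
  then show ?thesis
  proof eventually_elim
    case (elim h)
    then have h: "0 < h" "h * (a * C) \<le> \<rho>" "h * (real D * (a * L)) \<le> 1/2"
    proof -
      have pos: "0 < a * C + 1" "0 < 2 * (real D * (a * L) + 1)"
        using a0 C0 L0 by (auto intro!: add_nonneg_pos mult_nonneg_nonneg)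
      have "h \<le> \<rho> / (a * C + 1)" "h \<le> 1 / (2 * (real D * (a * L) + 1))"
        using elim unfolding \<delta>_def by auto
      then have "h * (a * C + 1) \<le> \<rho>" "h * (2 * (real D * (a * L) + 1)) \<le> 1"
        using pos by (simp_all add: pos_le_divide_eq)
      moreover show "0 < h" using elim by simp
      ultimately show "h * (a * C) \<le> \<rho>" "h * (real D * (a * L)) \<le> 1/2"
        by (auto simp: algebra_simps)
    qed
    define \<Phi> where "\<Phi> = (\<lambda>g j l. if j \<in> J \<and> l < D
        then z l + h * (\<Sum>k\<in>J. \<Sum>\<mu>\<in>UNIV. A \<mu> j k * F \<mu> (g k) l) else z l)"
    define gap where "gap = (\<lambda>g g' :: nat \<Rightarrow> rvec. \<Sum>j\<in>J. \<Sum>l<D. \<bar>g j l - g' j l\<bar>)"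
    have row: "(\<Sum>k\<in>J. \<Sum>\<mu>\<in>UNIV. \<bar>A \<mu> j k\<bar>) \<le> a" if "j \<in> J" for j
      unfolding a_def using J that by (intro member_le_sum) (auto intro: sum_nonneg)
    have contraction: "gap (\<Phi> g) (\<Phi> g') \<le> gap g g' / 2"
      if g: "\<And>j. j \<in> J \<Longrightarrow> g j \<in> cube D z \<rho>" and g': "\<And>j. j \<in> J \<Longrightarrow> g' j \<in> cube D z \<rho>" for g g'
    proof -
      have gap0: "0 \<le> gap g g'" unfolding gap_def by (intro sum_nonneg) auto
      have part: "(\<Sum>l<D. \<bar>g k l - g' k l\<bar>) \<le> gap g g'" if "k \<in> J" for k
        unfolding gap_def using J that by (intro member_le_sum[where f = "\<lambda>k. \<Sum>l<D. \<bar>g k l - g' k l\<bar>"]) (auto intro: sum_nonneg)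
      have "\<bar>\<Phi> g j l - \<Phi> g' j l\<bar> \<le> h * ((\<Sum>k\<in>J. \<Sum>\<mu>\<in>UNIV. \<bar>A \<mu> j k\<bar>) * (L * gap g g'))"
        if "j \<in> J" "l < D" for j l
      proof -
        have "\<Phi> g j l - \<Phi> g' j l = h * ((\<Sum>k\<in>J. \<Sum>\<mu>\<in>UNIV. A \<mu> j k * F \<mu> (g k) l)
            - (\<Sum>k\<in>J. \<Sum>\<mu>\<in>UNIV. A \<mu> j k * F \<mu> (g' k) l))"
          using that by (simp add: \<Phi>_def right_diff_distrib)
        also have "\<dots> = h * (\<Sum>k\<in>J. \<Sum>\<mu>\<in>UNIV. A \<mu> j k * (F \<mu> (g k) l - F \<mu> (g' k) l))"
          by (simp add: right_diff_distrib[of "A _ _ _"] sum_subtractf)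
        finally have "\<bar>\<Phi> g j l - \<Phi> g' j l\<bar> = h * \<bar>\<Sum>k\<in>J. \<Sum>\<mu>\<in>UNIV. A \<mu> j k * (F \<mu> (g k) l - F \<mu> (g' k) l)\<bar>"
          using h(1) by (simp add: abs_mult)
        also have "\<dots> \<le> h * (\<Sum>k\<in>J. \<Sum>\<mu>\<in>UNIV. \<bar>A \<mu> j k\<bar> * \<bar>F \<mu> (g k) l - F \<mu> (g' k) l\<bar>)"
          using h(1) by (intro mult_left_mono order_trans[OF sum_abs] sum_mono) (auto simp: abs_mult)
        also have "\<dots> \<le> h * (\<Sum>k\<in>J. \<Sum>\<mu>\<in>UNIV. \<bar>A \<mu> j k\<bar> * (L * gap g g'))"
        proof (intro mult_left_mono sum_mono)
          fix k \<mu> assume k: "k \<in> J"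
          have "\<bar>F \<mu> (g k) l - F \<mu> (g' k) l\<bar> \<le> L * (\<Sum>l<D. \<bar>g k l - g' k l\<bar>)"
            using L that(2) g g' k by blast
          also have "\<dots> \<le> L * gap g g'" using part[OF k] L0 by (rule mult_left_mono)
          finally show "\<bar>F \<mu> (g k) l - F \<mu> (g' k) l\<bar> \<le> L * gap g g'" .
        qed (use h(1) in auto)
        finally show ?thesis by (simp add: sum_distrib_right)
      qed
      then have "(\<Sum>j\<in>J. \<Sum>l<D. \<bar>\<Phi> g j l - \<Phi> g' j l\<bar>) \<le> (\<Sum>j\<in>J. \<Sum>l<D. h * ((\<Sum>k\<in>J. \<Sum>\<mu>\<in>UNIV. \<bar>A \<mu> j k\<bar>) * (L * gap g g')))"
        by (intro sum_mono) auto
      also have "\<dots> = (h * (real D * (a * L))) * gap g g'"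
        by (simp add: a_def sum_distrib_left sum_distrib_right mult_ac)
      also have "\<dots> \<le> 1/2 * gap g g'"
        using h(3) gap0 by (rule mult_right_mono)
      finally show ?thesis by (simp add: gap_def)
    qed
    have into: "\<Phi> g j \<in> cube D z \<rho>" if g: "\<And>j. j \<in> J \<Longrightarrow> g j \<in> cube D z \<rho>" for g j
    proof -
      have "\<bar>\<Phi> g j l - z l\<bar> \<le> \<rho>" if l: "l < D" for l
      proof (cases "j \<in> J")
        case True
        have "\<bar>\<Phi> g j l - z l\<bar> \<le> h * \<bar>\<Sum>k\<in>J. \<Sum>\<mu>\<in>UNIV. A \<mu> j k * F \<mu> (g k) l\<bar>"
          using True l h(1) by (simp add: \<Phi>_def abs_mult)
        also have "\<dots> \<le> h * (\<Sum>k\<in>J. \<Sum>\<mu>\<in>UNIV. \<bar>A \<mu> j k\<bar> * \<bar>F \<mu> (g k) l\<bar>)"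
          using h(1) by (intro mult_left_mono order_trans[OF sum_abs] sum_mono) (auto simp: abs_mult)
        also have "\<dots> \<le> h * (\<Sum>k\<in>J. \<Sum>\<mu>\<in>UNIV. \<bar>A \<mu> j k\<bar> * C)"
          using h(1) C l g by (intro mult_left_mono sum_mono) auto
        also have "\<dots> = h * ((\<Sum>k\<in>J. \<Sum>\<mu>\<in>UNIV. \<bar>A \<mu> j k\<bar>) * C)"
          by (simp add: sum_distrib_right)
        also have "\<dots> \<le> h * (a * C)"
          using row[OF True] C0 h(1) by (intro mult_left_mono mult_right_mono) auto
        finally show ?thesis using h(2) by simp
      qed (use \<rho> in \<open>simp add: \<Phi>_def\<close>)
      then show ?thesis by (auto simp: cube_iff \<Phi>_def)
    qed
    have gap_eqD: "g j l = g' j l" if "gap g g' \<le> 0" "j \<in> J" "l < D" for g g' j l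
    proof -
      have "\<bar>g j l - g' j l\<bar> \<le> (\<Sum>l<D. \<bar>g j l - g' j l\<bar>)"
        using that by (intro member_le_sum) auto
      also have "\<dots> \<le> gap g g'"
        unfolding gap_def using J that by (intro member_le_sum[where f = "\<lambda>k. \<Sum>l<D. \<bar>g k l - g' k l\<bar>"]) (auto intro: sum_nonneg)
      finally show ?thesis using that(1) by simp
    qed

    \<comment> \<open>The components with index outside \<open>J\<close> are confined as well, since compactness concerns all of them.\<close>
    define box where "box = {g :: nat \<Rightarrow> rvec. \<forall>j. g j \<in> cube D z \<rho>}"
    have box: "compact box"
      unfolding box_def by (intro compact_all_coords compact_cube)
    have nonempty: "(\<lambda>_. z) \<in> box"
      using \<rho> by (simp add: box_def cube_iff)
    have cont: "continuous_on box (\<lambda>g. gap (\<Phi> g) g)"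
    proof (rule continuous_on_subset)
      have coord: "continuous_on UNIV (\<lambda>g :: nat \<Rightarrow> rvec. g j l)" for j l
        by (rule continuous_on_product_then_coordinatewise) simp
      have "continuous_on UNIV (\<lambda>g :: nat \<Rightarrow> rvec. F \<mu> (g k) l)" if "l < D" for k l \<mu>
        by (rule continuous_on_compose2[OF smooth_imp_continuous[OF F[OF that]] continuous_on_product_coordinates]) simp
      then have "continuous_on UNIV (\<lambda>g. \<Phi> g j l)" if "j \<in> J" "l < D" for j l
        unfolding \<Phi>_def using that by (simp, intro continuous_intros) auto
      then show "continuous_on UNIV (\<lambda>g. gap (\<Phi> g) g)"
        unfolding gap_def using coord by (intro continuous_intros) auto
    qed simp
    obtain g where g: "g \<in> box" and least: "\<And>g'. g' \<in> box \<Longrightarrow> gap (\<Phi> g) g \<le> gap (\<Phi> g') g'"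
      using continuous_attains_inf[OF box _ cont] nonempty by auto
    have "gap (\<Phi> g) g \<le> gap (\<Phi> (\<Phi> g)) (\<Phi> g)"
      using g into by (intro least) (auto simp: box_def)
    also have "\<dots> \<le> gap (\<Phi> g) g / 2"
      using g into by (intro contraction) (auto simp: box_def)
    finally have "gap (\<Phi> g) g \<le> 0" by simp
    from gap_eqD[OF this] have "stage_solution A F J D z \<rho> h g"
      using g unfolding stage_solution_def by (auto simp: box_def \<Phi>_def)
    moreover have "g j = g' j" if g: "stage_solution A F J D z \<rho> h g" and g': "stage_solution A F J D z \<rho> h g'" and j: "j \<in> J" for g g' j
    proof -
      have "gap (\<Phi> g) (\<Phi> g') \<le> gap g g' / 2"
        using g g' by (intro contraction) (auto simp: stage_solution_def)
      moreover have "gap (\<Phi> g) (\<Phi> g') = gap g g'"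
        unfolding gap_def using g g' by (intro sum.cong refl) (auto simp: stage_solution_def \<Phi>_def)
      ultimately have "gap g g' \<le> 0" by simp
      note inside = gap_eqD[OF this j]
      have outside: "g j l = z l" "g' j l = z l" if "l \<ge> D" for l
        using g g' j that by (simp_all add: stage_solution_def cube_iff)
      show ?thesis
      proof
        fix l show "g j l = g' j l" using inside outside by (cases "l < D") simp_all
      qed
    qed
    ultimately show ?case by blast
  qed
qed

section \<open>Non-autonomous problems as autonomous ones with two clocks\<close>

text \<open>
Projection onto the first \<open>d\<close> coordinates. Composing with it extends a function on \<open>R^d\<close> to all
sequences.
\<close>

definition trunc :: "nat \<Rightarrow> rvec \<Rightarrow> rvec" where
  "trunc d z = (\<lambda>i. if i < d then z i else 0)"

lemma trunc_in_Rn: "trunc d z \<in> Rn d"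
  by (simp add: trunc_def topspace_Euclidean_space)

lemma smooth_const: "smooth D k (\<lambda>_. c)"
proof (induction k arbitrary: c)
  case (Suc k)
  have "partials D (\<lambda>_. c) (\<lambda>_ _. 0)" by (simp add: partials_def)
  with Suc[of 0] show ?case by (auto intro!: exI[of _ "\<lambda>_ _. 0"])
qed simp

text \<open>
The coordinate \<open>m\<close> serves as the time variable: differentiation in it is the time derivative of \<open>f\<close>,
differentiation in a coordinate below \<open>d\<close> a space derivative, and the other derivatives vanish.
\<close>

lemma smooth_autonomize:
  assumes "Ck d k f" "d \<le> m" "m < D"
  shows "smooth D k (\<lambda>z. f (trunc d z) (z m))"
  using assms(1)
proof (induction k arbitrary: f)
  have coord: "continuous_map euclidean euclideanreal (\<lambda>z::rvec. z i)" for i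
    using continuous_on_product_coordinates by (simp add: continuous_map_iff_continuous2)
  have "continuous_map euclidean (Euclidean_space d) (trunc d)"
    unfolding trunc_def continuous_map_componentwise_Euclidean_space using coord by simp
  then have emb: "continuous_map euclidean (prod_topology (Euclidean_space d) euclideanreal) (\<lambda>z. (trunc d z, z m))"
    using coord by (intro continuous_map_pairedI)
  have cont: "continuous_on UNIV (\<lambda>z. f (trunc d z) (z m))"
    if "continuous_map (prod_topology (Euclidean_space d) euclideanreal) euclideanreal (\<lambda>(x, t). f x t)" for f
    using continuous_map_compose[OF emb that] by (simp add: o_def continuous_map_iff_continuous2)
  {
    case 0
    then show ?case using cont by simp
  next
    case (Suc k)
    from Suc.prems obtain fx where fx: "\<And>i. i < d \<Longrightarrow> Ck d k (fx i)"
      "\<And>i x t. i < d \<Longrightarrow> x \<in> Rn d \<Longrightarrow> ((\<lambda>u. f (x(i := u)) t) has_real_derivative fx i x t) (at (x i))"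
      by (auto simp del: Ck.simps(1)) metis
    from Suc.prems obtain ft where ft: "Ck d k ft"
      "\<And>x t. x \<in> Rn d \<Longrightarrow> ((\<lambda>u. f x u) has_real_derivative ft x t) (at t)"
      by auto
    define P where "P = (\<lambda>l z. if l < d then fx l (trunc d z) (z m) else if l = m then ft (trunc d z) (z m) else 0)"
    have "((\<lambda>u. f (trunc d (z(l := u))) ((z(l := u)) m)) has_real_derivative P l z) (at (z l))" for l z
    proof -
      have upd: "trunc d (z(l := u)) = (if l < d then (trunc d z)(l := u) else trunc d z)" for u
        by (auto simp: trunc_def fun_eq_iff)
      consider "l < d" | "l = m" | "d \<le> l" "l \<noteq> m" by linarith
      then show ?thesis
      proof cases
        case 1
        then show ?thesis
          using fx(2)[OF 1 trunc_in_Rn, of z "z m"] assms(2) by (simp add: upd P_def) (simp add: trunc_def)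
      next
        case 2
        then have "trunc d (z(l := u)) = trunc d z" for u
          using assms(2) by (auto simp: trunc_def fun_eq_iff)
        then show ?thesis
          using ft(2)[OF trunc_in_Rn, of z "z m"] assms(2) 2 by (simp add: P_def)
      qed (simp add: upd P_def)
    qed
    then have "partials D (\<lambda>z. f (trunc d z) (z m)) P"
      by (simp add: partials_def)
    moreover have "smooth D k (P l)" if "l < D" for l
      using Suc.IH[OF fx(1)] Suc.IH[OF ft(1)] smooth_const
      by (cases "l < d"; cases "l = m") (simp_all add: P_def)
    ultimately show ?case using cont Suc.prems by auto
  }
qed

text \<open>
The two parts of the field are evaluated at different times within a stage, so each needs a clock of its
own. The clocks are the coordinates \<open>d\<close> and \<open>d + 1\<close>.
\<close>

definition clock :: "nat \<Rightarrow> bool \<Rightarrow> nat" where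
  "clock d \<sigma> = (if \<sigma> then d else Suc d)"

definition autonomous :: "nat \<Rightarrow> vfield \<Rightarrow> vfield \<Rightarrow> bool \<Rightarrow> rvec \<Rightarrow> rvec" where
  "autonomous d n s \<sigma> z i =
     (if i < d then (if \<sigma> then n else s) (trunc d z) (z (clock d \<sigma>)) i else if i = clock d \<sigma> then 1 else 0)"

definition with_clocks :: "nat \<Rightarrow> rvec \<Rightarrow> (bool \<Rightarrow> real) \<Rightarrow> rvec" where
  "with_clocks d x \<tau> i = (if i < d then x i else if i = d then \<tau> True else if i = Suc d then \<tau> False else 0)"

lemma trunc_with_clocks: "x \<in> Rn d \<Longrightarrow> trunc d (with_clocks d x \<tau>) = x"
  by (auto simp: trunc_def with_clocks_def topspace_Euclidean_space fun_eq_iff)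

lemma clock_with_clocks: "with_clocks d x \<tau> (clock d \<sigma>) = \<tau> \<sigma>"
  by (simp add: with_clocks_def clock_def)

lemma autonomous_at:
  assumes "x \<in> Rn d"
  shows "autonomous d n s \<sigma> (with_clocks d x \<tau>) i =
    (if i < d then (if \<sigma> then n x (\<tau> True) i else s x (\<tau> False) i) else if i = clock d \<sigma> then 1 else 0)"
  using assms by (auto simp: autonomous_def trunc_with_clocks clock_with_clocks)

lemma smooth_autonomous:
  assumes "Ck_field d k n" "Ck_field d k s"
  shows "smooth (d + 2) k (\<lambda>z. autonomous d n s \<sigma> z i)"
proof (cases "i < d")
  case True
  then have "Ck d k (\<lambda>x t. (if \<sigma> then n else s) x t i)"
    using assms by (simp add: Ck_field_def)
  from smooth_autonomize[OF this, of "clock d \<sigma>" "d + 2"] True show ?thesis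
    by (simp add: autonomous_def clock_def)
qed (simp add: autonomous_def smooth_const)

text \<open>
Only the strictly lower triangular part of the explicit matrix and the lower triangular part of the
implicit one enter the stage equations; the tableau sets the other entries to zero, so that sums may
range over all stages.
\<close>

definition tableau :: "imex \<Rightarrow> bool \<Rightarrow> nat \<Rightarrow> nat \<Rightarrow> real" where
  "tableau M \<sigma> j k =
     (if \<sigma> then (if k < j then Aex M j k else 0) else (if k \<le> j then Aim M j k else 0))"

definition weights :: "imex \<Rightarrow> bool \<Rightarrow> nat \<Rightarrow> real" where
  "weights M \<sigma> = (if \<sigma> then bex M else bim M)"

definition nodes :: "imex \<Rightarrow> bool \<Rightarrow> nat \<Rightarrow> real" where
  "nodes M \<sigma> = (if \<sigma> then cex M else cim M)"

definition row_sum_nodes :: "imex \<Rightarrow> bool" where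
  "row_sum_nodes M \<longleftrightarrow>
     (\<forall>\<sigma>. \<forall>j\<in>{1..stages M}. nodes M \<sigma> j = (\<Sum>k\<in>{1..stages M}. tableau M \<sigma> j k))"

lemma row_sum_nodesD:
  "row_sum_nodes M \<Longrightarrow> j \<in> {1..stages M} \<Longrightarrow> (\<Sum>k\<in>{1..stages M}. tableau M \<sigma> j k) = nodes M \<sigma> j"
  by (simp add: row_sum_nodes_def)

lemma tableau_row:
  assumes "j \<in> {1..r}"
  shows "(\<Sum>k\<in>{1..r}. tableau M True j k * a k + tableau M False j k * b k)
       = (\<Sum>k\<in>{1..<j}. Aex M j k * a k + Aim M j k * b k) + Aim M j j * b j"
proof -
  have "(\<Sum>k\<in>{1..r}. tableau M True j k * a k + tableau M False j k * b k)
      = (\<Sum>k\<in>{1..j}. tableau M True j k * a k + tableau M False j k * b k)"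
    using assms by (intro sum.mono_neutral_right) (auto simp: tableau_def)
  also have "{1..j} = insert j {1..<j}" using assms by auto
  also have "(\<Sum>k\<in>insert j {1..<j}. tableau M True j k * a k + tableau M False j k * b k)
      = Aim M j j * b j + (\<Sum>k\<in>{1..<j}. tableau M True j k * a k + tableau M False j k * b k)"
    by (simp add: tableau_def)
  also have "(\<Sum>k\<in>{1..<j}. tableau M True j k * a k + tableau M False j k * b k)
      = (\<Sum>k\<in>{1..<j}. Aex M j k * a k + Aim M j k * b k)"
    by (intro sum.cong) (auto simp: tableau_def)
  finally show ?thesis by simp
qed

lemma sum_colours: "(\<Sum>\<sigma>\<in>(UNIV::bool set). f \<sigma>) = f True + f False" for f :: "bool \<Rightarrow> real"
  by (simp add: UNIV_bool add.commute)

lemma stage_eqs_iff: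
  "stage_eqs M d n s t x h g \<longleftrightarrow> (\<forall>j\<in>{1..stages M}. g j \<in> Rn d \<and> (\<forall>i<d. g j i = x i +
     h * (\<Sum>k\<in>{1..stages M}. tableau M True j k * n (g k) (t + nodes M True k * h) i
                          + tableau M False j k * s (g k) (t + nodes M False k * h) i)))"
  unfolding stage_eqs_def by (intro ball_cong refl)
    (simp only: tableau_row, simp add: nodes_def distrib_left algebra_simps)

text \<open>
The row sum condition makes the clock coordinates obey the stage equations as well.
\<close>

lemma lifted_stages:
  assumes "row_sum_nodes M" "x \<in> Rn d"
    and eqs: "stage_eqs M d n s t x h g" and j: "j \<in> {1..stages M}" and l: "l < d + 2"
  defines "gl \<equiv> \<lambda>j. with_clocks d (g j) (\<lambda>\<sigma>. t + nodes M \<sigma> j * h)"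
  shows "gl j l = with_clocks d x (\<lambda>_. t) l
    + h * (\<Sum>k\<in>{1..stages M}. \<Sum>\<sigma>\<in>UNIV. tableau M \<sigma> j k * autonomous d n s \<sigma> (gl k) l)"
proof -
  have Rn: "g k \<in> Rn d" if "k \<in> {1..stages M}" for k
    using eqs that by (simp add: stage_eqs_iff)
  consider "l < d" | "l = d" | "l = Suc d" using l by linarith
  then show ?thesis
  proof cases
    case 1
    then show ?thesis
      using eqs j Rn by (simp add: gl_def autonomous_at sum_colours stage_eqs_iff with_clocks_def)
  next
    case 2
    then show ?thesis
      using row_sum_nodesD[OF assms(1) j, of True] Rn
      by (simp add: gl_def autonomous_at sum_colours clock_def with_clocks_def)
  next
    case 3
    then show ?thesis
      using row_sum_nodesD[OF assms(1) j, of False] Rn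
      by (simp add: gl_def autonomous_at sum_colours clock_def with_clocks_def)
  qed
qed

text \<open>
Conversely, the clock coordinates of a solution of the autonomous stage equations are forced: their
slopes are constant, so they show the times at which the original method evaluates the field.
\<close>

lemma projected_stages:
  assumes rows: "row_sum_nodes M"
    and sol: "stage_solution (tableau M) (autonomous d n s) {1..stages M} (d + 2)
                (with_clocks d x (\<lambda>_. t)) \<rho> h g"
  shows "j \<in> {1..stages M} \<Longrightarrow> g j = with_clocks d (trunc d (g j)) (\<lambda>\<sigma>. t + nodes M \<sigma> j * h)"
    and "stage_eqs M d n s t x h (\<lambda>j. trunc d (g j))"
proof -
  show clocks: "g j = with_clocks d (trunc d (g j)) (\<lambda>\<sigma>. t + nodes M \<sigma> j * h)"
    if j: "j \<in> {1..stages M}" for j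
  proof
    fix l
    consider "l < d" | "l = d" | "l = Suc d" | "d + 2 \<le> l" by linarith
    then show "g j l = with_clocks d (trunc d (g j)) (\<lambda>\<sigma>. t + nodes M \<sigma> j * h) l"
    proof cases
      case 1
      then show ?thesis by (simp add: with_clocks_def trunc_def)
    next
      case 2
      have "g j d = t + h * (\<Sum>k\<in>{1..stages M}. tableau M True j k)"
        using sol j by (simp add: stage_solution_def autonomous_def sum_colours clock_def with_clocks_def)
      then show ?thesis
        using row_sum_nodesD[OF rows j, of True] 2 by (simp add: with_clocks_def)
    next
      case 3
      have "g j (Suc d) = t + h * (\<Sum>k\<in>{1..stages M}. tableau M False j k)"
        using sol j by (simp add: stage_solution_def autonomous_def sum_colours clock_def with_clocks_def)
      then show ?thesis
        using row_sum_nodesD[OF rows j, of False] 3 by (simp add: with_clocks_def)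
    next
      case 4
      then show ?thesis
        using sol j by (simp add: stage_solution_def cube_iff with_clocks_def)
    qed
  qed
  have slope: "autonomous d n s \<sigma> (g k) i = (if \<sigma> then n (trunc d (g k)) (t + nodes M True k * h) i
      else s (trunc d (g k)) (t + nodes M False k * h) i)" if "k \<in> {1..stages M}" "i < d" for k i \<sigma>
    by (subst clocks[OF that(1)]) (simp add: autonomous_at trunc_in_Rn that(2))
  show "stage_eqs M d n s t x h (\<lambda>j. trunc d (g j))"
    unfolding stage_eqs_iff
  proof (intro ballI conjI allI impI)
    fix j i assume j: "j \<in> {1..stages M}" and i: "i < d"
    have "g j i = with_clocks d x (\<lambda>_. t) i
        + h * (\<Sum>k\<in>{1..stages M}. \<Sum>\<sigma>\<in>UNIV. tableau M \<sigma> j k * autonomous d n s \<sigma> (g k) i)"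
      using sol j i by (simp add: stage_solution_def)
    then show "trunc d (g j) i = x i +
     h * (\<Sum>k\<in>{1..stages M}. tableau M True j k * n (trunc d (g k)) (t + nodes M True k * h) i
                          + tableau M False j k * s (trunc d (g k)) (t + nodes M False k * h) i)"
      using i by (simp add: slope sum_colours with_clocks_def trunc_def)
  qed (rule trunc_in_Rn)
qed

section \<open>Sufficiency of the order conditions\<close>

text \<open>
One equation for every tree with at most two, respectively three, nodes and every colouring of its nodes.
\<close>

definition order2_conditions :: "imex \<Rightarrow> bool" where
  "order2_conditions M \<longleftrightarrow> (\<forall>\<sigma>. (\<Sum>j\<in>{1..stages M}. weights M \<sigma> j) = 1) \<and>
     (\<forall>\<sigma> \<mu>. (\<Sum>j\<in>{1..stages M}. weights M \<sigma> j * nodes M \<mu> j) = 1/2)"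

definition order3_conditions :: "imex \<Rightarrow> bool" where
  "order3_conditions M \<longleftrightarrow> order2_conditions M \<and>
     (\<forall>\<sigma> \<mu> \<nu>. (\<Sum>j\<in>{1..stages M}. weights M \<sigma> j * (\<Sum>k\<in>{1..stages M}. tableau M \<mu> j k * nodes M \<nu> k)) = 1/6) \<and>
     (\<forall>\<sigma> \<mu> \<nu>. (\<Sum>j\<in>{1..stages M}. weights M \<sigma> j * (nodes M \<mu> j * nodes M \<nu> j)) = 1/3)"

lemma stages_nearI:
  assumes "\<And>j i. j \<in> {1..stages M} \<Longrightarrow> i < d \<Longrightarrow> \<bar>g j i - x i\<bar> \<le> 1 / (real d + 1)"
  shows "stages_near M d x 1 g"
  unfolding stages_near_def
proof
  fix j assume j: "j \<in> {1..stages M}"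
  have "L2_set (\<lambda>i. g j i - x i) {..<d} \<le> (\<Sum>i<d. \<bar>g j i - x i\<bar>)" by (rule L2_set_le_sum_abs)
  also have "\<dots> \<le> (\<Sum>i<d. 1 / (real d + 1))" using assms j by (intro sum_mono) auto
  also have "\<dots> < 1" by (simp add: field_simps)
  finally show "L2_set (\<lambda>i. g j i - x i) {..<d} < 1" .
qed

lemma stages_nearD:
  assumes "stages_near M d x \<rho> g" "j \<in> {1..stages M}" "i < d"
  shows "\<bar>g j i - x i\<bar> < \<rho>"
proof -
  have "\<bar>g j i - x i\<bar> \<le> L2_set (\<lambda>i. \<bar>g j i - x i\<bar>) {..<d}"
    using assms(3) by (intro member_le_L2_set) auto
  also have "\<dots> = L2_set (\<lambda>i. g j i - x i) {..<d}" by (simp add: L2_set_def)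
  also have "\<dots> < \<rho>" using assms by (simp add: stages_near_def)
  finally show ?thesis .
qed

lemma Oh_L2_set:
  assumes "\<And>i. i < d \<Longrightarrow> (\<lambda>h. e h i) \<in> Oh k"
  shows "(\<lambda>h. L2_set (e h) {..<d}) \<in> Oh k"
proof -
  have "(\<lambda>h. \<Sum>i<d. \<bar>e h i\<bar>) \<in> Oh k"
    using assms by (intro Oh_sum) auto
  moreover have "(\<lambda>h. L2_set (e h) {..<d}) \<in> O[at_right 0](\<lambda>h. \<Sum>i<d. \<bar>e h i\<bar>)"
    by (intro landau_o.big_mono always_eventually allI)
       (simp add: L2_set_le_sum_abs L2_set_nonneg abs_of_nonneg sum_nonneg)
  ultimately show ?thesis by (rule landau_o.big_trans[rotated])
qed

lemma smooth_jet:
  assumes "\<And>\<sigma> i. i < D \<Longrightarrow> smooth D 3 (\<lambda>z. F \<sigma> z i)"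
  shows "\<exists>P H. coloured_jet D F P H"
proof -
  have "\<exists>P H. partials D (\<lambda>z. F \<sigma> z i) P \<and> (\<forall>l<D. partials D (P l) (H l))" if "i < D" for \<sigma> i
  proof -
    have "smooth D (Suc (Suc 1)) (\<lambda>z. F \<sigma> z i)"
      using assms[OF that] by (simp add: numeral_3_eq_3)
    then obtain P where P: "partials D (\<lambda>z. F \<sigma> z i) P" "\<And>l. l < D \<Longrightarrow> smooth D (Suc 1) (P l)"
      by auto
    then have "\<exists>H. partials D (P l) H" if "l < D" for l using that by force
    then show ?thesis using P(1) by metis
  qed
  then have "\<forall>\<sigma> i. \<exists>PH. i < D \<longrightarrow> partials D (\<lambda>z. F \<sigma> z i) (fst PH) \<and> (\<forall>l<D. partials D (fst PH l) (snd PH l))"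
    by simp
  then obtain PH where "\<forall>\<sigma> i. i < D \<longrightarrow> partials D (\<lambda>z. F \<sigma> z i) (fst (PH \<sigma> i))
      \<and> (\<forall>l<D. partials D (fst (PH \<sigma> i) l) (snd (PH \<sigma> i) l))"
    unfolding choice_iff by blast
  then have "coloured_jet D F (\<lambda>\<sigma> i. fst (PH \<sigma> i)) (\<lambda>\<sigma> i. snd (PH \<sigma> i))"
    using assms by unfold_locales auto
  then show ?thesis by blast
qed

text \<open>
After passing to the autonomous problem, the numerical and the exact expansion have the same
polynomial part, so the error is the difference of the two remainders.
\<close>

lemma order_conditions_sufficient:
  assumes rows: "row_sum_nodes M"
    and p: "p = 2 \<and> order2_conditions M \<or> p = 3 \<and> order3_conditions M"
  shows "order_accurate M p"
  unfolding order_accurate_def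
\<comment> \<open>An error of order \<open>h ^ 4\<close> involves third derivatives of the field; the same smoothness serves \<open>p = 2\<close>.\<close>
proof (rule exI[of _ 3], intro allI impI)
  fix d :: nat and n s :: vfield and t0 T :: real and x0 :: rvec and x :: "real \<Rightarrow> rvec"
  assume "1 \<le> d" and n: "Ck_field d 3 n" and s: "Ck_field d 3 s"
    and T: "0 < T" and ivp: "solves_ivp d n s t0 x0 T x"
  define D where "D = d + 2"
  define F where "F = autonomous d n s"
  define J where "J = {1..stages M}"
  define A where "A = tableau M"
  define b where "b = weights M"
  define z0 where "z0 = with_clocks d x0 (\<lambda>_. t0)"
  define y where "y = (\<lambda>h. with_clocks d (x (t0 + h)) (\<lambda>_. t0 + h))"
  have finJ: "finite J" by (simp add: J_def)
  have smooth_F: "smooth D 3 (\<lambda>z. F \<sigma> z i)" for \<sigma> i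
    unfolding D_def F_def using n s by (rule smooth_autonomous)
  have x0: "x0 \<in> Rn d" and x_Rn: "\<And>t. t \<in> {t0..t0 + T} \<Longrightarrow> x t \<in> Rn d" and x_t0: "x t0 = x0"
    using ivp T by (auto simp: solves_ivp_def)
  obtain P H where "coloured_jet D F P H"
    using smooth_jet[of D F] smooth_F by blast
  then interpret coloured_jet D F z0 P H .
  have c: "(\<Sum>k\<in>J. A \<mu> j k) = nodes M \<mu> j" if "j \<in> J" for \<mu> j
    unfolding J_def A_def by (rule row_sum_nodesD[OF rows that[unfolded J_def]])

  \<comment> \<open>Existence is used in a box small enough to lie in the open Euclidean unit ball, uniqueness in a box of half-width 1 that contains this ball.\<close>
  define \<rho> where "\<rho> = 1 / (real d + 1)"
  have \<rho>: "0 < \<rho>" "\<rho> \<le> 1" by (auto simp: \<rho>_def)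
  define sol where "sol = (\<lambda>\<rho> h g. stage_solution A F J D z0 \<rho> h g)"
  have solvable: "\<forall>\<^sub>F h in at_right 0. (\<exists>g. sol r h g) \<and> (\<forall>g g'. sol r h g \<longrightarrow> sol r h g' \<longrightarrow> (\<forall>j\<in>J. g j = g' j))"
    if "0 < r" for r
    unfolding sol_def by (intro stages_exist_unique finJ that smooth_mono[OF smooth_F]) auto
  define g where "g = (\<lambda>h. SOME g. sol \<rho> h g)"
  have g: "\<forall>\<^sub>F h in at_right 0. sol \<rho> h (g h)"
    using solvable[OF \<rho>(1)] by eventually_elim (metis g_def someI_ex)
  define G where "G = (\<lambda>h j. trunc d (g h j))"

  have unique: "\<forall>\<^sub>F h in at_right 0. stage_eqs M d n s t0 x0 h (G h) \<and> stages_near M d x0 1 (G h) \<and>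
      (\<forall>g'. stage_eqs M d n s t0 x0 h g' \<and> stages_near M d x0 1 g' \<longrightarrow> (\<forall>j\<in>{1..stages M}. g' j = G h j))"
    using g solvable[OF zero_less_one]
  proof eventually_elim
    case (elim h)
    then have g_sol: "stage_solution A F J D z0 \<rho> h (g h)" by (simp add: sol_def)
    note proj = projected_stages[OF rows g_sol[unfolded A_def F_def J_def D_def z0_def]]
    have near: "\<bar>g h j l - z0 l\<bar> \<le> \<rho>" if "j \<in> J" "l < D" for j l
    proof -
      have "g h j \<in> cube D z0 \<rho>" using g_sol that(1) unfolding stage_solution_def by blast
      then show ?thesis using that(2) by (simp add: cube_iff)
    qed
    have "stages_near M d x0 1 (G h)"
    proof (rule stages_nearI)
      fix j i assume "j \<in> {1..stages M}" "i < d"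
      then show "\<bar>G h j i - x0 i\<bar> \<le> 1 / (real d + 1)"
        using near[of j i] by (simp add: G_def trunc_def z0_def with_clocks_def J_def D_def \<rho>_def)
    qed
    moreover have "g' j = G h j"
      if eqs: "stage_eqs M d n s t0 x0 h g'" and near': "stages_near M d x0 1 g'" and j: "j \<in> {1..stages M}" for g' j
    proof -
      define gl where "gl = (\<lambda>j. with_clocks d (g' j) (\<lambda>\<sigma>. t0 + nodes M \<sigma> j * h))"
      have "gl k \<in> cube D z0 1" if k: "k \<in> J" for k
      proof -
        have "\<bar>gl k l - z0 l\<bar> \<le> 1" if "l < D" for l
        proof (cases "l < d")
          case True
          then show ?thesis
            using stages_nearD[OF near' k[unfolded J_def], of l] by (simp add: gl_def z0_def with_clocks_def)
        next
          case False
          then have "gl k l = g h k l"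
            using proj(1)[OF k[unfolded J_def]] by (auto simp: gl_def with_clocks_def fun_eq_iff)
          then show ?thesis using near[OF k that] \<rho>(2) by simp
        qed
        then show ?thesis by (auto simp: cube_iff gl_def z0_def with_clocks_def D_def)
      qed
      moreover have "gl k l = z0 l + h * (\<Sum>j\<in>J. \<Sum>\<mu>\<in>UNIV. A \<mu> k j * F \<mu> (gl j) l)" if "k \<in> J" "l < D" for k l
        using lifted_stages[OF rows x0 eqs] that
        unfolding gl_def z0_def J_def A_def F_def D_def by blast
      ultimately have "sol 1 h gl" by (simp add: sol_def stage_solution_def)
      moreover have "sol 1 h (g h)"
        using g_sol cube_mono[OF \<rho>(2)] unfolding sol_def stage_solution_def by blast
      moreover have "j \<in> J" using j by (simp add: J_def)
      ultimately have "gl j = g h j" using elim(2) by blast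
      then have "trunc d (gl j) = G h j" by (simp add: G_def)
      then show ?thesis
        using eqs j by (simp add: gl_def trunc_with_clocks stage_eqs_def)
    qed
    moreover have "stage_eqs M d n s t0 x0 h (G h)"
      using proj(2) by (simp add: G_def)
    ultimately show ?case by blast
  qed

  have y0: "y 0 = z0" by (simp add: y_def z0_def x_t0)
  have y_der: "((\<lambda>u. y u l) has_real_derivative (\<Sum>\<sigma>\<in>UNIV. F \<sigma> (y \<tau>) l)) (at \<tau> within {0..T})"
    if \<tau>: "\<tau> \<in> {0..T}" and l: "l < D" for \<tau> l
  proof -
    have in_Rn: "x (t0 + \<tau>) \<in> Rn d" using \<tau> by (intro x_Rn) auto
    consider "l < d" | "l = d" | "l = Suc d" using l unfolding D_def by linarith
    then show ?thesis
    proof cases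
      case 1
      have shift: "(\<lambda>\<tau>. t0 + \<tau>) ` {0..T} = {t0..t0 + T}"
        by (simp add: image_add_atLeastAtMost add.commute)
      have "((\<lambda>u. x u l) has_real_derivative n (x (t0 + \<tau>)) (t0 + \<tau>) l + s (x (t0 + \<tau>)) (t0 + \<tau>) l)
          (at (t0 + \<tau>) within (\<lambda>\<tau>. t0 + \<tau>) ` {0..T})"
        unfolding shift using ivp 1 \<tau> by (simp add: solves_ivp_def)
      moreover have "((\<lambda>\<tau>. t0 + \<tau>) has_real_derivative 1) (at \<tau> within {0..T})"
        by (auto intro!: derivative_eq_intros)
      ultimately have "((\<lambda>u. x (t0 + u) l) has_real_derivative
          n (x (t0 + \<tau>)) (t0 + \<tau>) l + s (x (t0 + \<tau>)) (t0 + \<tau>) l) (at \<tau> within {0..T})"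
        using DERIV_image_chain by (fastforce simp: o_def)
      then show ?thesis
        using 1 in_Rn
        by (simp add: y_def F_def autonomous_at sum_colours with_clocks_def)
    qed (use in_Rn in \<open>auto simp: y_def F_def autonomous_at sum_colours with_clocks_def clock_def
           intro!: derivative_eq_intros\<close>)
  qed
  have y_off: "y \<tau> l = z0 l" if "D \<le> l" for \<tau> l
    using that by (simp add: y_def z0_def with_clocks_def D_def)
  have exact2: "(\<lambda>h. y h i - z0 i - (h * (\<Sum>\<sigma>\<in>UNIV. F \<sigma> z0 i)
        + h\<^sup>2 / 2 * (\<Sum>\<sigma>\<in>UNIV. \<Sum>\<mu>\<in>UNIV. diff2 \<sigma> \<mu> i))) \<in> Oh 3"
    and exact3: "(\<lambda>h. y h i - z0 i - (h * (\<Sum>\<sigma>\<in>UNIV. F \<sigma> z0 i)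
        + h\<^sup>2 / 2 * (\<Sum>\<sigma>\<in>UNIV. \<Sum>\<mu>\<in>UNIV. diff2 \<sigma> \<mu> i)
        + h ^ 3 / 6 * (\<Sum>\<sigma>\<in>UNIV. \<Sum>\<mu>\<in>UNIV. \<Sum>\<nu>\<in>UNIV. diff3_tall \<sigma> \<mu> \<nu> i + diff3_bushy \<sigma> \<mu> \<nu> i))) \<in> Oh 4"
    if "i < D" for i
    by (rule exact_solution_expansions[OF T y0 y_der y_off that]; assumption)+
  note approx = method_expansions[OF g[unfolded sol_def], of _ b]

  have second: "order2_conditions M"
    using p by (auto simp: order3_conditions_def)
  have order1: "(\<Sum>j\<in>J. b \<sigma> j) = 1" for \<sigma>
    using second unfolding order2_conditions_def b_def J_def by blast
  have order2: "(\<Sum>j\<in>J. b \<sigma> j * (\<Sum>k\<in>J. A \<mu> j k)) = 1/2" for \<sigma> \<mu>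
  proof -
    have "(\<Sum>j\<in>J. b \<sigma> j * (\<Sum>k\<in>J. A \<mu> j k)) = (\<Sum>j\<in>J. b \<sigma> j * nodes M \<mu> j)"
      by (intro sum.cong refl) (simp add: c)
    also have "\<dots> = 1/2"
      using second unfolding order2_conditions_def b_def J_def by blast
    finally show ?thesis .
  qed
  have rough: "(\<lambda>h. h * (\<Sum>j\<in>J. \<Sum>\<sigma>\<in>UNIV. b \<sigma> j * F \<sigma> (g h j) i) - (y h i - z0 i)) \<in> Oh (p + 1)" if i: "i < d" for i
  proof -
    have iD: "i < D" using i by (simp add: D_def)
    show ?thesis
    proof (cases "p = 2")
      case True
      from Oh_diff[OF approx(1)[OF iD order1 order2] exact2[OF iD]]
      have "(\<lambda>h. h * (\<Sum>j\<in>J. \<Sum>\<sigma>\<in>UNIV. b \<sigma> j * F \<sigma> (g h j) i) - (y h i - z0 i)) \<in> Oh 3"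
        by (simp add: algebra_simps)
      with True show ?thesis by simp
    next
      case False
      then have p3: "p = 3" "order3_conditions M" using p by auto
      have tall: "(\<Sum>j\<in>J. b \<sigma> j * (\<Sum>k\<in>J. A \<mu> j k * (\<Sum>l\<in>J. A \<nu> k l))) = 1/6" for \<sigma> \<mu> \<nu>
      proof -
        have "(\<Sum>j\<in>J. b \<sigma> j * (\<Sum>k\<in>J. A \<mu> j k * (\<Sum>l\<in>J. A \<nu> k l)))
            = (\<Sum>j\<in>J. b \<sigma> j * (\<Sum>k\<in>J. A \<mu> j k * nodes M \<nu> k))"
          by (intro sum.cong refl arg_cong[of _ _ "\<lambda>x. b \<sigma> _ * x"]) (simp add: c)
        also have "\<dots> = 1/6"
          using p3(2) unfolding order3_conditions_def b_def J_def A_def by blast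
        finally show ?thesis .
      qed
      have bushy: "(\<Sum>j\<in>J. b \<sigma> j * ((\<Sum>k\<in>J. A \<mu> j k) * (\<Sum>k\<in>J. A \<nu> j k))) = 1/3" for \<sigma> \<mu> \<nu>
      proof -
        have "(\<Sum>j\<in>J. b \<sigma> j * ((\<Sum>k\<in>J. A \<mu> j k) * (\<Sum>k\<in>J. A \<nu> j k)))
            = (\<Sum>j\<in>J. b \<sigma> j * (nodes M \<mu> j * nodes M \<nu> j))"
          by (intro sum.cong refl) (simp add: c)
        also have "\<dots> = 1/3"
          using p3(2) unfolding order3_conditions_def b_def J_def by blast
        finally show ?thesis .
      qed
      from Oh_diff[OF approx(2)[OF iD order1 order2 tall bushy] exact3[OF iD]]
      have "(\<lambda>h. h * (\<Sum>j\<in>J. \<Sum>\<sigma>\<in>UNIV. b \<sigma> j * F \<sigma> (g h j) i) - (y h i - z0 i)) \<in> Oh 4"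
        by (simp add: algebra_simps)
      with p3 show ?thesis by simp
    qed
  qed
  have same: "\<forall>\<^sub>F h in at_right 0. h * (\<Sum>j\<in>J. \<Sum>\<sigma>\<in>UNIV. b \<sigma> j * F \<sigma> (g h j) i) - (y h i - z0 i)
      = step_result M n s t0 x0 h (G h) i - x (t0 + h) i" if i: "i < d" for i
    using g
  proof eventually_elim
    case (elim h)
    then have g_sol: "stage_solution A F J D z0 \<rho> h (g h)" by (simp add: sol_def)
    note proj = projected_stages(1)[OF rows g_sol[unfolded A_def F_def J_def D_def z0_def]]
    have "F \<sigma> (g h k) i = (if \<sigma> then n (G h k) (t0 + nodes M True k * h) i
        else s (G h k) (t0 + nodes M False k * h) i)" if "k \<in> J" for \<sigma> k
      unfolding F_def
      by (subst proj[OF that[unfolded J_def]]) (simp add: autonomous_at trunc_in_Rn i G_def)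
    then show ?case
      using i by (simp add: step_result_def J_def sum_colours b_def weights_def nodes_def y_def z0_def with_clocks_def)
  qed
  have err: "(\<lambda>h. step_result M n s t0 x0 h (G h) i - x (t0 + h) i) \<in> Oh (p + 1)" if "i < d" for i
    by (rule Oh_cong[OF rough[OF that] same[OF that]])
  show "\<exists>\<rho>>0. \<exists>G.
      (\<forall>\<^sub>F h in at_right 0. stage_eqs M d n s t0 x0 h (G h) \<and> stages_near M d x0 \<rho> (G h) \<and>
         (\<forall>g. stage_eqs M d n s t0 x0 h g \<and> stages_near M d x0 \<rho> g \<longrightarrow> (\<forall>j\<in>{1..stages M}. g j = G h j))) \<and>
      (\<lambda>h. L2_set (\<lambda>i. step_result M n s t0 x0 h (G h) i - x (t0 + h) i) {..<d}) \<in> Oh (p + 1)"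
    by (intro exI[of _ 1] exI[of _ G] conjI zero_less_one unique) (rule Oh_L2_set, rule err)
qed

section \<open>Necessity of the order conditions\<close>

lemma Ck_const: "Ck d k (\<lambda>x t. c)"
proof (induction k arbitrary: c)
  case (Suc k)
  show ?case by (auto simp: case_prod_unfold intro!: exI[of _ "\<lambda>x t. 0"] Suc.IH)
qed (simp add: case_prod_unfold)

lemma continuous_map_coordinate:
  "continuous_map (prod_topology (Euclidean_space d) euclideanreal) euclideanreal (\<lambda>(x, t). x i)"
proof -
  have "continuous_map (Euclidean_space d) euclideanreal (\<lambda>x. x i)"
    unfolding Euclidean_space_def
    by (intro continuous_map_from_subtopology continuous_map_product_projection) simp
  from continuous_map_compose[OF continuous_map_fst this] show ?thesis
    by (simp add: o_def case_prod_unfold)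
qed

lemma Ck_coordinate: "Ck d k (\<lambda>x t. x i)"
proof (cases k)
  case (Suc k')
  have "\<exists>f'. Ck d k' f' \<and> (\<forall>x\<in>Rn d. \<forall>t. ((\<lambda>u. (x(j := u)) i) has_real_derivative f' x t) (at (x j)))" for j
    by (rule exI[of _ "\<lambda>x t. if i = j then 1 else 0"]) (auto intro!: derivative_eq_intros Ck_const)
  moreover have "\<exists>f'. Ck d k' f' \<and> (\<forall>x\<in>Rn d. \<forall>t. ((\<lambda>u. x i) has_real_derivative f' x t) (at t))"
    by (rule exI[of _ "\<lambda>x t. 0"]) (auto intro!: Ck_const)
  ultimately show ?thesis unfolding Suc using continuous_map_coordinate by auto
qed (use continuous_map_coordinate in auto)

lemma Ck_product_of_coordinates:
  assumes "i \<noteq> m"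
  shows "Ck d k (\<lambda>x t. x i * x m)"
proof -
  have cont: "continuous_map (prod_topology (Euclidean_space d) euclideanreal) euclideanreal (\<lambda>(x, t). x i * x m)"
    using continuous_map_real_mult[OF continuous_map_coordinate continuous_map_coordinate, of d i m]
    by (simp add: case_prod_unfold)
  show ?thesis
  proof (cases k)
    case (Suc k')
    have "\<exists>f'. Ck d k' f' \<and> (\<forall>x\<in>Rn d. \<forall>t. ((\<lambda>u. (x(j := u)) i * (x(j := u)) m) has_real_derivative f' x t) (at (x j)))" for j
    proof -
      consider "j = i" | "j = m" | "j \<noteq> i" "j \<noteq> m" by blast
      then show ?thesis
      proof cases
        case 1
        then show ?thesis using assms
          by (intro exI[of _ "\<lambda>x t. x m"]) (auto intro!: derivative_eq_intros Ck_coordinate)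
      next
        case 2
        then show ?thesis using assms
          by (intro exI[of _ "\<lambda>x t. x i"]) (auto intro!: derivative_eq_intros Ck_coordinate)
      next
        case 3
        then show ?thesis
          by (intro exI[of _ "\<lambda>x t. 0"]) (auto intro!: derivative_eq_intros Ck_const)
      qed
    qed
    moreover have "\<exists>f'. Ck d k' f' \<and> (\<forall>x\<in>Rn d. \<forall>t. ((\<lambda>u. x i * x m) has_real_derivative f' x t) (at t))"
      by (rule exI[of _ "\<lambda>x t. 0"]) (auto intro!: Ck_const)
    ultimately show ?thesis unfolding Suc using cont by auto
  qed (use cont in auto)
qed

text \<open>
A monomial cannot be small of an order above its degree. Since the errors of the test problems are
monomials in \<open>h\<close>, this extracts the order conditions.
\<close>

lemma power_coefficient_zero:
  assumes small: "(\<lambda>h. C * h ^ k) \<in> Oh (Suc p)" and "k \<le> p"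
  shows "C = (0::real)"
proof (rule ccontr)
  assume C: "C \<noteq> 0"
  have "(\<lambda>h. C * h ^ k) \<in> Oh (Suc k)"
    using small by (rule Oh_mono) (use assms(2) in simp)
  then obtain K where "\<forall>\<^sub>F h in at_right 0. norm (C * h ^ k) \<le> K * norm (h ^ Suc k)"
    by (rule landau_o.bigE)
  moreover have "\<forall>\<^sub>F h in at_right 0. h \<in> {0<..<\<bar>C\<bar> / (\<bar>K\<bar> + 1)}"
    using C by (intro eventually_at_right_real) auto
  ultimately have "\<forall>\<^sub>F h::real in at_right 0. False"
  proof eventually_elim
    case (elim h)
    then have h: "0 < h" "h * (\<bar>K\<bar> + 1) < \<bar>C\<bar>" by (auto simp: pos_less_divide_eq)
    have "\<bar>C\<bar> * h ^ k \<le> (K * h) * h ^ k" using elim(1) h(1) by (simp add: abs_mult mult_ac)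
    then have "\<bar>C\<bar> \<le> K * h" using h(1) by simp
    also have "\<dots> \<le> \<bar>K\<bar> * h" using h(1) by (intro mult_right_mono) auto
    also have "\<dots> < \<bar>C\<bar>" using h by (simp add: algebra_simps)
    finally show False by simp
  qed
  then show False by (simp add: trivial_limit_at_right_real)
qed

text \<open>
Up to the choice of colours, the equations are \<open>x 0' = 1\<close>, \<open>x 1' = 1\<close>, \<open>x 2' = x 0\<close>,
\<open>x 3' = x 2\<close> and \<open>x 4' = x 1 * x 0\<close>. The components \<open>0\<close>, \<open>2\<close>, \<open>3\<close> and \<open>4\<close> realise the trees with
one, two and three nodes, the colours of the nodes being those of the parts in which the slopes are put;
component \<open>1\<close> only provides a second factor of its own colour.
\<close>

definition test_slope :: "bool \<Rightarrow> bool \<Rightarrow> bool \<Rightarrow> bool \<Rightarrow> vfield" where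
  "test_slope \<sigma> \<mu> \<nu> \<kappa> x t i =
     (if i = 0 then (if \<kappa> = \<nu> then 1 else 0)
      else if i = 1 then (if \<kappa> = \<mu> then 1 else 0)
      else if i = 2 then (if \<kappa> = \<mu> then x 0 else 0)
      else if i = 3 then (if \<kappa> = \<sigma> then x 2 else 0)
      else (if \<kappa> = \<sigma> then x 1 * x 0 else 0))"

definition test_solution :: "real \<Rightarrow> rvec" where
  "test_solution t i =
     (if i = 0 then t else if i = 1 then t else if i = 2 then t\<^sup>2 / 2
      else if i = 3 then t ^ 3 / 6 else if i = 4 then t ^ 3 / 3 else 0)"

lemma Ck_if: "Ck d k f \<Longrightarrow> Ck d k (\<lambda>x t. if Q then f x t else 0)"
  by (cases Q) (simp_all add: Ck_const)

lemma Ck_test: "Ck_field 5 k (test_slope \<sigma> \<mu> \<nu> \<kappa>)"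
  unfolding Ck_field_def
proof (intro allI impI)
  fix i :: nat
  have "Ck 5 k (\<lambda>x t. x 1 * x 0)"
    by (rule Ck_product_of_coordinates) simp
  then show "Ck 5 k (\<lambda>x t. test_slope \<sigma> \<mu> \<nu> \<kappa> x t i)"
    unfolding test_slope_def
    by (cases "i = 0"; cases "i = 1"; cases "i = 2"; cases "i = 3")
       (simp_all add: Ck_if Ck_coordinate Ck_const)
qed

lemma test_slope_total:
  "test_slope \<sigma> \<mu> \<nu> True x t i + test_slope \<sigma> \<mu> \<nu> False x t i =
     (if i = 0 \<or> i = 1 then 1 else if i = 2 then x 0 else if i = 3 then x 2 else x 1 * x 0)"
  by (cases \<sigma>; cases \<mu>; cases \<nu>) (simp_all add: test_slope_def)

lemma test_ivp:
  "solves_ivp 5 (test_slope \<sigma> \<mu> \<nu> True) (test_slope \<sigma> \<mu> \<nu> False) 0 (\<lambda>_. 0) 1 test_solution"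
proof -
  have der: "((\<lambda>u. test_solution u i) has_real_derivative
      (if i = 0 \<or> i = 1 then 1 else if i = 2 then test_solution t 0 else if i = 3 then test_solution t 2
       else test_solution t 1 * test_solution t 0)) (at t)" if "i < 5" for i :: nat and t
  proof -
    consider "i = 0" | "i = 1" | "i = 2" | "i = 3" | "i = 4" using \<open>i < 5\<close> by linarith
    then show ?thesis
    proof cases
      case 3
      have "((\<lambda>u. u\<^sup>2 / 2) has_real_derivative t) (at t)"
        by (auto intro!: derivative_eq_intros)
      then show ?thesis using 3 by (simp add: test_solution_def)
    next
      case 4
      have "((\<lambda>u. u ^ 3 / 6) has_real_derivative t\<^sup>2 / 2) (at t)"
        by (auto intro!: derivative_eq_intros)
      then show ?thesis using 4 by (simp add: test_solution_def)
    next
      case 5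
      have "((\<lambda>u. u ^ 3 / 3) has_real_derivative t * t) (at t)"
        by (auto intro!: derivative_eq_intros simp: power2_eq_square)
      then show ?thesis using 5 by (simp add: test_solution_def)
    qed (simp_all add: test_solution_def)
  qed
  show ?thesis
    unfolding solves_ivp_def test_slope_total
  proof (intro conjI ballI allI impI)
    show "test_solution 0 = (\<lambda>_. 0)"
      by (simp add: test_solution_def fun_eq_iff)
    show "test_solution t \<in> Rn 5" for t
      by (simp add: topspace_Euclidean_space test_solution_def)
  qed (rule has_field_derivative_at_within[OF der])
qed

lemma sum_one_colour:
  "(\<Sum>k\<in>J. f True k * (if True = \<mu> then a k else 0) + f False k * (if False = \<mu> then a k else 0))
    = (\<Sum>k\<in>J. f \<mu> k * a k :: real)"
  by (cases \<mu>) auto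

lemma order_accurateE:
  assumes "order_accurate M p" "1 \<le> d" "\<And>k. Ck_field d k n" "\<And>k. Ck_field d k s" "0 < T"
    and "solves_ivp d n s t0 x0 T x"
  obtains G where "\<forall>\<^sub>F h in at_right 0. stage_eqs M d n s t0 x0 h (G h)"
    and "(\<lambda>h. L2_set (\<lambda>i. step_result M n s t0 x0 h (G h) i - x (t0 + h) i) {..<d}) \<in> Oh (p + 1)"
proof -
  define Q where "Q = (\<lambda>d n s t0 x0 x. \<exists>\<rho>>0. \<exists>G.
              (\<forall>\<^sub>F h in at_right 0.
                 stage_eqs M d n s t0 x0 h (G h) \<and> stages_near M d x0 \<rho> (G h) \<and>
                 (\<forall>g. stage_eqs M d n s t0 x0 h g \<and> stages_near M d x0 \<rho> g \<longrightarrow>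
                      (\<forall>j\<in>{1..stages M}. g j = G h j))) \<and>
              (\<lambda>h. L2_set (\<lambda>i. step_result M n s t0 x0 h (G h) i - x (t0 + h) i) {..<d})
                \<in> Oh (p + 1))"
  obtain K where "\<forall>d\<ge>1. \<forall>n s. Ck_field d K n \<longrightarrow> Ck_field d K s \<longrightarrow>
        (\<forall>t0 x0 T x. T > 0 \<longrightarrow> solves_ivp d n s t0 x0 T x \<longrightarrow> Q d n s t0 x0 x)"
    using assms(1) unfolding order_accurate_def Q_def by (rule exE)
  from this[rule_format, OF assms(2-6)] have "Q d n s t0 x0 x" .
  then obtain G where "\<forall>\<^sub>F h in at_right 0. stage_eqs M d n s t0 x0 h (G h)"
    "(\<lambda>h. L2_set (\<lambda>i. step_result M n s t0 x0 h (G h) i - x (t0 + h) i) {..<d}) \<in> Oh (p + 1)"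
    unfolding Q_def eventually_conj_iff by (elim exE conjE) (rule that, assumption, assumption)
  then show thesis by (rule that)
qed

text \<open>
On the test problem every stage is an explicit multiple of a power of \<open>h\<close>. The result of the step in
component \<open>i\<close> differs from the exact solution by a power of \<open>h\<close> times the defect of one condition.
\<close>

lemma order_conditions_necessary:
  assumes rows: "row_sum_nodes M" and order: "order_accurate M p"
  shows "2 \<le> p \<Longrightarrow> order2_conditions M" and "3 \<le> p \<Longrightarrow> order3_conditions M"
proof -
  let ?J = "{1..stages M}"
  have cond: "(\<Sum>j\<in>?J. weights M \<nu> j) = 1"
      "2 \<le> p \<Longrightarrow> (\<Sum>j\<in>?J. weights M \<mu> j * nodes M \<nu> j) = 1/2"
      "3 \<le> p \<Longrightarrow> (\<Sum>j\<in>?J. weights M \<sigma> j * (\<Sum>k\<in>?J. tableau M \<mu> j k * nodes M \<nu> k)) = 1/6"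
      "3 \<le> p \<Longrightarrow> (\<Sum>j\<in>?J. weights M \<sigma> j * (nodes M \<mu> j * nodes M \<nu> j)) = 1/3" if "1 \<le> p" for \<sigma> \<mu> \<nu>
  proof -
    let ?F = "test_slope \<sigma> \<mu> \<nu>"
    obtain G where "\<forall>\<^sub>F h in at_right 0. stage_eqs M 5 (?F True) (?F False) 0 (\<lambda>_. 0) h (G h)"
      and small: "(\<lambda>h. L2_set (\<lambda>i. step_result M (?F True) (?F False) 0 (\<lambda>_. 0) h (G h) i
                       - test_solution (0 + h) i) {..<5}) \<in> Oh (p + 1)"
      by (rule order_accurateE[OF order _ Ck_test Ck_test zero_less_one test_ivp], simp, rule that)
    from this(1) have eqs: "\<forall>\<^sub>F h in at_right 0. \<forall>j\<in>?J. \<forall>i<5. G h j i =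
       h * (\<Sum>k\<in>?J. tableau M True j k * ?F True (G h k) (nodes M True k * h) i
                          + tableau M False j k * ?F False (G h k) (nodes M False k * h) i)"
      by eventually_elim (simp add: stage_eqs_iff)
    have err: "(\<lambda>h. step_result M (?F True) (?F False) 0 (\<lambda>_. 0) h (G h) i - test_solution h i) \<in> Oh (Suc p)"
      if "i < 5" for i
    proof -
      have "(\<lambda>h. step_result M (?F True) (?F False) 0 (\<lambda>_. 0) h (G h) i - test_solution (0 + h) i)
          \<in> O[at_right 0](\<lambda>h. L2_set (\<lambda>i. step_result M (?F True) (?F False) 0 (\<lambda>_. 0) h (G h) i
                       - test_solution (0 + h) i) {..<5})"
      proof (intro landau_o.big_mono always_eventually allI)
        fix h
        let ?e = "\<lambda>i. step_result M (?F True) (?F False) 0 (\<lambda>_. 0) h (G h) i - test_solution (0 + h) i"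
        have "\<bar>?e i\<bar> \<le> L2_set (\<lambda>i. \<bar>?e i\<bar>) {..<5}"
          using that by (intro member_le_L2_set) auto
        then show "norm (?e i) \<le> norm (L2_set ?e {..<5})"
          by (simp add: L2_set_def)
      qed
      from landau_o.big_trans[OF this small] show ?thesis by simp
    qed
    have result: "step_result M (?F True) (?F False) 0 (\<lambda>_. 0) h (G h) i =
        h * (\<Sum>k\<in>?J. weights M True k * ?F True (G h k) (nodes M True k * h) i
                  + weights M False k * ?F False (G h k) (nodes M False k * h) i)" for h i
      by (simp add: step_result_def weights_def nodes_def)
    have stages: "\<forall>\<^sub>F h in at_right 0. \<forall>j\<in>?J. G h j 0 = h * nodes M \<nu> j \<and> G h j 1 = h * nodes M \<mu> j \<and>
        G h j 2 = h\<^sup>2 * (\<Sum>k\<in>?J. tableau M \<mu> j k * nodes M \<nu> k)"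
      using eqs
    proof eventually_elim
      case (elim h)
      have row: "G h j i = h * (\<Sum>k\<in>?J. tableau M True j k * ?F True (G h k) (nodes M True k * h) i
          + tableau M False j k * ?F False (G h k) (nodes M False k * h) i)" if "j \<in> ?J" "i < 5" for j i
        using elim that by blast
      have first: "G h j 0 = h * nodes M \<nu> j" if "j \<in> ?J" for j
        using row[OF that, of 0] sum_one_colour[of "\<lambda>\<kappa>. tableau M \<kappa> j" \<nu> "\<lambda>_. 1" ?J] row_sum_nodesD[OF rows that]
        by (simp add: test_slope_def)
      have second: "G h j 1 = h * nodes M \<mu> j" if "j \<in> ?J" for j
        using row[OF that, of 1] sum_one_colour[of "\<lambda>\<kappa>. tableau M \<kappa> j" \<mu> "\<lambda>_. 1" ?J] row_sum_nodesD[OF rows that]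
        by (simp add: test_slope_def)
      have "G h j 2 = h\<^sup>2 * (\<Sum>k\<in>?J. tableau M \<mu> j k * nodes M \<nu> k)" if "j \<in> ?J" for j
      proof -
        have "G h j 2 = h * (\<Sum>k\<in>?J. tableau M \<mu> j k * G h k 0)"
          using row[OF that, of 2] sum_one_colour[of "\<lambda>\<kappa>. tableau M \<kappa> j" \<mu> "\<lambda>k. G h k 0" ?J]
          by (simp add: test_slope_def)
        then show ?thesis
          by (simp add: first power2_eq_square sum_distrib_left mult_ac)
      qed
      with first second show ?case by blast
    qed
    have zero: "C = 0"
      if "i < 5" "k \<le> p" "\<forall>\<^sub>F h in at_right 0. step_result M (?F True) (?F False) 0 (\<lambda>_. 0) h (G h) i
           - test_solution h i = C * h ^ k" for i k C
      using power_coefficient_zero[OF Oh_cong[OF err[OF that(1)] that(3)] that(2)] .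
    have "(\<Sum>j\<in>?J. weights M \<nu> j) - 1 = 0"
      using \<open>1 \<le> p\<close> sum_one_colour[of "weights M" \<nu> "\<lambda>_. 1" ?J]
      by (intro zero[of 0 1] always_eventually) (simp_all add: result test_slope_def test_solution_def algebra_simps)
    then show "(\<Sum>j\<in>?J. weights M \<nu> j) = 1" by simp
    have "(\<Sum>j\<in>?J. weights M \<mu> j * nodes M \<nu> j) - 1/2 = 0" if "2 \<le> p"
    proof (rule zero[of 2 2])
      show "\<forall>\<^sub>F h in at_right 0. step_result M (?F True) (?F False) 0 (\<lambda>_. 0) h (G h) 2 - test_solution h 2
          = ((\<Sum>j\<in>?J. weights M \<mu> j * nodes M \<nu> j) - 1/2) * h ^ 2"
        using stages
      proof eventually_elim
        case (elim h)
        have "step_result M (?F True) (?F False) 0 (\<lambda>_. 0) h (G h) 2 = h * (\<Sum>k\<in>?J. weights M \<mu> k * G h k 0)"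
          using sum_one_colour[of "weights M" \<mu> "\<lambda>k. G h k 0" ?J] by (simp add: result test_slope_def)
        also have "\<dots> = h\<^sup>2 * (\<Sum>j\<in>?J. weights M \<mu> j * nodes M \<nu> j)"
          using elim by (simp add: power2_eq_square sum_distrib_left mult_ac)
        finally show ?case by (simp add: test_solution_def algebra_simps)
      qed
    qed (use that in auto)
    then show "(\<Sum>j\<in>?J. weights M \<mu> j * nodes M \<nu> j) = 1/2" if "2 \<le> p" using that by simp
    have "(\<Sum>j\<in>?J. weights M \<sigma> j * (\<Sum>k\<in>?J. tableau M \<mu> j k * nodes M \<nu> k)) - 1/6 = 0" if "3 \<le> p"
    proof (rule zero[of 3 3])
      show "\<forall>\<^sub>F h in at_right 0. step_result M (?F True) (?F False) 0 (\<lambda>_. 0) h (G h) 3 - test_solution h 3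
          = ((\<Sum>j\<in>?J. weights M \<sigma> j * (\<Sum>k\<in>?J. tableau M \<mu> j k * nodes M \<nu> k)) - 1/6) * h ^ 3"
        using stages
      proof eventually_elim
        case (elim h)
        have "step_result M (?F True) (?F False) 0 (\<lambda>_. 0) h (G h) 3 = h * (\<Sum>k\<in>?J. weights M \<sigma> k * G h k 2)"
          using sum_one_colour[of "weights M" \<sigma> "\<lambda>k. G h k 2" ?J] by (simp add: result test_slope_def)
        also have "\<dots> = h * (\<Sum>j\<in>?J. weights M \<sigma> j * (h\<^sup>2 * (\<Sum>k\<in>?J. tableau M \<mu> j k * nodes M \<nu> k)))"
          using elim by simp
        also have "\<dots> = h ^ 3 * (\<Sum>j\<in>?J. weights M \<sigma> j * (\<Sum>k\<in>?J. tableau M \<mu> j k * nodes M \<nu> k))"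
          by (simp add: power2_eq_square power3_eq_cube sum_distrib_left mult_ac)
        finally show ?case by (simp add: test_solution_def algebra_simps)
      qed
    qed (use that in auto)
    then show "(\<Sum>j\<in>?J. weights M \<sigma> j * (\<Sum>k\<in>?J. tableau M \<mu> j k * nodes M \<nu> k)) = 1/6" if "3 \<le> p"
      using that by simp
    have "(\<Sum>j\<in>?J. weights M \<sigma> j * (nodes M \<mu> j * nodes M \<nu> j)) - 1/3 = 0" if "3 \<le> p"
    proof (rule zero[of 4 3])
      show "\<forall>\<^sub>F h in at_right 0. step_result M (?F True) (?F False) 0 (\<lambda>_. 0) h (G h) 4 - test_solution h 4
          = ((\<Sum>j\<in>?J. weights M \<sigma> j * (nodes M \<mu> j * nodes M \<nu> j)) - 1/3) * h ^ 3"
        using stages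
      proof eventually_elim
        case (elim h)
        have "step_result M (?F True) (?F False) 0 (\<lambda>_. 0) h (G h) 4 = h * (\<Sum>k\<in>?J. weights M \<sigma> k * (G h k 1 * G h k 0))"
          using sum_one_colour[of "weights M" \<sigma> "\<lambda>k. G h k 1 * G h k 0" ?J] by (simp add: result test_slope_def)
        also have "\<dots> = h * (\<Sum>j\<in>?J. weights M \<sigma> j * ((h * nodes M \<mu> j) * (h * nodes M \<nu> j)))"
          using elim by simp
        also have "\<dots> = h ^ 3 * (\<Sum>j\<in>?J. weights M \<sigma> j * (nodes M \<mu> j * nodes M \<nu> j))"
          by (simp add: power3_eq_cube sum_distrib_left mult_ac)
        finally show ?case by (simp add: test_solution_def algebra_simps)
      qed
    qed (use that in auto)
    then show "(\<Sum>j\<in>?J. weights M \<sigma> j * (nodes M \<mu> j * nodes M \<nu> j)) = 1/3" if "3 \<le> p"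
      using that by simp
  qed
  show "2 \<le> p \<Longrightarrow> order2_conditions M" "3 \<le> p \<Longrightarrow> order3_conditions M"
    unfolding order2_conditions_def order3_conditions_def using cond by auto
qed

text \<open>
The order conditions for arbitrary IMEX methods whose nodes are row sums.
\<close>

theorem order_accurate_iff:
  assumes "row_sum_nodes M"
  shows "order_accurate M 2 \<longleftrightarrow> order2_conditions M"
    and "order_accurate M 3 \<longleftrightarrow> order3_conditions M"
proof -
  show "order_accurate M 2 \<longleftrightarrow> order2_conditions M"
    using order_conditions_sufficient[OF assms, of 2] order_conditions_necessary(1)[OF assms, of 2] by blast
  show "order_accurate M 3 \<longleftrightarrow> order3_conditions M"
    using order_conditions_sufficient[OF assms, of 3] order_conditions_necessary(2)[OF assms, of 3] by blast
qed

section \<open>The order conditions of the family\<close>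

text \<open>
The explicit and the implicit part of the family are described together: \<open>sub\<close>, \<open>first\<close> and \<open>diag\<close> are
the subdiagonal, the first column and the diagonal of the tableau of either colour, with indices as in
the coefficient sequences. By the convention that coefficients with nonpositive index vanish, the formula
for a row in \<open>row_M\<close> also holds for row \<open>2\<close>, where subdiagonal and first column meet, and the formula
in \<open>node_M\<close> also holds for stage \<open>1\<close>.
\<close>

locale subdiagonal_family =
  fixes q :: nat and \<alpha> \<beta> \<alpha>' \<beta>' d' :: "int \<Rightarrow> real" and M :: imex
    and sub first diag :: "bool \<Rightarrow> int \<Rightarrow> real"
  defines "M \<equiv> imex_family q \<alpha> \<beta> \<alpha>' \<beta>' d'"
    and "sub \<equiv> \<lambda>\<sigma>. if \<sigma> then \<alpha> else \<alpha>'"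
    and "first \<equiv> \<lambda>\<sigma>. if \<sigma> then \<beta> else \<beta>'"
    and "diag \<equiv> \<lambda>\<sigma> k. if \<sigma> then 0 else d' k"
  assumes q: "2 \<le> q"
    and nonpos: "\<And>\<sigma> k. k \<le> 0 \<Longrightarrow> sub \<sigma> k = 0" "\<And>\<sigma> k. k \<le> 0 \<Longrightarrow> first \<sigma> k = 0" "\<And>\<sigma> k. k \<le> 0 \<Longrightarrow> diag \<sigma> k = 0"
begin

lemma stages_M: "stages M = q + 1"
  by (simp add: M_def imex_family_def)

lemma tableau_M:
  assumes "2 \<le> j" "j \<le> q + 1" "1 \<le> k"
  shows "tableau M \<sigma> j k = (if k = j - 1 then sub \<sigma> (int j - 1) else 0) + (if k = 1 then first \<sigma> (int j - 2) else 0)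
     + (if k = j \<and> j \<le> q then diag \<sigma> (int j - 1) else 0)"
  using assms nonpos(2)[of 0 \<sigma>]
  by (auto simp: tableau_def M_def imex_family_def family_A_def family_Ahat_def sub_def first_def diag_def)

lemma tableau_M_first_row: "1 \<le> k \<Longrightarrow> tableau M \<sigma> 1 k = 0"
  by (auto simp: tableau_def M_def imex_family_def family_A_def family_Ahat_def)

lemma row_M:
  assumes "2 \<le> j" "j \<le> q + 1"
  shows "(\<Sum>k\<in>{1..q+1}. tableau M \<sigma> j k * f k) = sub \<sigma> (int j - 1) * f (j - 1) + first \<sigma> (int j - 2) * f 1
     + (if j \<le> q then diag \<sigma> (int j - 1) * f j else 0)"
proof -
  have "(\<Sum>k\<in>{1..q+1}. tableau M \<sigma> j k * f k) = (\<Sum>k\<in>{1..q+1}. (if k = j - 1 then sub \<sigma> (int j - 1) * f (j - 1) else 0)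
     + (if k = 1 then first \<sigma> (int j - 2) * f 1 else 0)
     + (if k = j then (if j \<le> q then diag \<sigma> (int j - 1) * f j else 0) else 0))"
    using assms by (intro sum.cong refl) (auto simp: tableau_M distrib_right)
  also have "\<dots> = sub \<sigma> (int j - 1) * f (j - 1) + first \<sigma> (int j - 2) * f 1
     + (if j \<le> q then diag \<sigma> (int j - 1) * f j else 0)"
  proof -
    have "j - 1 \<in> {1..q+1}" "1 \<in> {1..q+1}" "j \<in> {1..q+1}" using assms by auto
    then show ?thesis by (simp only: sum.distrib sum.delta finite_atLeastAtMost if_True)
  qed
  finally show ?thesis .
qed

lemma row_sum_nodes_M: "row_sum_nodes M"
  unfolding row_sum_nodes_def
proof (intro allI ballI)
  fix \<sigma> j assume "j \<in> {1..stages M}"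
  then show "nodes M \<sigma> j = (\<Sum>k\<in>{1..stages M}. tableau M \<sigma> j k)"
    by (auto simp: nodes_def tableau_def M_def imex_family_def family_A_def family_Ahat_def intro!: sum.cong)
qed

lemma node_M_first: "nodes M \<sigma> 1 = 0"
  using row_sum_nodesD[OF row_sum_nodes_M, of 1 \<sigma>] tableau_M_first_row[of _ \<sigma>] by (simp add: stages_M)

lemma node_M:
  assumes "1 \<le> j" "j \<le> q"
  shows "nodes M \<sigma> j = sub \<sigma> (int j - 1) + first \<sigma> (int j - 2) + diag \<sigma> (int j - 1)"
proof (cases "j = 1")
  case True
  then show ?thesis using nonpos by (simp add: node_M_first[simplified])
next
  case False
  then show ?thesis
    using assms row_M[of j \<sigma> "\<lambda>_. 1"] row_sum_nodesD[OF row_sum_nodes_M, of j \<sigma>] by (simp add: stages_M)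
qed

text \<open>
The weights are the last row, which has no diagonal entry. As the first node is zero, only stage \<open>q\<close>
survives in the conditions of order two and three.
\<close>

lemma weighted_sum_M:
  "(\<Sum>j\<in>{1..q+1}. weights M \<sigma> j * f j) = sub \<sigma> (int q) * f q + first \<sigma> (int q - 1) * f 1"
proof -
  have "weights M \<sigma> j = tableau M \<sigma> (q + 1) j" if "j \<in> {1..q+1}" for j
    using that by (auto simp: weights_def tableau_def M_def imex_family_def family_A_def family_Ahat_def)
  then have "(\<Sum>j\<in>{1..q+1}. weights M \<sigma> j * f j) = (\<Sum>j\<in>{1..q+1}. tableau M \<sigma> (q + 1) j * f j)"
    by (intro sum.cong) auto
  then show ?thesis
    using row_M[of "q + 1" \<sigma> f] q by simp
qed

lemma order2_conditions_M:
  "order2_conditions M \<longleftrightarrow> (\<forall>\<sigma>. sub \<sigma> (int q) + first \<sigma> (int q - 1) = 1) \<and>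
     (\<forall>\<sigma> \<mu>. sub \<sigma> (int q) * nodes M \<mu> q = 1/2)"
  using weighted_sum_M[of _ "\<lambda>_. 1"]
  by (simp add: order2_conditions_def stages_M weighted_sum_M[simplified] node_M_first[simplified])

lemma order3_conditions_M:
  "order3_conditions M \<longleftrightarrow> order2_conditions M \<and>
     (\<forall>\<sigma> \<mu> \<nu>. sub \<sigma> (int q) * (sub \<mu> (int q - 1) * nodes M \<nu> (q - 1) + diag \<mu> (int q - 1) * nodes M \<nu> q) = 1/6) \<and>
     (\<forall>\<sigma> \<mu> \<nu>. sub \<sigma> (int q) * (nodes M \<mu> q * nodes M \<nu> q) = 1/3)"
proof -
  have "(\<Sum>k\<in>{1..q+1}. tableau M \<mu> q k * nodes M \<nu> k)
      = sub \<mu> (int q - 1) * nodes M \<nu> (q - 1) + diag \<mu> (int q - 1) * nodes M \<nu> q" for \<mu> \<nu>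
    using row_M[of q \<mu> "nodes M \<nu>"] q by (simp add: node_M_first[simplified])
  moreover have "(\<Sum>k\<in>{1..q+1}. tableau M \<mu> 1 k * nodes M \<nu> k) = 0" for \<mu> \<nu>
    by (intro sum.neutral) (simp add: tableau_M_first_row[simplified])
  ultimately show ?thesis
    by (simp only: order3_conditions_def stages_M weighted_sum_M node_M_first) simp
qed

end

text \<open>
Dividing \<open>a * c\<^sup>2 = 1/3\<close> by \<open>a * c = 1/2\<close> gives \<open>c\<close>; then \<open>a\<close>, \<open>b\<close> and the remaining equations
follow by substitution.
\<close>

lemma third_order_system:
  fixes a b c p e \<delta> :: "bool \<Rightarrow> real"
  shows "((\<forall>\<sigma>. a \<sigma> + b \<sigma> = 1) \<and> (\<forall>\<sigma> \<mu>. a \<sigma> * c \<mu> = 1/2)) \<and>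
      (\<forall>\<sigma> \<mu> \<nu>. a \<sigma> * (p \<mu> * e \<nu> + \<delta> \<mu> * c \<nu>) = 1/6) \<and> (\<forall>\<sigma> \<mu> \<nu>. a \<sigma> * (c \<mu> * c \<nu>) = 1/3)
    \<longleftrightarrow> (\<forall>\<sigma>. a \<sigma> = 3/4 \<and> b \<sigma> = 1/4 \<and> c \<sigma> = 2/3) \<and> (\<forall>\<mu> \<nu>. p \<mu> * e \<nu> + 2/3 * \<delta> \<mu> = 2/9)"
    (is "?L \<longleftrightarrow> ?R")
proof
  assume L: ?L
  have c: "c \<mu> = 2/3" for \<mu>
  proof -
    have "1/2 * c \<mu> = a \<mu> * (c \<mu> * c \<mu>)" using L by (simp add: mult.assoc[symmetric])
    then show ?thesis using L by simp
  qed
  have a: "a \<sigma> = 3/4" for \<sigma>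
  proof -
    have "a \<sigma> * c \<sigma> = 1/2" using L by blast
    then show ?thesis by (simp add: c)
  qed
  have b: "b \<sigma> = 1/4" for \<sigma>
  proof -
    have "a \<sigma> + b \<sigma> = 1" using L by blast
    then show ?thesis by (simp add: a)
  qed
  have "p \<mu> * e \<nu> + 2/3 * \<delta> \<mu> = 2/9" for \<mu> \<nu>
  proof -
    have "a True * (p \<mu> * e \<nu> + \<delta> \<mu> * c \<nu>) = 1/6" using L by blast
    then show ?thesis by (simp add: a c)
  qed
  with a b c show ?R by blast
next
  assume R: ?R
  have vals: "a \<sigma> = 3/4" "b \<sigma> = 1/4" "c \<sigma> = 2/3" for \<sigma>
    using R by blast+
  have "p \<mu> * e \<nu> + \<delta> \<mu> * (2/3) = 2/9" for \<mu> \<nu>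
  proof -
    have "p \<mu> * e \<nu> + 2/3 * \<delta> \<mu> = 2/9" using R by blast
    then show ?thesis by (simp add: mult.commute)
  qed
  then show ?L by (simp only: vals) simp
qed

theorem theorem3p1:
  fixes q :: nat
    and \<alpha> \<beta> \<alpha>' \<beta>' d' :: "int \<Rightarrow> real"
  assumes "2 \<le> q"
    and "\<And>k. k \<le> 0 \<Longrightarrow> \<alpha> k = 0"
    and "\<And>k. k \<le> 0 \<Longrightarrow> \<beta> k = 0"
    and "\<And>k. k \<le> 0 \<Longrightarrow> \<alpha>' k = 0"
    and "\<And>k. k \<le> 0 \<Longrightarrow> \<beta>' k = 0"
    and "\<And>k. k \<le> 0 \<Longrightarrow> d' k = 0"
  shows
    "(order_accurate (imex_family q \<alpha> \<beta> \<alpha>' \<beta>' d') 2 \<longleftrightarrow>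
        \<alpha> (int q) * (\<beta> (int q - 2) + \<alpha> (int q - 1)) = 1/2 \<and>
        \<alpha> (int q) * (\<beta>' (int q - 2) + \<alpha>' (int q - 1) + d' (int q - 1)) = 1/2 \<and>
        \<alpha>' (int q) * (\<beta>' (int q - 2) + \<alpha>' (int q - 1) + d' (int q - 1)) = 1/2 \<and>
        \<alpha>' (int q) * (\<beta> (int q - 2) + \<alpha> (int q - 1)) = 1/2 \<and>
        \<alpha> (int q) + \<beta> (int q - 1) = 1 \<and>
        \<alpha>' (int q) + \<beta>' (int q - 1) = 1)
     \<and>
     (\<beta> (int q - 1) = 0 \<and> \<beta>' (int q - 1) = 0 \<and> \<beta> (int q - 2) = 0 \<and> \<beta>' (int q - 2) = 0 \<longrightarrow>
        ((\<alpha> (int q) * (\<beta> (int q - 2) + \<alpha> (int q - 1)) = 1/2 \<and>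
          \<alpha> (int q) * (\<beta>' (int q - 2) + \<alpha>' (int q - 1) + d' (int q - 1)) = 1/2 \<and>
          \<alpha>' (int q) * (\<beta>' (int q - 2) + \<alpha>' (int q - 1) + d' (int q - 1)) = 1/2 \<and>
          \<alpha>' (int q) * (\<beta> (int q - 2) + \<alpha> (int q - 1)) = 1/2 \<and>
          \<alpha> (int q) + \<beta> (int q - 1) = 1 \<and>
          \<alpha>' (int q) + \<beta>' (int q - 1) = 1)
         \<longleftrightarrow>
         \<alpha> (int q) = 1 \<and> \<alpha>' (int q) = 1 \<and> \<alpha> (int q - 1) = 1/2 \<and>
         \<alpha>' (int q - 1) + d' (int q - 1) = 1/2))
     \<and>
     (order_accurate (imex_family q \<alpha> \<beta> \<alpha>' \<beta>' d') 3 \<longleftrightarrow>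
        \<alpha> (int q) = 3/4 \<and> \<alpha>' (int q) = 3/4 \<and>
        \<beta> (int q - 1) = 1/4 \<and> \<beta>' (int q - 1) = 1/4 \<and>
        \<alpha>' (int q - 1) * (\<alpha>' (int q - 2) + d' (int q - 2) + \<beta>' (int q - 3))
          + 2/3 * d' (int q - 1) = 2/9 \<and>
        \<alpha>' (int q - 1) * (\<alpha> (int q - 2) + \<beta> (int q - 3)) + 2/3 * d' (int q - 1) = 2/9 \<and>
        \<alpha> (int q - 1) * (\<alpha>' (int q - 2) + d' (int q - 2) + \<beta>' (int q - 3)) = 2/9 \<and>
        \<alpha> (int q - 1) * (\<alpha> (int q - 2) + \<beta> (int q - 3)) = 2/9 \<and>
        \<alpha>' (int q - 1) + d' (int q - 1) + \<beta>' (int q - 2) = 2/3 \<and>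
        \<alpha> (int q - 1) + \<beta> (int q - 2) = 2/3)"
proof -
  let ?sub = "\<lambda>\<sigma>. if \<sigma> then \<alpha> else \<alpha>'"
  let ?first = "\<lambda>\<sigma>. if \<sigma> then \<beta> else \<beta>'"
  let ?diag = "\<lambda>\<sigma> k. if \<sigma> then 0 else d' k"
  let ?M = "imex_family q \<alpha> \<beta> \<alpha>' \<beta>' d'"
  interpret subdiagonal_family q \<alpha> \<beta> \<alpha>' \<beta>' d' ?M ?sub ?first ?diag
    by unfold_locales (use assms in auto)
  have node: "nodes ?M \<sigma> q = ?sub \<sigma> (int q - 1) + ?first \<sigma> (int q - 2) + ?diag \<sigma> (int q - 1)" for \<sigma>
    using node_M[of q \<sigma>] q by simp
  have node': "nodes ?M \<sigma> (q - 1) = ?sub \<sigma> (int q - 2) + ?first \<sigma> (int q - 3) + ?diag \<sigma> (int q - 2)" for \<sigma>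
    using node_M[of "q - 1" \<sigma>] q by (simp add: of_nat_diff)
  show ?thesis
  proof (intro conjI)
    show "order_accurate ?M 2 \<longleftrightarrow>
        \<alpha> (int q) * (\<beta> (int q - 2) + \<alpha> (int q - 1)) = 1/2 \<and>
        \<alpha> (int q) * (\<beta>' (int q - 2) + \<alpha>' (int q - 1) + d' (int q - 1)) = 1/2 \<and>
        \<alpha>' (int q) * (\<beta>' (int q - 2) + \<alpha>' (int q - 1) + d' (int q - 1)) = 1/2 \<and>
        \<alpha>' (int q) * (\<beta> (int q - 2) + \<alpha> (int q - 1)) = 1/2 \<and>
        \<alpha> (int q) + \<beta> (int q - 1) = 1 \<and>
        \<alpha>' (int q) + \<beta>' (int q - 1) = 1"
      unfolding order_accurate_iff[OF row_sum_nodes_M] order2_conditions_M all_bool_eq node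
      by (auto simp: add_ac)
    show "order_accurate ?M 3 \<longleftrightarrow>
        \<alpha> (int q) = 3/4 \<and> \<alpha>' (int q) = 3/4 \<and>
        \<beta> (int q - 1) = 1/4 \<and> \<beta>' (int q - 1) = 1/4 \<and>
        \<alpha>' (int q - 1) * (\<alpha>' (int q - 2) + d' (int q - 2) + \<beta>' (int q - 3))
          + 2/3 * d' (int q - 1) = 2/9 \<and>
        \<alpha>' (int q - 1) * (\<alpha> (int q - 2) + \<beta> (int q - 3)) + 2/3 * d' (int q - 1) = 2/9 \<and>
        \<alpha> (int q - 1) * (\<alpha>' (int q - 2) + d' (int q - 2) + \<beta>' (int q - 3)) = 2/9 \<and>
        \<alpha> (int q - 1) * (\<alpha> (int q - 2) + \<beta> (int q - 3)) = 2/9 \<and>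
        \<alpha>' (int q - 1) + d' (int q - 1) + \<beta>' (int q - 2) = 2/3 \<and>
        \<alpha> (int q - 1) + \<beta> (int q - 2) = 2/3"
      unfolding order_accurate_iff[OF row_sum_nodes_M] order3_conditions_M order2_conditions_M
      unfolding third_order_system
      unfolding all_bool_eq node node'
      by (auto simp: add_ac)
    show "\<beta> (int q - 1) = 0 \<and> \<beta>' (int q - 1) = 0 \<and> \<beta> (int q - 2) = 0 \<and> \<beta>' (int q - 2) = 0 \<longrightarrow>
        ((\<alpha> (int q) * (\<beta> (int q - 2) + \<alpha> (int q - 1)) = 1/2 \<and>
          \<alpha> (int q) * (\<beta>' (int q - 2) + \<alpha>' (int q - 1) + d' (int q - 1)) = 1/2 \<and>
          \<alpha>' (int q) * (\<beta>' (int q - 2) + \<alpha>' (int q - 1) + d' (int q - 1)) = 1/2 \<and>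
          \<alpha>' (int q) * (\<beta> (int q - 2) + \<alpha> (int q - 1)) = 1/2 \<and>
          \<alpha> (int q) + \<beta> (int q - 1) = 1 \<and>
          \<alpha>' (int q) + \<beta>' (int q - 1) = 1)
         \<longleftrightarrow>
         \<alpha> (int q) = 1 \<and> \<alpha>' (int q) = 1 \<and> \<alpha> (int q - 1) = 1/2 \<and>
         \<alpha>' (int q - 1) + d' (int q - 1) = 1/2)"
      by auto
  qed
qed

end
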